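(* Let $R$ be a non-archimedean real closed field, let $p_1,\dots,p_m\in R[X_1,\dots,X_n]$ be polynomials and $g_1,\dots,g_l\in L=R(X_1,\dots,X_n)$ rational functions, and set \[T_{\bar p,\bar g}=\{\bar b\in R^n : p_1(\bar b),\dots,p_m(\bar b)>0 \text{ and } g_1,\dots,g_l \text{ are finitary at } \bar b\}.\] Let $I_{\bar p}=\{\frac{1}{1+f}: f\in \mathrm{Cone}(\bar p)\}$ and let $A_{\bar p,\bar g}$ be the $O_R$-subalgebra of $L$ generated by $I_{\bar p}\cup\{g_1,\dots,g_l\}$. Then for any $h\in L$, $h$ is finitary on $T_{\bar p,\bar g}$ (i.e. finitary at every point of $T_{\bar p,\bar g}$) if and only if $h\in\sqrt[int]{A_{\bar p,\bar g}}$.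
   Context: The finite part of $R$ is the convex hull of $\mathbb{Z}$ in $R$; it equals the valuation ring $O_R=\{x: v(x)\ge 0\}$ of the canonical (non-trivial, since $R$ is non-archimedean) valuation $v$ on $R$, with maximal ideal $\mathcal{M}_R=\{x: v(x)>0\}$. A function $f\in R(\bar X)$ is finitary at $\bar b\in R^n$ if there is a neighborhood of $\bar b$ (in the order topology of $R^n$) on which every defined value $f(\bar x)$ lies in the finite part of $R$. $\mathrm{Cone}(\bar p)$ denotes the positive cone in $L$ generated by $p_1,\dots,p_m$ (the smallest subset of $L$ containing all squares of $L$ and $p_1,\dots,p_m$ and closed under addition and multiplication). For an $O_R$-subalgebra $A\subseteq L$, let $T_A=\{1+ma: m\in\mathcal{M}_R, a\in A\}$ (a multiplicative set); the integral radical $\sqrt[int]{A}$ is the integral closure in $L$ of the localization $A_{T_A}$.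
   Formalization: The polynomials p_i are assumed nonzero (for m=1, p_1=0, l=0 the claim fails: T is empty, yet X_1 is not in the integral radical); 1/(1+f) is taken only when 1+f≠0, and A_{T_A} is formed inside L by inverting only the nonzero elements of T_A. *)

theory Defs
  imports
    "HOL-Analysis.Finite_Cartesian_Product"
    "HOL-Library.Poly_Mapping"
    "HOL-Computational_Algebra.Polynomial_Factorial"
begin

definition real_closed :: "'a::linordered_field itself \<Rightarrow> bool" where
  "real_closed _ \<longleftrightarrow>
    (\<forall>x::'a. 0 \<le> x \<longrightarrow> (\<exists>y. x = y * y)) \<and>
    (\<forall>p::'a poly. odd (degree p) \<longrightarrow> (\<exists>x. poly p x = 0))"

definition non_archimedean :: "'a::linordered_field itself \<Rightarrow> bool" where
  "non_archimedean _ \<longleftrightarrow> (\<exists>x::'a. \<forall>k::nat. of_nat k < x)"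


text \<open>The convex hull of the integers.\<close>

definition finite_part :: "'a::linordered_field set" where
  "finite_part = {x. \<exists>a b :: int. of_int a \<le> x \<and> x \<le> of_int b}"

text \<open>The maximal ideal of the valuation ring \<^const>\<open>finite_part\<close>, i.e. its set of non-units.\<close>

definition finite_part_max_ideal :: "'a::linordered_field set" where
  "finite_part_max_ideal = {x \<in> finite_part. \<not> (\<exists>y \<in> finite_part. x * y = 1)}"

lemma finite_part_iff: "x \<in> finite_part \<longleftrightarrow> (\<exists>k::nat. \<bar>x\<bar> \<le> of_nat k)"
proof
  assume "x \<in> finite_part"
  then obtain a b :: int where ab: "of_int a \<le> x" "x \<le> of_int b"
    unfolding finite_part_def by blast
  have "of_int a \<ge> - (of_int \<bar>a\<bar> :: 'a)" "of_int b \<le> (of_int \<bar>b\<bar> :: 'a)"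
    by (simp_all add: abs_le_D2 flip: of_int_minus)
  moreover have "(of_int \<bar>a\<bar> :: 'a) \<ge> 0" "(of_int \<bar>b\<bar> :: 'a) \<ge> 0"
    by simp_all
  ultimately have "\<bar>x\<bar> \<le> of_int \<bar>a\<bar> + of_int \<bar>b\<bar>"
    using ab by linarith
  also have "\<dots> = of_nat (nat (\<bar>a\<bar> + \<bar>b\<bar>))"
    by simp
  finally show "\<exists>k::nat. \<bar>x\<bar> \<le> of_nat k" ..
next
  assume "\<exists>k::nat. \<bar>x\<bar> \<le> of_nat k"
  then obtain k :: nat where "\<bar>x\<bar> \<le> of_nat k" ..
  then have "of_int (- int k) \<le> x \<and> x \<le> of_int (int k)"
    by (auto simp: abs_le_iff)
  then show "x \<in> finite_part"
    unfolding finite_part_def by blast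
qed

lemma finite_part_max_ideal_iff:
  "x \<in> finite_part_max_ideal \<longleftrightarrow> (\<forall>k::nat. of_nat k * \<bar>x\<bar> < 1)"
proof
  assume x: "x \<in> finite_part_max_ideal"
  show "\<forall>k::nat. of_nat k * \<bar>x\<bar> < 1"
  proof (rule ccontr)
    assume "\<not> ?thesis"
    then obtain k :: nat where k: "1 \<le> of_nat k * \<bar>x\<bar>"
      by (auto simp: not_less)
    then have "x \<noteq> 0"
      by auto
    then have "\<bar>inverse x\<bar> \<le> of_nat k"
      using k by (simp add: field_simps)
    then have "inverse x \<in> finite_part"
      using finite_part_iff by blast
    with \<open>x \<noteq> 0\<close> x show False
      by (auto simp: finite_part_max_ideal_def)
  qed
next
  assume small: "\<forall>k::nat. of_nat k * \<bar>x\<bar> < 1"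
  from small[rule_format, of 1] have "x \<in> finite_part"
    unfolding finite_part_iff by (intro exI[of _ 1]) simp
  moreover have False if y: "y \<in> finite_part" "x * y = 1" for y
  proof -
    from y obtain k :: nat where k: "\<bar>y\<bar> \<le> of_nat k"
      by (auto simp: finite_part_iff)
    have "1 = \<bar>y\<bar> * \<bar>x\<bar>"
      using y by (simp add: mult.commute flip: abs_mult)
    also have "\<dots> \<le> of_nat k * \<bar>x\<bar>"
      using k by (intro mult_right_mono) auto
    finally show False
      using small[rule_format, of k] by simp
  qed
  ultimately show "x \<in> finite_part_max_ideal"
    by (auto simp: finite_part_max_ideal_def)
qed


text \<open>
  Polynomials are finitely supported maps from exponent vectors to coefficients. The linear order
  on the index type of the variables is only there to make the library's \<^class>\<open>idom\<close> instance
  (and hence the fraction field) available.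
\<close>

type_synonym ('a, 'n) mpoly = "('n \<Rightarrow>\<^sub>0 nat) \<Rightarrow>\<^sub>0 'a"
type_synonym ('a, 'n) ratfun = "(('n \<Rightarrow>\<^sub>0 nat) \<Rightarrow>\<^sub>0 'a) fract"

definition eval_mpoly :: "('a::comm_semiring_1, 'n::finite) mpoly \<Rightarrow> ('a, 'n) vec \<Rightarrow> 'a" where
  "eval_mpoly p x =
    (\<Sum>e\<in>Poly_Mapping.keys p. Poly_Mapping.lookup p e * (\<Prod>i\<in>UNIV. (x $ i) ^ Poly_Mapping.lookup e i))"

definition ratfun_const :: "'a::field \<Rightarrow> ('a, 'n::linorder) ratfun" where
  "ratfun_const c = to_fract (Poly_Mapping.single 0 c)"

text \<open>
  \<open>ratfun_has_value f x y\<close>: the rational function \<open>f\<close> is defined at \<open>x\<close>, i.e. it can be written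
  with a denominator that does not vanish there, and its value is \<open>y\<close>.
\<close>

definition ratfun_has_value ::
    "('a::field, 'n::{finite,linorder}) ratfun \<Rightarrow> ('a, 'n) vec \<Rightarrow> 'a \<Rightarrow> bool" where
  "ratfun_has_value f x y \<longleftrightarrow>
    (\<exists>p q. f = Fract p q \<and> eval_mpoly q x \<noteq> 0 \<and> y = eval_mpoly p x / eval_mpoly q x)"

text \<open>
  The class \<^class>\<open>linorder_topology\<close> says that \<open>open\<close> on the field is the order topology; on
  vectors, \<open>open\<close> is the product topology.
\<close>

definition finitary_at ::
    "('a::{linordered_field,linorder_topology}, 'n::{finite,linorder}) ratfun \<Rightarrow> ('a, 'n) vec \<Rightarrow> bool"
  where
  "finitary_at f b \<longleftrightarrow>
    (\<exists>U. open U \<and> b \<in> U \<and> (\<forall>x\<in>U. \<forall>y. ratfun_has_value f x y \<longrightarrow> y \<in> finite_part))"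

definition finitary_on ::
    "('a::{linordered_field,linorder_topology}, 'n::{finite,linorder}) ratfun \<Rightarrow> ('a, 'n) vec set \<Rightarrow> bool"
  where
  "finitary_on f S \<longleftrightarrow> (\<forall>b\<in>S. finitary_at f b)"

definition T_set ::
    "('a::{linordered_field,linorder_topology}, 'n::{finite,linorder}) mpoly list \<Rightarrow>
      ('a, 'n) ratfun list \<Rightarrow> ('a, 'n) vec set" where
  "T_set ps gs =
    {b. (\<forall>p\<in>set ps. eval_mpoly p b > 0) \<and> (\<forall>g\<in>set gs. finitary_at g b)}"


definition is_positive_cone :: "'l::field set \<Rightarrow> bool" where
  "is_positive_cone C \<longleftrightarrow>
    (\<forall>x. x * x \<in> C) \<and> (\<forall>x\<in>C. \<forall>y\<in>C. x + y \<in> C) \<and> (\<forall>x\<in>C. \<forall>y\<in>C. x * y \<in> C)"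

definition Cone :: "('a::field, 'n::linorder) mpoly list \<Rightarrow> ('a, 'n) ratfun set" where
  "Cone ps = is_positive_cone hull (to_fract ` set ps)"

definition I_set :: "('a::field, 'n::linorder) mpoly list \<Rightarrow> ('a, 'n) ratfun set" where
  "I_set ps = {1 / (1 + f) | f. f \<in> Cone ps \<and> 1 + f \<noteq> 0}"

definition is_finite_part_subalgebra ::
    "('a::linordered_field, 'n::linorder) ratfun set \<Rightarrow> bool" where
  "is_finite_part_subalgebra A \<longleftrightarrow>
    1 \<in> A \<and> (\<forall>x\<in>A. \<forall>y\<in>A. x + y \<in> A) \<and> (\<forall>x\<in>A. \<forall>y\<in>A. x * y \<in> A) \<and>
    (\<forall>c\<in>finite_part. \<forall>x\<in>A. ratfun_const c * x \<in> A)"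

definition A_alg ::
    "('a::linordered_field, 'n::linorder) mpoly list \<Rightarrow> ('a, 'n) ratfun list \<Rightarrow> ('a, 'n) ratfun set"
  where
  "A_alg ps gs = is_finite_part_subalgebra hull (I_set ps \<union> set gs)"

definition T_mult :: "('a::linordered_field, 'n::linorder) ratfun set \<Rightarrow> ('a, 'n) ratfun set" where
  "T_mult A = {1 + ratfun_const c * a | c a. c \<in> finite_part_max_ideal \<and> a \<in> A}"

text \<open>
  The localization is formed inside the ambient field, so only the nonzero elements of the
  multiplicative set are inverted.
\<close>

definition localization_in :: "'l::field set \<Rightarrow> 'l set \<Rightarrow> 'l set" where
  "localization_in A S = {a / s | a s. a \<in> A \<and> s \<in> S \<and> s \<noteq> 0}"

definition integral_closure_in :: "'l::field set \<Rightarrow> 'l set" where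
  "integral_closure_in B =
    {x. \<exists>P. lead_coeff P = 1 \<and> (\<forall>i. coeff P i \<in> B) \<and> poly P x = 0}"

definition integral_radical ::
    "('a::linordered_field, 'n::linorder) ratfun set \<Rightarrow> ('a, 'n) ratfun set" where
  "integral_radical A = integral_closure_in (localization_in A (T_mult A))"

end

theory Submission
  imports Defs "HOL-Algebra.Algebraic_Closure_Type"
begin

text \<open>
  Membership in the integral radical gives finitariness because each step of its construction
  preserves having finite values at generic points near a given point, and a value of a rational
  function is finite as soon as values at arbitrarily close generic points are.

  For the converse put \<open>g = 1 + g\<^sub>1\<^sup>2 + \<dots> + g\<^sub>l\<^sup>2\<close>. If \<open>h\<close> is finitary, then \<open>h\<^sup>2\<close> is finite wherever
  the \<open>p\<^sub>i\<close> are positive and \<open>g\<close> is finite. By quantifier elimination the relation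
  ``some such point has \<open>g \<le> s\<close> and \<open>h\<^sup>2 \<ge> t\<close>'' depends only on the signs of finitely many polynomials in
  \<open>s, t\<close>, and these are constant on a region \<open>N \<le> s\<close>, \<open>s\<^sup>k \<le> t \<le> c\<close> with \<open>c\<close> infinite. Hence
  \<open>h\<^sup>2 \<le> N g\<^sup>k\<close> wherever \<open>m g\<^sup>k < 1\<close>, for a suitable infinitesimal \<open>m > 0\<close>. With \<open>w = m g\<^sup>k\<close> and
  \<open>U = N g\<^sup>k (1 + w\<^sup>2)\<close> this makes \<open>f = U - h\<^sup>2 (1 - w)\<close> nonnegative where the \<open>p\<^sub>i\<close> are positive, so \<open>f\<close>
  lies in the cone by Artin's theorem. For \<open>z = 1 / (1 + h\<^sup>2)\<close> one gets
  \<open>1 - m (g\<^sup>k / (1 + f z)) = z (U + 1 - w) / (1 + f z)\<close>, which exhibits \<open>1 + h\<^sup>2\<close> as an element of the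
  localization.
\<close>

text \<open>Finitariness bounds \<open>h\<close> at each point where \<open>g\<close> is finite, but
  neither uniformly in \<open>g\<close> nor where \<open>g\<close> is infinite. The constancy of
  signs supplies both: a point with \<open>g \<le> s\<close> and large \<open>h\<^sup>2\<close> for
  an infinite \<open>s\<close> would produce a point where \<open>g\<close> is at most a natural
  number and \<open>h\<^sup>2\<close> at least the infinite \<open>c\<close>. So the bound persists
  a little way into the infinite values of \<open>g\<close>. Beyond them nothing is known about
  \<open>h\<close>, and the factor \<open>1 - w\<close> is there to turn negative and make
  \<open>f\<close> nonnegative for free. The transfer of sign conditions is proved once, between two
  fields and for coefficients in a ring mapped to each. Two specialisations of
  \<open>R[s][t]\<close> to the same field give the bound; the embeddings of \<open>R\<close> into
  itself and into an ordered extension of its function field give Artin's theorem. Its hypothesis is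
  the intermediate value property, which is what sign diagrams use and what maximality of a cone
  yields for the extension. For \<open>R\<close> itself it has to be derived from square roots and
  roots of odd degree polynomials, hence the passage through the algebraic closure.\<close>

hide_const (open) up_ring.coeff up_ring.monom Polynomials.degree Polynomials.lead_coeff
  module.smult Coset.order
no_notation fps_nth (infixl \<open>$\<close> 75)

section \<open>Polynomials over ordered fields with the intermediate value property\<close>

definition poly_ivp :: "'a::linordered_field itself \<Rightarrow> bool" where
  "poly_ivp _ \<longleftrightarrow>
    (\<forall>(p::'a poly) a b. a < b \<longrightarrow> poly p a * poly p b < 0 \<longrightarrow> (\<exists>x. a < x \<and> x < b \<and> poly p x = 0))"

lemma poly_ivpD:
  fixes p :: "'a::linordered_field poly"
  assumes "poly_ivp TYPE('a)" "a < b" "poly p a * poly p b < 0"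
  obtains x where "a < x" "x < b" "poly p x = 0"
  using assms unfolding poly_ivp_def by blast

text \<open>Any root will do: one outside the interval contributes a factor with equal signs at
  \<open>a\<close> and \<open>b\<close>, so dividing it out keeps the sign change and lowers the
  degree.\<close>

lemma poly_ivpI:
  assumes root: "\<And>(p::'a::linordered_field poly) a b. poly p a * poly p b < 0 \<Longrightarrow> \<exists>x. poly p x = 0"
  shows "poly_ivp TYPE('a)"
proof -
  have "\<exists>x. a < x \<and> x < b \<and> poly p x = 0"
    if "a < b" "poly p a * poly p b < 0" for p :: "'a poly" and a b
    using that
  proof (induction "degree p" arbitrary: p rule: less_induct)
    case less
    obtain c where c: "poly p c = 0"
      using root[OF less.prems(2)] by blast
    show ?case
    proof (cases "a < c \<and> c < b")
      case True
      with c show ?thesis by blast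
    next
      case False
      from c obtain q where q: "p = [:-c, 1:] * q"
        unfolding poly_eq_0_iff_dvd by (rule dvdE)
      have "a \<noteq> c" "b \<noteq> c" "p \<noteq> 0"
        using less.prems c by auto
      have "q \<noteq> 0" using q \<open>p \<noteq> 0\<close> by auto
      have pos: "(a - c) * (b - c) > 0"
        using False \<open>a < b\<close> \<open>a \<noteq> c\<close> \<open>b \<noteq> c\<close> by (auto simp: zero_less_mult_iff not_less)
      have "poly p a * poly p b = ((a - c) * (b - c)) * (poly q a * poly q b)"
        by (simp add: q algebra_simps)
      then have "poly q a * poly q b < 0"
        using less.prems(2) pos by (metis mult_less_cancel_left_pos mult_zero_right)
      moreover have "degree q < degree p"
        unfolding q using \<open>q \<noteq> 0\<close> by (subst degree_mult_eq) auto
      ultimately obtain x where "a < x" "x < b" "poly q x = 0"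
        using less.hyps \<open>a < b\<close> by blast
      then show ?thesis by (auto simp: q)
    qed
  qed
  then show ?thesis unfolding poly_ivp_def by blast
qed

lemma poly_nonzero_root_factor:
  fixes p :: "'a::idom poly"
  assumes "p \<noteq> 0"
  obtains q where "p = [:-a, 1:] ^ order a p * q" "poly q a \<noteq> 0"
proof -
  obtain q where q: "p = [:-a, 1:] ^ order a p * q"
    using order_1 by (metis dvdE)
  have "poly q a \<noteq> 0"
  proof
    assume "poly q a = 0"
    then have "[:-a, 1:] dvd q" by (simp add: poly_eq_0_iff_dvd)
    then have "[:-a, 1:] ^ order a p * [:-a, 1:] dvd [:-a, 1:] ^ order a p * q"
      by (rule mult_dvd_mono[OF dvd_refl])
    then have "[:-a, 1:] ^ Suc (order a p) dvd p"
      unfolding power_Suc2 by (simp only: q[symmetric])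
    then show False using order_2[OF assms] by blast
  qed
  with q that show thesis by blast
qed

text \<open>For Rolle's theorem: once the powers are split off, the remaining factor has no common
  zero forced at either root, and its sign there can be read off.\<close>

lemma pderiv_power_mult_power_mult:
  fixes A B q :: "'a::{comm_ring_1,ring_no_zero_divisors} poly"
  assumes "pderiv A = 1" "pderiv B = 1"
  shows "pderiv (A ^ Suc m * (B ^ Suc n * q)) = A ^ m * B ^ n *
    (smult (of_nat (Suc m)) (B * q) + smult (of_nat (Suc n)) (A * q) + A * B * pderiv q)"
proof -
  have sm: "smult c p = [:c:] * p" for c and p :: "'a poly"
    by simp
  show ?thesis
    unfolding pderiv_mult pderiv_power_Suc assms sm
    by (simp only: algebra_simps mult_1_right mult_1_left power_Suc)
qed

text \<open>Between consecutive roots \<open>a\<close>, \<open>b\<close> write \<open>p = (x - a)^m (x - b)^n q\<close>; the cofactor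
  of \<open>p'\<close> changes sign there.\<close>

lemma poly_rolle:
  fixes p :: "'a::linordered_field poly"
  assumes ivp: "poly_ivp TYPE('a)" and "a < b" "poly p a = 0" "poly p b = 0"
  shows "\<exists>x. a < x \<and> x < b \<and> poly (pderiv p) x = 0"
proof (cases "p = 0")
  case True
  then show ?thesis using \<open>a < b\<close> dense by auto
next
  case False
  define Z where "Z = {x. poly p x = 0 \<and> a < x}"
  have Z: "finite Z" "b \<in> Z"
    using poly_roots_finite[OF False] assms by (auto simp: Z_def)
  define c where "c = Min Z"
  have c: "c \<in> Z" "c \<le> b" and cmin: "\<And>x. x \<in> Z \<Longrightarrow> c \<le> x"
    using Z by (auto simp: c_def intro: Min_in)
  have "a < c" "poly p c = 0"
    using c by (auto simp: Z_def)
  have noroot: "poly p x \<noteq> 0" if "a < x" "x < c" for x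
    using cmin[of x] that by (auto simp: Z_def)
  obtain u where u: "p = [:-a, 1:] ^ order a p * u" "poly u a \<noteq> 0"
    using poly_nonzero_root_factor[OF False] by blast
  have "u \<noteq> 0" using u by auto
  obtain q where q: "u = [:-c, 1:] ^ order c u * q" "poly q c \<noteq> 0"
    using poly_nonzero_root_factor[OF \<open>u \<noteq> 0\<close>] by blast
  have "order a p \<noteq> 0"
    using assms False order_root by blast
  then obtain m where m: "order a p = Suc m" by (cases "order a p") auto
  have "poly u c = 0"
  proof -
    have "poly p c = (c - a) ^ order a p * poly u c"
      by (subst u(1)) simp
    then show ?thesis using \<open>poly p c = 0\<close> \<open>a < c\<close> by simp
  qed
  then have "order c u \<noteq> 0"
    using \<open>u \<noteq> 0\<close> order_root by blast
  then obtain n where n: "order c u = Suc n" by (cases "order c u") auto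
  have p: "p = [:-a, 1:] ^ Suc m * ([:-c, 1:] ^ Suc n * q)"
    using u(1) q(1) m n by simp
  have qa: "poly q a \<noteq> 0"
    using u(2) by (subst (asm) q(1)) auto
  have "poly q a * poly q c > 0"
  proof (rule ccontr)
    assume "\<not> ?thesis"
    then have "poly q a * poly q c < 0" using qa q(2) by (auto simp: less_le not_less)
    then obtain x where "a < x" "x < c" "poly q x = 0"
      using poly_ivpD[OF ivp \<open>a < c\<close>] by blast
    then show False using noroot[of x] by (simp add: p)
  qed
  define r where "r = smult (of_nat (Suc m)) ([:-c, 1:] * q) + smult (of_nat (Suc n)) ([:-a, 1:] * q)
      + [:-a, 1:] * [:-c, 1:] * pderiv q"
  have dp: "pderiv p = [:-a, 1:] ^ m * [:-c, 1:] ^ n * r"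
    unfolding p r_def by (intro pderiv_power_mult_power_mult) (simp_all add: pderiv_pCons)
  have ra: "poly r a = of_nat (Suc m) * (a - c) * poly q a"
    and rc: "poly r c = of_nat (Suc n) * (c - a) * poly q c"
    by (simp_all add: r_def algebra_simps)
  have "poly r a * poly r c = - (of_nat (Suc m) * of_nat (Suc n) * (c - a)\<^sup>2 * (poly q a * poly q c))"
    unfolding ra rc power2_eq_square by (simp only: algebra_simps minus_mult_left minus_mult_right)
  moreover have "of_nat (Suc m) * of_nat (Suc n) * (c - a)\<^sup>2 * (poly q a * poly q c) > 0"
    using \<open>a < c\<close> \<open>poly q a * poly q c > 0\<close> by (simp del: of_nat_Suc)
  ultimately have "poly r a * poly r c < 0" by linarith
  then obtain x where "a < x" "x < c" "poly r x = 0"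
    using poly_ivpD[OF ivp \<open>a < c\<close>] by blast
  then show ?thesis using \<open>c \<le> b\<close> by (intro exI[of _ x]) (auto simp: dp)
qed

lemma poly_mvt_field:
  fixes p :: "'a::linordered_field poly"
  assumes ivp: "poly_ivp TYPE('a)" and "a < b"
  obtains x where "a < x" "x < b" "poly p b - poly p a = (b - a) * poly (pderiv p) x"
proof -
  define k where "k = (poly p b - poly p a) / (b - a)"
  define q where "q = p - [:poly p a - k * a, k:]"
  have "poly q a = 0" "poly q b = 0"
  proof -
    have "k * (b - a) = poly p b - poly p a"
      using \<open>a < b\<close> by (simp add: k_def)
    then show "poly q a = 0" "poly q b = 0"
      by (simp_all add: q_def algebra_simps)
  qed
  then obtain x where x: "a < x" "x < b" "poly (pderiv q) x = 0"
    using poly_rolle[OF ivp \<open>a < b\<close>] by blast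
  then have "poly (pderiv p) x = k"
    by (simp add: q_def pderiv_diff pderiv_pCons)
  with x that \<open>a < b\<close> show thesis by (simp add: k_def)
qed

text \<open>Monotonicity in the only form the sign diagrams need. The derivative keeps one sign by
  the intermediate value property, so the increments over \<open>[a, x]\<close> and
  \<open>[x, b]\<close>, expressed by the mean value theorem, have the same sign.\<close>

lemma poly_strictly_between:
  fixes p :: "'a::linordered_field poly"
  assumes ivp: "poly_ivp TYPE('a)" and "a < x" "x < b"
    and nz: "\<And>z. a < z \<Longrightarrow> z < b \<Longrightarrow> poly (pderiv p) z \<noteq> 0"
  shows "poly p a < poly p x \<and> poly p x < poly p b \<or> poly p a > poly p x \<and> poly p x > poly p b"
proof -
  obtain u where u: "a < u" "u < x" "poly p x - poly p a = (x - a) * poly (pderiv p) u"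
    using poly_mvt_field[OF ivp \<open>a < x\<close>] by blast
  obtain v where v: "x < v" "v < b" "poly p b - poly p x = (b - x) * poly (pderiv p) v"
    using poly_mvt_field[OF ivp \<open>x < b\<close>] by blast
  have "u < v" using u v by simp
  have "\<not> poly (pderiv p) u * poly (pderiv p) v < 0"
  proof
    assume "poly (pderiv p) u * poly (pderiv p) v < 0"
    then obtain z where "u < z" "z < v" "poly (pderiv p) z = 0"
      using poly_ivpD[OF ivp \<open>u < v\<close>] by blast
    then show False using nz[of z] u v by simp
  qed
  moreover have "poly (pderiv p) u \<noteq> 0" "poly (pderiv p) v \<noteq> 0"
    using nz u v assms by auto
  ultimately consider "poly (pderiv p) u > 0" "poly (pderiv p) v > 0" |
      "poly (pderiv p) u < 0" "poly (pderiv p) v < 0"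
    using linorder_less_linear[of "poly (pderiv p) u" 0] linorder_less_linear[of "poly (pderiv p) v" 0]
    by (auto simp: mult_less_0_iff)
  then show ?thesis
  proof cases
    case 1
    then have "poly p x - poly p a > 0" "poly p b - poly p x > 0"
      using u v assms by simp_all
    then show ?thesis by simp
  next
    case 2
    then have "poly p x - poly p a < 0" "poly p b - poly p x < 0"
      using u v assms by (simp_all add: mult_less_0_iff)
    then show ?thesis by simp
  qed
qed

text \<open>The bound \<open>c\<close> away from zero is the induction invariant:
  \<open>x * poly p x\<close> then outgrows the constant coefficient.\<close>

lemma poly_eventually_pos:
  fixes p :: "'a::linordered_field poly"
  assumes "lead_coeff p > 0"
  shows "\<exists>c>0. \<exists>M. \<forall>x\<ge>M. poly p x \<ge> c"
  using assms
proof (induction p)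
  case 0
  then show ?case by simp
next
  case (pCons a p)
  show ?case
  proof (cases "p = 0")
    case True
    then show ?thesis using pCons.prems by auto
  next
    case False
    then obtain c M where cM: "c > 0" "\<And>x. x \<ge> M \<Longrightarrow> poly p x \<ge> c"
      using pCons by auto
    have "poly (pCons a p) x \<ge> 1" if x: "x \<ge> max M ((\<bar>a\<bar> + 1) / c)" for x
    proof -
      have "x \<ge> 0"
        using x cM(1) order.trans[of 0 "(\<bar>a\<bar> + 1) / c" x] by simp
      have "\<bar>a\<bar> + 1 \<le> x * c"
        using x cM(1) by (simp add: pos_divide_le_eq)
      also have "\<dots> \<le> x * poly p x"
        using cM(2)[of x] x \<open>x \<ge> 0\<close> by (intro mult_left_mono) auto
      finally show ?thesis using abs_ge_minus_self[of a] unfolding poly_pCons by linarith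
    qed
    then show ?thesis using zero_less_one by blast
  qed
qed

definition same_sign :: "'a::linordered_idom \<Rightarrow> 'b::linordered_idom \<Rightarrow> bool" where
  "same_sign x y \<longleftrightarrow> (0 < x \<longleftrightarrow> 0 < y) \<and> (x < 0 \<longleftrightarrow> y < 0)"

lemma same_sign_zeroD: "same_sign x y \<Longrightarrow> x = 0 \<longleftrightarrow> y = 0"
  unfolding same_sign_def using linorder_less_linear[of x 0] linorder_less_linear[of y 0] by auto

lemma same_sign_zero [simp]: "same_sign 0 0"
  by (simp add: same_sign_def)

lemma same_sign_sym: "same_sign x y \<Longrightarrow> same_sign y x"
  by (auto simp: same_sign_def)

lemma same_sign_mult: "same_sign a b \<Longrightarrow> same_sign x y \<Longrightarrow> same_sign (a * x) (b * y)"
  by (auto simp: same_sign_def zero_less_mult_iff mult_less_0_iff)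

lemma same_sign_mult_cancel:
  "0 < c \<Longrightarrow> 0 < d \<Longrightarrow> same_sign (c * x) (d * y) \<Longrightarrow> same_sign x y"
  by (auto simp: same_sign_def zero_less_mult_iff mult_less_0_iff)

lemma poly_sign_at_top:
  fixes p :: "'a::linordered_field poly"
  shows "\<exists>M. \<forall>x\<ge>M. same_sign (poly p x) (lead_coeff p)"
proof -
  consider "p = 0" | "lead_coeff p > 0" | "lead_coeff (- p) > 0"
    using linorder_less_linear[of "lead_coeff p" 0] by auto
  then show ?thesis
  proof cases
    case 2
    then obtain c M where "c > 0" "\<And>x. x \<ge> M \<Longrightarrow> poly p x \<ge> c"
      using poly_eventually_pos by blast
    then have "poly p x > 0" if "x \<ge> M" for x
      using that by (meson order.strict_trans2)
    then have "\<forall>x\<ge>M. same_sign (poly p x) (lead_coeff p)"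
      using 2 by (auto simp: same_sign_def dest: order.asym)
    then show ?thesis ..
  next
    case 3
    then obtain c M where cM: "c > 0" "\<And>x. x \<ge> M \<Longrightarrow> poly (- p) x \<ge> c"
      using poly_eventually_pos by blast
    have "poly p x < 0" if "x \<ge> M" for x
      using cM(1) cM(2)[OF that] by simp
    then have "\<forall>x\<ge>M. same_sign (poly p x) (lead_coeff p)"
      using 3 by (auto simp: same_sign_def dest: order.asym)
    then show ?thesis ..
  qed auto
qed

lemma poly_sign_at_bot:
  fixes p :: "'a::linordered_field poly"
  shows "\<exists>M. \<forall>x\<le>M. same_sign (poly p x) ((-1) ^ degree p * lead_coeff p)"
proof -
  obtain M where M: "\<And>x. x \<ge> M \<Longrightarrow>
      same_sign (poly (pcompose p [:0,-1:]) x) (lead_coeff (pcompose p [:0,-1:]))"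
    using poly_sign_at_top by blast
  have "same_sign (poly p x) ((-1) ^ degree p * lead_coeff p)" if "x \<le> - M" for x
    using M[of "- x"] that
    using lead_coeff_comp[of "[:0,-1:]" p] by (simp add: poly_pcompose mult.commute)
  then show ?thesis by blast
qed

section \<open>Simultaneous sign diagrams\<close>

lemma same_sign_trans: "same_sign x y \<Longrightarrow> same_sign y z \<Longrightarrow> same_sign x z"
  by (auto simp: same_sign_def)

text \<open>\<open>mono_pairs G\<close>: the set \<open>G\<close> is the graph of an order isomorphism. \<open>same_cut G x y\<close>: it remains
  one after adding the pair \<open>(x, y)\<close>.\<close>

definition mono_pairs :: "('a::linorder \<times> 'b::linorder) set \<Rightarrow> bool" where
  "mono_pairs G \<longleftrightarrow> (\<forall>a b a' b'. (a, b) \<in> G \<longrightarrow> (a', b') \<in> G \<longrightarrow> (a < a' \<longleftrightarrow> b < b'))"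

definition same_cut :: "('a::linorder \<times> 'b::linorder) set \<Rightarrow> 'a \<Rightarrow> 'b \<Rightarrow> bool" where
  "same_cut G x y \<longleftrightarrow> (\<forall>a b. (a, b) \<in> G \<longrightarrow> (x < a \<longleftrightarrow> y < b) \<and> (a < x \<longleftrightarrow> b < y))"

text \<open>\<open>G\<close> serves as a common sign diagram, whose cells are the cuts it
  determines. Its points need not be roots, but for a nonzero \<open>p\<close> all roots are forced
  to occur in it (\<open>sim_on_root_dom\<close>).\<close>

definition sim_on :: "('a::linordered_field \<times> 'b::linordered_field) set \<Rightarrow> 'a poly \<Rightarrow> 'b poly \<Rightarrow> bool"
  where "sim_on G p q \<longleftrightarrow> (\<forall>x y. same_cut G x y \<longrightarrow> same_sign (poly p x) (poly q y))"

lemma mono_pairs_converse: "mono_pairs (G\<inverse>) \<longleftrightarrow> mono_pairs G"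
  by (auto simp: mono_pairs_def)

lemma same_cut_converse: "same_cut (G\<inverse>) y x \<longleftrightarrow> same_cut G x y"
  by (auto simp: same_cut_def)

lemma sim_on_converse: "sim_on (G\<inverse>) q p \<longleftrightarrow> sim_on G p q"
  by (auto simp: sim_on_def same_cut_converse intro: same_sign_sym)

lemma same_cut_mono: "same_cut G x y \<Longrightarrow> G' \<subseteq> G \<Longrightarrow> same_cut G' x y"
  unfolding same_cut_def by blast

lemma sim_on_mono: "sim_on G' p q \<Longrightarrow> G' \<subseteq> G \<Longrightarrow> sim_on G p q"
  unfolding sim_on_def using same_cut_mono by blast

lemma mono_pairs_same_cut: "mono_pairs G \<Longrightarrow> (a, b) \<in> G \<Longrightarrow> same_cut G a b"
  unfolding mono_pairs_def same_cut_def by blast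

lemma finite_separate:
  fixes A B :: "'a::linordered_field set"
  assumes "finite A" "finite B" "\<And>a b. a \<in> A \<Longrightarrow> b \<in> B \<Longrightarrow> a < b"
  obtains y where "\<And>a. a \<in> A \<Longrightarrow> a < y" "\<And>b. b \<in> B \<Longrightarrow> y < b"
proof -
  have ex: "\<exists>y. (\<forall>a\<in>A. a < y) \<and> (\<forall>b\<in>B. y < b)"
  proof (cases "A = {}")
    case True
    show ?thesis
    proof (cases "B = {}")
      case False
      have "Min B - 1 < b" if "b \<in> B" for b
        using Min_le[OF assms(2) that] by simp
      then show ?thesis using True by blast
    qed (use True in auto)
  next
    case False
    show ?thesis
    proof (cases "B = {}")
      case True
      have "a < Max A + 1" if "a \<in> A" for a
        using Max_ge[OF assms(1) that] by simp
      then show ?thesis using True by blast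
    next
      case B: False
      have "Max A < Min B"
        using assms(3) Max_in[OF assms(1) False] Min_in[OF assms(2) B] by blast
      then obtain y where y: "Max A < y" "y < Min B" using dense by blast
      have "a < y" if "a \<in> A" for a
        using Max_ge[OF assms(1) that] y by simp
      moreover have "y < b" if "b \<in> B" for b
        using Min_le[OF assms(2) that] y by simp
      ultimately show ?thesis by blast
    qed
  qed
  then show thesis using that by blast
qed

text \<open>An unmarked point finds a partner because a finite \<open>G\<close> leaves room in every
  cell: the order of a field is dense and has no endpoints.\<close>

lemma same_cut_ex:
  fixes G :: "('a::linordered_field \<times> 'b::linordered_field) set"
  assumes "finite G" "mono_pairs G"
  obtains y where "same_cut G x y"
proof (cases "\<exists>b. (x, b) \<in> G")
  case True
  then show ?thesis using mono_pairs_same_cut[OF assms(2)] that by blast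
next
  case False
  define A where "A = snd ` {g \<in> G. fst g < x}"
  define B where "B = snd ` {g \<in> G. x < fst g}"
  have "a < b" if "a \<in> A" "b \<in> B" for a b
  proof -
    from that obtain u v where "(u, a) \<in> G" "u < x" "(v, b) \<in> G" "x < v"
      by (auto simp: A_def B_def)
    then show ?thesis
      using assms(2) unfolding mono_pairs_def by (meson order.strict_trans)
  qed
  moreover have "finite A" "finite B" using assms(1) by (auto simp: A_def B_def)
  ultimately obtain y where y: "\<And>a. a \<in> A \<Longrightarrow> a < y" "\<And>b. b \<in> B \<Longrightarrow> y < b"
    using finite_separate[of A B] by blast
  have "(x < a \<longleftrightarrow> y < b) \<and> (a < x \<longleftrightarrow> b < y)" if ab: "(a, b) \<in> G" for a b
  proof -
    have "a \<noteq> x" using False ab by blast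
    then consider "a < x" | "x < a" by (meson linorder_neqE)
    then show ?thesis
    proof cases
      case 1
      then have "b \<in> A" using ab unfolding A_def by (intro image_eqI[of _ _ "(a, b)"]) auto
      with y(1) 1 show ?thesis by (meson order.asym)
    next
      case 2
      then have "b \<in> B" using ab unfolding B_def by (intro image_eqI[of _ _ "(a, b)"]) auto
      with y(2) 2 show ?thesis by (meson order.asym)
    qed
  qed
  then show ?thesis using that unfolding same_cut_def by blast
qed

text \<open>If the root \<open>c\<close> were unmarked, all points slightly to its right would lie
  in its cell and share its partner \<open>d\<close>. They would then all be roots, infinitely many
  of them.\<close>

lemma sim_on_root_dom:
  fixes G :: "('a::linordered_field \<times> 'b::linordered_field) set"
  assumes "finite G" "mono_pairs G" "sim_on G p q" "p \<noteq> 0" "poly p c = 0"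
  obtains b where "(c, b) \<in> G"
proof -
  have "\<exists>b. (c, b) \<in> G"
  proof (rule ccontr)
    assume no: "\<not> ?thesis"
    obtain d where d: "same_cut G c d"
      by (rule same_cut_ex[OF assms(1,2), of c])
    have "finite {c}" "finite {a \<in> fst ` G. c < a}" "\<And>a b. a \<in> {c} \<Longrightarrow> b \<in> {a \<in> fst ` G. c < a} \<Longrightarrow> a < b"
      using assms(1) by auto
    then obtain u where u: "\<And>a. a \<in> {c} \<Longrightarrow> a < u" "\<And>b. b \<in> {a \<in> fst ` G. c < a} \<Longrightarrow> u < b"
      using finite_separate[of "{c}" "{a \<in> fst ` G. c < a}" thesis] by blast
    have "poly p z = 0" if z: "c < z" "z < u" for z
    proof -
      have "(z < a \<longleftrightarrow> d < b) \<and> (a < z \<longleftrightarrow> b < d)" if ab: "(a, b) \<in> G" for a b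
      proof -
        have "a \<noteq> c" using no ab by blast
        then consider "a < c" | "c < a" by (meson linorder_neqE)
        then show ?thesis
        proof cases
          case 1
          then show ?thesis using d ab z unfolding same_cut_def by (meson order.asym order.strict_trans)
        next
          case 2
          then have "u < a" using u(2) ab by force
          then show ?thesis using d ab z 2 unfolding same_cut_def by (meson order.asym order.strict_trans)
        qed
      qed
      then have "same_cut G z d" unfolding same_cut_def by blast
      then have "same_sign (poly p z) (poly q d)" "same_sign (poly p c) (poly q d)"
        using assms(3) d unfolding sim_on_def by blast+
      then show ?thesis using assms(5) by (metis same_sign_zeroD)
    qed
    then have "{c<..<u} \<subseteq> {x. poly p x = 0}" by auto
    then have "finite {c<..<u}"
      using poly_roots_finite[OF assms(4)] finite_subset by blast
    moreover have "infinite {c<..<u}" using u(1) by (intro infinite_Ioo) auto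
    ultimately show False by blast
  qed
  then show thesis using that by blast
qed

text \<open>Either a marked point lies weakly between \<open>x\<close> and \<open>x'\<close> and
  decides the order of the partners, or both are new roots, and Rolle's theorem places a critical
  point between them, which is marked.\<close>

lemma extend_less:
  fixes G :: "('a::linordered_field \<times> 'b::linorder) set"
  assumes ivp: "poly_ivp TYPE('a)"
    and crit: "\<And>z. poly (pderiv p) z = 0 \<Longrightarrow> z \<in> fst ` G"
    and "same_cut G x y" "same_cut G x' y'"
    and "(x, y) \<in> G \<or> poly p x = 0" "(x', y') \<in> G \<or> poly p x' = 0" "x < x'"
  shows "y < y'"
proof (cases "\<exists>a b. (a, b) \<in> G \<and> x \<le> a \<and> a \<le> x'")
  case True
  then obtain a b where ab: "(a, b) \<in> G" "x \<le> a" "a \<le> x'" by blast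
  have "x < a \<longleftrightarrow> y < b" "a < x \<longleftrightarrow> b < y" "x' < a \<longleftrightarrow> y' < b" "a < x' \<longleftrightarrow> b < y'"
    using assms ab unfolding same_cut_def by blast+
  then show ?thesis using ab \<open>x < x'\<close>
    by (metis order.strict_trans1 order.strict_trans2 not_less order.order_iff_strict)
next
  case False
  then have "(x, y) \<notin> G" "(x', y') \<notin> G"
    using order.strict_implies_order[OF assms(7)] by blast+
  then have "poly p x = 0" "poly p x' = 0"
    using assms(5,6) by auto
  then obtain z where "x < z" "z < x'" "poly (pderiv p) z = 0"
    using poly_rolle[OF ivp \<open>x < x'\<close>] by blast
  moreover from this(3) obtain b where "(z, b) \<in> G" using crit[of z] by force
  ultimately show ?thesis using False order.strict_implies_order by metis
qed

lemma extend_mono_pairs: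
  fixes G :: "('a::linordered_field \<times> 'b::linordered_field) set"
  assumes ivp: "poly_ivp TYPE('a)" "poly_ivp TYPE('b)" and mono: "mono_pairs G"
    and crit: "\<And>z. poly (pderiv p) z = 0 \<Longrightarrow> z \<in> fst ` G" "\<And>z. poly (pderiv q) z = 0 \<Longrightarrow> z \<in> snd ` G"
  shows "mono_pairs (G \<union> {(x, y). same_cut G x y \<and> poly p x = 0 \<and> poly q y = 0})" (is "mono_pairs ?G")
proof -
  have "x < x' \<longleftrightarrow> y < y'" if xy: "(x, y) \<in> ?G" "(x', y') \<in> ?G" for x y x' y'
  proof
    have cut: "same_cut G x y" "same_cut G x' y'"
      using xy mono_pairs_same_cut[OF mono] by auto
    show "y < y'" if "x < x'"
      using extend_less[OF ivp(1) crit(1) cut _ _ that] xy by blast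
    have crit': "\<And>z. poly (pderiv q) z = 0 \<Longrightarrow> z \<in> fst ` (G\<inverse>)"
      using crit(2) by force
    have cut': "same_cut (G\<inverse>) y x" "same_cut (G\<inverse>) y' x'"
      using cut by (simp_all add: same_cut_converse)
    show "x < x'" if "y < y'"
      using extend_less[OF ivp(2) crit' cut' _ _ that] xy by blast
  qed
  then show ?thesis unfolding mono_pairs_def by blast
qed

text \<open>With all critical points marked, \<open>p\<close> and \<open>q\<close> are monotone
  between adjacent marked points. Each then has a root inside such a cell exactly when its signs at
  the ends are opposite, and these signs agree for \<open>p\<close> and \<open>q\<close>. The
  outermost marks \<open>l1\<close>, \<open>u1\<close> and \<open>l2\<close>, \<open>u2\<close> lie
  so far out that signs beyond them agree by assumption.\<close>

lemma extend_sim_on: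
  fixes G :: "('a::linordered_field \<times> 'b::linordered_field) set"
  assumes ivp: "poly_ivp TYPE('a)" "poly_ivp TYPE('b)" and mono: "mono_pairs G" and fin: "finite G"
    and crit: "\<And>z. poly (pderiv p) z = 0 \<Longrightarrow> z \<in> fst ` G" "\<And>z. poly (pderiv q) z = 0 \<Longrightarrow> z \<in> snd ` G"
    and pts: "\<And>a b. (a, b) \<in> G \<Longrightarrow> same_sign (poly p a) (poly q b)"
    and top: "(u1, u2) \<in> G" "\<And>x y. u1 \<le> x \<Longrightarrow> u2 \<le> y \<Longrightarrow> same_sign (poly p x) (poly q y)"
    and bot: "(l1, l2) \<in> G" "\<And>x y. x \<le> l1 \<Longrightarrow> y \<le> l2 \<Longrightarrow> same_sign (poly p x) (poly q y)"
  shows "sim_on (G \<union> {(x, y). same_cut G x y \<and> poly p x = 0 \<and> poly q y = 0}) p q" (is "sim_on ?G p q")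
  unfolding sim_on_def
proof (intro allI impI)
  fix x y assume cut: "same_cut ?G x y"
  then have cutG: "same_cut G x y" by (rule same_cut_mono) blast
  then have cD: "x < a \<longleftrightarrow> y < b" "a < x \<longleftrightarrow> b < y" if "(a, b) \<in> G" for a b
    using that unfolding same_cut_def by blast+
  consider "u1 \<le> x" | "x \<le> l1" | b where "(x, b) \<in> G" | "l1 < x" "x < u1" "x \<notin> fst ` G"
    by (metis fst_conv image_iff not_less prod.collapse)
  then show "same_sign (poly p x) (poly q y)"
  proof cases
    case 1
    then show ?thesis using top cD[OF top(1)] by (simp add: not_less[symmetric])
  next
    case 2
    then show ?thesis using bot cD[OF bot(1)] by (simp add: not_less[symmetric])
  next
    case 3
    then have "y = b" using cD[OF 3] by (metis less_irrefl linorder_neqE)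
    then show ?thesis using pts 3 by blast
  next
    case 4
    define A where "A = {a \<in> fst ` G. a < x}"
    define B where "B = {a \<in> fst ` G. x < a}"
    have fin': "finite A" "finite B" "A \<noteq> {}" "B \<noteq> {}"
      using fin 4 top(1) bot(1) by (force simp: A_def B_def)+
    have "Max A \<in> A" "Min B \<in> B" using fin' by simp_all
    then obtain b b' where ab: "(Max A, b) \<in> G" "Max A < x" and ab': "(Min B, b') \<in> G" "x < Min B"
      by (auto simp: A_def B_def)
    define a where "a = Max A"
    define a' where "a' = Min B"
    note ab = ab[folded a_def] and ab' = ab'[folded a'_def]
    have split: "c \<le> a \<or> a' \<le> c" if "(c, d) \<in> G" for c d
    proof -
      have "c \<noteq> x" using 4 that by force
      then have "c \<in> A \<or> c \<in> B" using that by (force simp: A_def B_def)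
      then show ?thesis using fin' by (auto simp: a_def a'_def)
    qed
    have monoD: "c < c' \<longleftrightarrow> d < d'" if "(c, d) \<in> G" "(c', d') \<in> G" for c d c' d'
      using mono that unfolding mono_pairs_def by blast
    have cell: "same_cut G z w" if zw: "a < z" "z < a'" "b < w" "w < b'" for z w
      unfolding same_cut_def
    proof (intro allI impI)
      fix c d assume cd: "(c, d) \<in> G"
      from split[OF cd] show "(z < c \<longleftrightarrow> w < d) \<and> (c < z \<longleftrightarrow> d < w)"
      proof
        assume "c \<le> a"
        then have "d \<le> b" using monoD[OF ab(1) cd] by (simp add: not_less[symmetric])
        then have "c < z" "d < w" using zw \<open>c \<le> a\<close> by auto
        then show ?thesis by auto
      next
        assume "a' \<le> c"
        then have "b' \<le> d" using monoD[OF cd ab'(1)] by (simp add: not_less[symmetric])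
        then have "z < c" "w < d" using zw \<open>a' \<le> c\<close> by auto
        then show ?thesis by auto
      qed
    qed
    have y: "b < y" "y < b'" using cD[OF ab(1)] cD[OF ab'(1)] ab ab' by auto
    have nz1: "poly (pderiv p) z \<noteq> 0" if "a < z" "z < a'" for z
    proof
      assume "poly (pderiv p) z = 0"
      then obtain d where "(z, d) \<in> G" using crit(1) by force
      then show False using split that by force
    qed
    have nz2: "poly (pderiv q) z \<noteq> 0" if "b < z" "z < b'" for z
    proof
      assume "poly (pderiv q) z = 0"
      then obtain c where c: "(c, z) \<in> G" using crit(2) by force
      then have "a < c" "c < a'" using monoD[OF ab(1) c] monoD[OF c ab'(1)] that by auto
      then show False using split[OF c] by auto
    qed
    have sa: "same_sign (poly p a) (poly q b)" and sa': "same_sign (poly p a') (poly q b')"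
      using pts ab ab' by auto
    \<comment> \<open>With opposite signs at the ends both polynomials have a root in the cell. This
      pair of roots belongs to the enlarged graph, so \<open>x\<close> and \<open>y\<close> lie on
      the same side of it.\<close>
    show ?thesis
    proof (cases "poly p a * poly p a' < 0")
      case True
      then have "poly q b * poly q b' < 0"
        using same_sign_mult[OF sa sa'] by (simp add: same_sign_def)
      then obtain y0 where y0: "b < y0" "y0 < b'" "poly q y0 = 0"
        by (rule poly_ivpD[OF ivp(2), rotated]) (use y in auto)
      from True obtain x0 where x0: "a < x0" "x0 < a'" "poly p x0 = 0"
        by (rule poly_ivpD[OF ivp(1), rotated]) (use ab ab' in auto)
      have "(x0, y0) \<in> ?G" using x0 y0 cell by simp
      then have c0: "x < x0 \<longleftrightarrow> y < y0" "x0 < x \<longleftrightarrow> y0 < y"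
        using cut unfolding same_cut_def by blast+
      consider "x = x0" | "x < x0" | "x0 < x" by (meson linorder_neqE)
      then show ?thesis
      proof cases
        case 1
        then have "y = y0" using c0 by (metis less_irrefl linorder_neqE)
        then show ?thesis using 1 x0 y0 by simp
      next
        case 2
        have "poly p a < poly p x \<and> poly p x < poly p x0 \<or> poly p a > poly p x \<and> poly p x > poly p x0"
          using 2 x0 ab by (intro poly_strictly_between[OF ivp(1)] nz1) auto
        moreover have "poly q b < poly q y \<and> poly q y < poly q y0 \<or> poly q b > poly q y \<and> poly q y > poly q y0"
          using 2 c0 y0 y by (intro poly_strictly_between[OF ivp(2)] nz2) auto
        ultimately show ?thesis using sa x0 y0 unfolding same_sign_def by auto
      next
        case 3
        have "poly p x0 < poly p x \<and> poly p x < poly p a' \<or> poly p x0 > poly p x \<and> poly p x > poly p a'"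
          using 3 x0 ab' by (intro poly_strictly_between[OF ivp(1)] nz1) auto
        moreover have "poly q y0 < poly q y \<and> poly q y < poly q b' \<or> poly q y0 > poly q y \<and> poly q y > poly q b'"
          using 3 c0 y0 y by (intro poly_strictly_between[OF ivp(2)] nz2) auto
        ultimately show ?thesis using sa' x0 y0 unfolding same_sign_def by auto
      qed
    next
      \<comment> \<open>Both end values lie weakly on one side of zero, and the value inside lies
        strictly between them, hence strictly on that side; the side is the same for
        \<open>q\<close>.\<close>
      case False
      have 1: "poly p a < poly p x \<and> poly p x < poly p a' \<or> poly p a > poly p x \<and> poly p x > poly p a'"
        using ab ab' by (intro poly_strictly_between[OF ivp(1)] nz1) auto
      have 2: "poly q b < poly q y \<and> poly q y < poly q b' \<or> poly q b > poly q y \<and> poly q y > poly q b'"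
        using y by (intro poly_strictly_between[OF ivp(2)] nz2) auto
      from False consider "\<not> poly p a < 0" "\<not> poly p a' < 0" | "\<not> 0 < poly p a" "\<not> 0 < poly p a'"
        by (metis mult_less_0_iff not_less_iff_gr_or_eq)
      then show ?thesis
      proof cases
        case c: 1
        then have "\<not> poly q b < 0" "\<not> poly q b' < 0" using sa sa' by (simp_all add: same_sign_def)
        with 1 2 c show ?thesis unfolding same_sign_def by auto
      next
        case c: 2
        then have "\<not> 0 < poly q b" "\<not> 0 < poly q b'" using sa sa' by (simp_all add: same_sign_def)
        with 1 2 c show ?thesis unfolding same_sign_def by auto
      qed
    qed
  qed
qed

text \<open>One polynomial joins a family \<open>N\<close> that already has a common diagram and
  contains its derivative. What links it to \<open>N\<close> is \<open>pts\<close>: its signs at the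
  roots of \<open>N\<close>, which will be known through remainders.\<close>

lemma sim_step:
  fixes G :: "('a::linordered_field \<times> 'b::linordered_field) set"
  assumes ivp: "poly_ivp TYPE('a)" "poly_ivp TYPE('b)" and mono: "mono_pairs G" and fin: "finite G"
    and N: "\<And>q1 q2. (q1, q2) \<in> N \<Longrightarrow> q1 \<noteq> 0 \<and> q2 \<noteq> 0 \<and> sim_on G q1 q2"
    and deriv: "(pderiv p1, pderiv p2) \<in> N"
    and deg: "degree p1 = degree p2" "same_sign (lead_coeff p1) (lead_coeff p2)"
    and pts: "\<And>a b q1 q2. (a, b) \<in> G \<Longrightarrow> (q1, q2) \<in> N \<Longrightarrow> poly q1 a = 0 \<Longrightarrow>
      same_sign (poly p1 a) (poly p2 b)"
  shows "\<exists>G'. finite G' \<and> mono_pairs G' \<and> sim_on G' p1 p2 \<and> (\<forall>q1 q2. (q1, q2) \<in> N \<longrightarrow> sim_on G' q1 q2)"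
proof -
  \<comment> \<open>Only roots of members of \<open>N\<close> are kept, since at other points of
    \<open>G\<close> nothing is known about the signs of \<open>p1\<close> and
    \<open>p2\<close>.\<close>
  define G0 where "G0 = {g \<in> G. \<exists>q1 q2. (q1, q2) \<in> N \<and> poly q1 (fst g) = 0}"
  have G0: "G0 \<subseteq> G" "finite G0" "mono_pairs G0"
    using fin mono by (auto simp: G0_def mono_pairs_def)
  have root1: "\<exists>b. (c, b) \<in> G0" if h: "(q1, q2) \<in> N" "poly q1 c = 0" for q1 q2 c
  proof -
    obtain b where "(c, b) \<in> G"
      using sim_on_root_dom[OF fin mono, of q1 q2 c] N[OF h(1)] h(2) by metis
    then show ?thesis using h by (auto simp: G0_def)
  qed
  have root2: "\<exists>a. (a, c) \<in> G0" if h: "(q1, q2) \<in> N" "poly q2 c = 0" for q1 q2 c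
  proof -
    have "finite (G\<inverse>)" "mono_pairs (G\<inverse>)" using fin mono by (simp_all add: mono_pairs_converse)
    moreover have "sim_on (G\<inverse>) q2 q1" "q2 \<noteq> 0" using N[OF h(1)] by (simp_all add: sim_on_converse)
    ultimately obtain a where "(c, a) \<in> G\<inverse>"
      using sim_on_root_dom[of "G\<inverse>" q2 q1 c] h(2) by metis
    then have a: "(a, c) \<in> G" by blast
    then have "same_sign (poly q1 a) (poly q2 c)"
      using N[OF h(1)] mono_pairs_same_cut[OF mono a] unfolding sim_on_def by blast
    then have "poly q1 a = 0" using h(2) same_sign_zeroD by blast
    then show ?thesis using a h by (auto simp: G0_def)
  qed
  \<comment> \<open>Dropping the other points is harmless: take \<open>x'\<close> matching
    \<open>y\<close> in all of \<open>G\<close>. No root of \<open>q1\<close> separates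
    \<open>x\<close> from \<open>x'\<close>, so \<open>q1\<close> has the same sign at both.\<close>
  have simN: "sim_on G0 q1 q2" if q: "(q1, q2) \<in> N" for q1 q2
    unfolding sim_on_def
  proof (intro allI impI)
    fix x y assume xy: "same_cut G0 x y"
    obtain x' where "same_cut (G\<inverse>) y x'"
      using same_cut_ex[of "G\<inverse>" y] fin mono by (auto simp: mono_pairs_converse)
    then have x': "same_cut G x' y" by (simp add: same_cut_converse)
    then have x'0: "same_cut G0 x' y" using G0 same_cut_mono by blast
    have sep: "c < x \<longleftrightarrow> c < x'" "x < c \<longleftrightarrow> x' < c" if "poly q1 c = 0" for c
      using root1[OF q that] xy x'0 unfolding same_cut_def by blast+
    have "same_sign (poly q1 x) (poly q1 x')"
    proof (cases "poly q1 x = 0 \<or> poly q1 x' = 0 \<or> x = x'")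
      case True
      then have "x = x'" using sep by (metis less_irrefl linorder_neqE)
      then show ?thesis by (simp add: same_sign_def)
    next
      case False
      have "\<not> poly q1 x * poly q1 x' < 0"
      proof
        assume neg: "poly q1 x * poly q1 x' < 0"
        then have neg': "poly q1 x' * poly q1 x < 0" by (simp add: mult.commute)
        consider "x < x'" | "x' < x" using False by (meson linorder_neqE)
        then show False
        proof cases
          case 1
          then show False using poly_ivpD[OF ivp(1) 1 neg] sep by (metis order.asym)
        next
          case 2
          then show False using poly_ivpD[OF ivp(1) 2 neg'] sep by (metis order.asym)
        qed
      qed
      then show ?thesis using False
        using linorder_less_linear[of "poly q1 x" 0] linorder_less_linear[of "poly q1 x'" 0]
        by (auto simp: same_sign_def mult_less_0_iff)
    qed
    moreover have "same_sign (poly q1 x') (poly q2 y)"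
      using N[OF q] x' unfolding sim_on_def by blast
    ultimately show "same_sign (poly q1 x) (poly q2 y)" by (rule same_sign_trans)
  qed
  obtain t1 t2 where t: "\<And>x. t1 \<le> x \<Longrightarrow> same_sign (poly p1 x) (lead_coeff p1)"
      "\<And>x. t2 \<le> x \<Longrightarrow> same_sign (poly p2 x) (lead_coeff p2)"
    using poly_sign_at_top[of p1] poly_sign_at_top[of p2] by blast
  obtain s1 s2 where s: "\<And>x. x \<le> s1 \<Longrightarrow> same_sign (poly p1 x) ((-1) ^ degree p1 * lead_coeff p1)"
      "\<And>x. x \<le> s2 \<Longrightarrow> same_sign (poly p2 x) ((-1) ^ degree p2 * lead_coeff p2)"
    using poly_sign_at_bot[of p1] poly_sign_at_bot[of p2] by blast
  \<comment> \<open>The new extreme marks lie outside all retained roots and in the range where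
    leading coefficients decide the sign.\<close>
  obtain u1 where u1: "\<And>a. a \<in> insert t1 (fst ` G0) \<Longrightarrow> a < u1"
    using finite_separate[of "insert t1 (fst ` G0)" "{}"] G0(2) by auto
  obtain u2 where u2: "\<And>a. a \<in> insert t2 (snd ` G0) \<Longrightarrow> a < u2"
    using finite_separate[of "insert t2 (snd ` G0)" "{}"] G0(2) by auto
  obtain l1 where l1: "\<And>a. a \<in> insert u1 (insert s1 (fst ` G0)) \<Longrightarrow> l1 < a"
    using finite_separate[of "{}" "insert u1 (insert s1 (fst ` G0))"] G0(2) by auto
  obtain l2 where l2: "\<And>a. a \<in> insert u2 (insert s2 (snd ` G0)) \<Longrightarrow> l2 < a"
    using finite_separate[of "{}" "insert u2 (insert s2 (snd ` G0))"] G0(2) by auto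
  define G1 where "G1 = insert (l1, l2) (insert (u1, u2) G0)"
  have bounds: "l1 < a" "a < u1" "l2 < b" "b < u2" if "(a, b) \<in> G0" for a b
    using that l1[of a] l2[of b] u1[of a] u2[of b] by force+
  have lu: "l1 < u1" "l2 < u2" "l1 < s1" "l2 < s2" "t1 < u1" "t2 < u2"
    using l1 l2 u1 u2 by auto
  have mono1: "mono_pairs G1"
    unfolding mono_pairs_def
  proof (intro allI impI)
    fix a b a' b' assume "(a, b) \<in> G1" "(a', b') \<in> G1"
    then show "a < a' \<longleftrightarrow> b < b'"
      using G0(3) bounds[of a b] bounds[of a' b'] lu(1,2) unfolding G1_def mono_pairs_def
      by (auto dest: order.asym)
  qed
  have fin1: "finite G1" using G0 by (simp add: G1_def)
  have same_top: "same_sign (poly p1 x) (poly p2 y)" if "u1 \<le> x" "u2 \<le> y" for x y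
    using t(1)[of x] t(2)[of y] that lu deg(2) same_sign_trans same_sign_sym
    by (meson order.strict_implies_order order.trans)
  have "same_sign ((-1) ^ degree p1 * lead_coeff p1) ((-1) ^ degree p2 * lead_coeff p2)"
    by (rule same_sign_mult[OF _ deg(2)])
      (cases "even (degree p2)"; simp add: same_sign_def deg(1))
  then have same_bot: "same_sign (poly p1 x) (poly p2 y)" if "x \<le> l1" "y \<le> l2" for x y
    using s(1)[of x] s(2)[of y] that lu same_sign_trans same_sign_sym
    by (meson order.strict_implies_order order.trans)
  have pts1: "same_sign (poly p1 a) (poly p2 b)" if ab: "(a, b) \<in> G1" for a b
  proof -
    have "same_sign (poly p1 a) (poly p2 b)" if ab0: "(a, b) \<in> G0"
    proof -
      obtain q1 q2 where "(q1, q2) \<in> N" "poly q1 a = 0" "(a, b) \<in> G"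
        using ab0 by (auto simp: G0_def)
      then show ?thesis using pts by blast
    qed
    then show ?thesis using ab same_top[of u1 u2] same_bot[of l1 l2] by (auto simp: G1_def)
  qed
  have crit1: "z \<in> fst ` G1" if "poly (pderiv p1) z = 0" for z
    using root1[OF deriv that] by (force simp: G1_def)
  have crit2: "z \<in> snd ` G1" if "poly (pderiv p2) z = 0" for z
    using root2[OF deriv that] by (force simp: G1_def)
  define G2 where "G2 = G1 \<union> {(x, y). same_cut G1 x y \<and> poly p1 x = 0 \<and> poly p2 y = 0}"
  have nz: "p1 \<noteq> 0" "p2 \<noteq> 0" using N[OF deriv] by auto
  have "{(x, y). same_cut G1 x y \<and> poly p1 x = 0 \<and> poly p2 y = 0} \<subseteq> {x. poly p1 x = 0} \<times> {x. poly p2 x = 0}"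
    by auto
  then have "finite {(x, y). same_cut G1 x y \<and> poly p1 x = 0 \<and> poly p2 y = 0}"
    using poly_roots_finite[OF nz(1)] poly_roots_finite[OF nz(2)] by (meson finite_SigmaI finite_subset)
  then have "finite G2" using fin1 by (simp add: G2_def)
  moreover have "mono_pairs G2"
    unfolding G2_def by (rule extend_mono_pairs[OF ivp mono1 crit1 crit2])
  moreover have "sim_on G2 p1 p2"
    unfolding G2_def
    by (rule extend_sim_on[OF ivp mono1 fin1 crit1 crit2 pts1 _ same_top _ same_bot])
      (auto simp: G1_def)
  moreover have "sim_on G2 q1 q2" if "(q1, q2) \<in> N" for q1 q2
    using sim_on_mono[OF simN[OF that], of G2] by (auto simp: G2_def G1_def)
  ultimately show ?thesis by blast
qed

section \<open>Elimination of one variable\<close>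

definition is_ring_hom :: "('d::comm_ring_1 \<Rightarrow> 'b::comm_ring_1) \<Rightarrow> bool" where
  "is_ring_hom f \<longleftrightarrow> f 1 = 1 \<and> (\<forall>x y. f (x + y) = f x + f y) \<and> (\<forall>x y. f (x * y) = f x * f y)"

lemma is_ring_homD:
  assumes "is_ring_hom f"
  shows "f 1 = 1" "f (x + y) = f x + f y" "f (x * y) = f x * f y" "f 0 = 0" "f (- x) = - f x"
    "f (x - y) = f x - f y" "f (x ^ n) = f x ^ n" "f (of_nat n) = of_nat n"
proof -
  show 1: "f 1 = 1" and add: "f (x + y) = f x + f y" and mult: "f (x * y) = f x * f y" for x y
    using assms by (auto simp: is_ring_hom_def)
  have "f 0 + f 0 = f 0" using add[of 0 0] by simp
  then show 0: "f 0 = 0" by simp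
  have m: "f (- x) = - f x" for x
    using add[of "-x" x] 0 by (simp add: eq_neg_iff_add_eq_0)
  show "f (- x) = - f x" by (rule m)
  show "f (x - y) = f x - f y" using add[of x "- y"] m[of y] by simp
  show "f (x ^ n) = f x ^ n" by (induction n) (simp_all add: 1 mult)
  show "f (of_nat n) = of_nat n" by (induction n) (simp_all add: 0 1 add)
qed

lemma is_ring_hom_sum: "is_ring_hom f \<Longrightarrow> f (sum g A) = (\<Sum>x\<in>A. f (g x))"
  by (induction A rule: infinite_finite_induct) (simp_all add: is_ring_homD)

lemma is_ring_hom_prod: "is_ring_hom f \<Longrightarrow> f (prod g A) = (\<Prod>x\<in>A. f (g x))"
  by (induction A rule: infinite_finite_induct) (simp_all add: is_ring_homD)

context
  fixes f :: "'d::comm_ring_1 \<Rightarrow> 'b::comm_ring_1"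
  assumes f: "is_ring_hom f"
begin

lemma coeff_map_poly_hom: "coeff (map_poly f p) n = f (coeff p n)"
  by (simp add: coeff_map_poly is_ring_homD[OF f])

lemma map_poly_hom_add: "map_poly f (p + q) = map_poly f p + map_poly f q"
  by (rule poly_eqI) (simp add: coeff_map_poly_hom is_ring_homD[OF f])

lemma map_poly_hom_diff: "map_poly f (p - q) = map_poly f p - map_poly f q"
  by (rule poly_eqI) (simp add: coeff_map_poly_hom is_ring_homD[OF f])

lemma map_poly_hom_mult: "map_poly f (p * q) = map_poly f p * map_poly f q"
  by (rule poly_eqI) (simp add: coeff_map_poly_hom coeff_mult is_ring_hom_sum[OF f] is_ring_homD[OF f])

lemma map_poly_hom_smult: "map_poly f (smult c p) = smult (f c) (map_poly f p)"
  by (rule poly_eqI) (simp add: coeff_map_poly_hom is_ring_homD[OF f])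

lemma map_poly_hom_const: "map_poly f [:c:] = [:f c:]"
  by (simp add: map_poly_pCons is_ring_homD[OF f])

lemma map_poly_hom_monom: "map_poly f (monom c n) = monom (f c) n"
  by (rule map_poly_monom) (simp add: is_ring_homD[OF f])

lemma map_poly_hom_sum: "map_poly f (sum g A) = (\<Sum>x\<in>A. map_poly f (g x))"
  by (induction A rule: infinite_finite_induct) (simp_all add: map_poly_hom_add)

lemma poly_map_poly_hom: "poly (map_poly f p) (f x) = f (poly p x)"
  by (induction p) (simp_all add: map_poly_pCons is_ring_homD[OF f])

end

lemma degree_map_poly_hom:
  assumes f: "is_ring_hom f" and "f (lead_coeff p) \<noteq> 0"
  shows "degree (map_poly f p) = degree p"
proof (rule antisym)
  show "degree (map_poly f p) \<le> degree p"
    by (rule degree_le) (simp add: coeff_map_poly_hom[OF f] coeff_eq_0 is_ring_homD[OF f])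
  show "degree p \<le> degree (map_poly f p)"
    using assms(2) by (intro le_degree) (simp add: coeff_map_poly_hom[OF f])
qed

lemma degree_pderiv_le: "degree (pderiv p) \<le> degree p - 1"
  by (rule degree_le) (auto simp: coeff_pderiv coeff_eq_0)

lemma map_poly_hom_pderiv:
  fixes f :: "'d::{comm_ring_1,semiring_no_zero_divisors} \<Rightarrow> 'b::{comm_ring_1,semiring_no_zero_divisors}"
  assumes f: "is_ring_hom f"
  shows "map_poly f (pderiv p) = pderiv (map_poly f p)"
  by (rule poly_eqI)
    (simp add: coeff_map_poly_hom[OF f] coeff_pderiv is_ring_homD[OF f] del: of_nat_Suc)

section \<open>Truncations and pseudo-remainders\<close>

lemma poly_cutoff_eq_0I: "n = 0 \<Longrightarrow> poly_cutoff n p = 0"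
  by (simp add: poly_eq_iff coeff_poly_cutoff)

lemma degree_poly_cutoff_le: "degree (poly_cutoff n p) \<le> degree p"
  by (rule degree_le) (auto simp: coeff_poly_cutoff coeff_eq_0)

lemma degree_poly_cutoff_less: "0 < n \<Longrightarrow> degree (poly_cutoff n p) < n"
  using degree_le[of "n - 1" "poly_cutoff n p"] by (force simp: coeff_poly_cutoff)

lemma poly_cutoff_poly_cutoff: "poly_cutoff m (poly_cutoff n p) = poly_cutoff (min m n) p"
  by (simp add: poly_eq_iff coeff_poly_cutoff)

lemma poly_cutoff_self: "degree p < n \<Longrightarrow> poly_cutoff n p = p"
  by (auto simp: poly_eq_iff coeff_poly_cutoff coeff_eq_0)

text \<open>A homomorphism may annihilate leading coefficients. Among the truncations of
  \<open>q\<close> there is one with the same image whose own leading coefficient survives; the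
  bound on \<open>j\<close> keeps the set finite.\<close>

definition truncations :: "'a::zero poly set \<Rightarrow> 'a poly set" where
  "truncations Q = {poly_cutoff j q | j q. q \<in> Q \<and> j \<le> Suc (degree q)}"

lemma finite_truncations: "finite Q \<Longrightarrow> finite (truncations Q)"
proof -
  assume "finite Q"
  moreover have "truncations Q = (\<Union>q\<in>Q. (\<lambda>j. poly_cutoff j q) ` {..Suc (degree q)})"
    by (auto simp: truncations_def)
  ultimately show ?thesis by simp
qed

lemma truncations_superset: "Q \<subseteq> truncations Q"
proof
  fix q assume "q \<in> Q"
  then show "q \<in> truncations Q"
    unfolding truncations_def
    by (intro CollectI exI[of _ "Suc (degree q)"] exI[of _ q]) (simp add: poly_cutoff_self)
qed

lemma poly_cutoff_in_truncations: "r \<in> truncations Q \<Longrightarrow> poly_cutoff j r \<in> truncations Q"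
  unfolding truncations_def
  by (force simp: poly_cutoff_poly_cutoff intro: min.coboundedI2)

text \<open>The pseudo-remainder, scaled by a further power of the leading coefficient of \<open>r\<close> so that the
  total scaling factor is a square.\<close>

definition signed_rem :: "'a::idom poly \<Rightarrow> 'a poly \<Rightarrow> 'a poly" where
  "signed_rem p r = smult (lead_coeff r ^ (Suc (degree p) - degree r)) (pseudo_mod p r)"

lemma signed_rem:
  fixes p r :: "'a::idom poly"
  assumes "r \<noteq> 0"
  shows "\<exists>e s. smult ((lead_coeff r ^ e)\<^sup>2) p = r * s + signed_rem p r"
    and "signed_rem p r = 0 \<or> degree (signed_rem p r) < degree r"
proof -
  define e where "e = Suc (degree p) - degree r"
  obtain s t where st: "pseudo_divmod p r = (s, t)" by (cases "pseudo_divmod p r")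
  have 1: "smult (lead_coeff r ^ e) p = r * s + t" and 2: "t = 0 \<or> degree t < degree r"
    using pseudo_divmod[OF assms st] by (simp_all add: e_def)
  have t: "signed_rem p r = smult (lead_coeff r ^ e) t"
    by (simp add: signed_rem_def pseudo_mod_def st e_def)
  have "smult ((lead_coeff r ^ e)\<^sup>2) p = smult (lead_coeff r ^ e) (smult (lead_coeff r ^ e) p)"
    by (simp add: power2_eq_square)
  also have "\<dots> = r * smult (lead_coeff r ^ e) s + signed_rem p r"
    unfolding 1 t by (simp add: smult_add_right)
  finally show "\<exists>e s. smult ((lead_coeff r ^ e)\<^sup>2) p = r * s + signed_rem p r" by blast
  show "signed_rem p r = 0 \<or> degree (signed_rem p r) < degree r"
    using 2 unfolding t by (metis degree_smult_le order.strict_trans1 smult_0_right)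
qed

text \<open>\<open>E\<close> collects parameters whose signs determine the sign diagram of
  \<open>P\<close> after specialisation. The point is to find a finite \<open>E\<close> that serves
  all \<open>\<phi>\<close> and \<open>\<psi>\<close> at once, which is the order of quantifiers in
  \<open>ex_transfers\<close>.\<close>

definition transfers :: "'d::idom poly set \<Rightarrow> 'd set \<Rightarrow>
    ('d \<Rightarrow> 'b::linordered_field) \<Rightarrow> ('d \<Rightarrow> 'c::linordered_field) \<Rightarrow> bool" where
  "transfers P E \<phi> \<psi> \<longleftrightarrow> is_ring_hom \<phi> \<longrightarrow> is_ring_hom \<psi> \<longrightarrow> (\<forall>e\<in>E. same_sign (\<phi> e) (\<psi> e)) \<longrightarrow>
    (\<exists>G. finite G \<and> mono_pairs G \<and> (\<forall>p\<in>P. sim_on G (map_poly \<phi> p) (map_poly \<psi> p)))"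

text \<open>If the leading coefficient of \<open>p\<close> is annihilated, \<open>p\<close> acts as
  its truncation (\<open>degen\<close>). Otherwise, at a root of a member of
  \<open>truncations Q\<close> the sign of \<open>p\<close> is that of a remainder
  (\<open>main\<close>), which is what \<open>sim_step\<close> asks for. The coefficients enter the
  sign conditions so that \<open>\<phi>\<close> and \<open>\<psi>\<close> fall into the same
  case.\<close>

lemma transfers_step:
  fixes P :: "'d::idom poly set" and \<phi> :: "'d \<Rightarrow> 'b::linordered_field" and \<psi> :: "'d \<Rightarrow> 'c::linordered_field"
  assumes ivp: "poly_ivp TYPE('b)" "poly_ivp TYPE('c)" and d: "0 < degree p"
    and Q: "Q = insert (pderiv p) P"
    and main: "transfers (truncations Q \<union> signed_rem p ` (truncations Q - {0})) E1 \<phi> \<psi>"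
    and degen: "transfers (insert (poly_cutoff (degree p) p) P) E2 \<phi> \<psi>"
  shows "transfers (insert p P) (E1 \<union> E2 \<union> (\<Union>q\<in>insert p Q. range (coeff q))) \<phi> \<psi>"
  unfolding transfers_def
proof (intro impI)
  assume \<phi>: "is_ring_hom \<phi>" and \<psi>: "is_ring_hom \<psi>"
    and E: "\<forall>e\<in>E1 \<union> E2 \<union> (\<Union>q\<in>insert p Q. range (coeff q)). same_sign (\<phi> e) (\<psi> e)"
  have coeff_sign: "same_sign (\<phi> (coeff q i)) (\<psi> (coeff q i))" if "q \<in> insert p Q" for q i
    using E that by blast
  show "\<exists>G. finite G \<and> mono_pairs G \<and> (\<forall>p\<in>insert p P. sim_on G (map_poly \<phi> p) (map_poly \<psi> p))"
  proof (cases "\<phi> (lead_coeff p) = 0")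
    case True
    have \<psi>0: "\<psi> (lead_coeff p) = 0"
      using True coeff_sign[of p "degree p"] same_sign_zeroD by fastforce
    have cut: "map_poly \<theta> p = map_poly \<theta> (poly_cutoff (degree p) p)"
      if "is_ring_hom \<theta>" "\<theta> (lead_coeff p) = 0" for \<theta> :: "'d \<Rightarrow> 'e::linordered_field"
    proof (rule poly_eqI)
      fix i
      show "coeff (map_poly \<theta> p) i = coeff (map_poly \<theta> (poly_cutoff (degree p) p)) i"
        using that(2) coeff_eq_0[of p i] is_ring_homD(4)[OF that(1)]
        by (cases i "degree p" rule: linorder_cases)
          (simp_all add: coeff_map_poly_hom[OF that(1)] coeff_poly_cutoff)
    qed
    have "\<exists>G. finite G \<and> mono_pairs G \<and>
        (\<forall>q\<in>insert (poly_cutoff (degree p) p) P. sim_on G (map_poly \<phi> q) (map_poly \<psi> q))"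
      using degen \<phi> \<psi> E unfolding transfers_def by blast
    then show ?thesis using cut[OF \<phi> True] cut[OF \<psi> \<psi>0] by auto
  next
    case False
    then have \<psi>n: "\<psi> (lead_coeff p) \<noteq> 0"
      using coeff_sign[of p "degree p"] same_sign_zeroD by fastforce
    obtain G where G: "finite G" "mono_pairs G"
      and sim: "\<And>q. q \<in> truncations Q \<Longrightarrow> sim_on G (map_poly \<phi> q) (map_poly \<psi> q)"
      and simr: "\<And>q. q \<in> truncations Q \<Longrightarrow> q \<noteq> 0 \<Longrightarrow>
          sim_on G (map_poly \<phi> (signed_rem p q)) (map_poly \<psi> (signed_rem p q))"
    proof -
      have "\<exists>G. finite G \<and> mono_pairs G \<and> (\<forall>q\<in>truncations Q \<union> signed_rem p ` (truncations Q - {0}).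
          sim_on G (map_poly \<phi> q) (map_poly \<psi> q))"
        using main \<phi> \<psi> E unfolding transfers_def by blast
      then show thesis using that by blast
    qed
    \<comment> \<open>Members with image zero are left out, as every point would be a root of
      them.\<close>
    define N where "N = {(map_poly \<phi> q, map_poly \<psi> q) | q. q \<in> truncations Q \<and> map_poly \<phi> q \<noteq> 0}"
    have coeff_zero: "\<phi> (coeff q i) = 0 \<longleftrightarrow> \<psi> (coeff q i) = 0" if "q \<in> truncations Q" for q i
    proof -
      obtain j q' where q: "q = poly_cutoff j q'" "q' \<in> Q"
        using \<open>q \<in> truncations Q\<close> by (auto simp: truncations_def)
      have "\<phi> (coeff q' i) = 0 \<longleftrightarrow> \<psi> (coeff q' i) = 0"
        using coeff_sign[of q' i] q(2) same_sign_zeroD by blast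
      then show ?thesis
        by (simp add: q(1) coeff_poly_cutoff is_ring_homD[OF \<phi>] is_ring_homD[OF \<psi>])
    qed
    have zero_iff: "map_poly \<phi> q = 0 \<longleftrightarrow> map_poly \<psi> q = 0" if "q \<in> truncations Q" for q
      using coeff_zero[OF that] by (simp add: poly_eq_iff coeff_map_poly_hom[OF \<phi>] coeff_map_poly_hom[OF \<psi>])
    have deg: "degree (map_poly \<phi> p) = degree p" "degree (map_poly \<psi> p) = degree p"
      using degree_map_poly_hom[OF \<phi> False] degree_map_poly_hom[OF \<psi> \<psi>n] .
    have dnz: "map_poly \<phi> (pderiv p) \<noteq> 0"
      using d deg by (simp add: map_poly_hom_pderiv[OF \<phi>] pderiv_eq_0_iff)
    have "\<exists>G'. finite G' \<and> mono_pairs G' \<and> sim_on G' (map_poly \<phi> p) (map_poly \<psi> p) \<and>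
        (\<forall>q1 q2. (q1, q2) \<in> N \<longrightarrow> sim_on G' q1 q2)"
    proof (rule sim_step[OF ivp G(2,1)])
      show "q1 \<noteq> 0 \<and> q2 \<noteq> 0 \<and> sim_on G q1 q2" if "(q1, q2) \<in> N" for q1 q2
        using that sim zero_iff by (auto simp: N_def)
      have "pderiv p \<in> truncations Q" using truncations_superset Q by blast
      then show "(pderiv (map_poly \<phi> p), pderiv (map_poly \<psi> p)) \<in> N"
        using dnz unfolding N_def map_poly_hom_pderiv[OF \<phi>, symmetric] map_poly_hom_pderiv[OF \<psi>, symmetric]
        by blast
      show "degree (map_poly \<phi> p) = degree (map_poly \<psi> p)" using deg by simp
      show "same_sign (lead_coeff (map_poly \<phi> p)) (lead_coeff (map_poly \<psi> p))"
        using coeff_sign[of p "degree p"] by (simp add: deg coeff_map_poly_hom[OF \<phi>] coeff_map_poly_hom[OF \<psi>])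
    next
      fix a b q1 q2 assume ab: "(a, b) \<in> G" and q12: "(q1, q2) \<in> N" and root: "poly q1 a = 0"
      then obtain q where q: "q \<in> truncations Q" "q1 = map_poly \<phi> q" "q2 = map_poly \<psi> q" "map_poly \<phi> q \<noteq> 0"
        by (auto simp: N_def)
      \<comment> \<open>\<open>k\<close> is the degree that \<open>q\<close> retains after
        specialisation. The cutoff \<open>r\<close> has the same image as \<open>q\<close>, and its
        leading coefficient is not annihilated, so division by \<open>r\<close> is meaningful in
        both fields.\<close>
      define k where "k = degree (map_poly \<phi> q)"
      define r where "r = poly_cutoff (Suc k) q"
      have r: "r \<in> truncations Q" using q(1) poly_cutoff_in_truncations by (auto simp: r_def)
      have \<phi>k: "\<phi> (coeff q k) \<noteq> 0"
        using q(4) unfolding k_def by (metis coeff_map_poly_hom[OF \<phi>] leading_coeff_0_iff)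
      have \<psi>k: "\<psi> (coeff q k) \<noteq> 0" using \<phi>k coeff_zero[OF q(1)] by blast
      have "coeff q k \<noteq> 0" using \<phi>k is_ring_homD(4)[OF \<phi>] by auto
      then have "degree r = k"
        using degree_poly_cutoff_less[of "Suc k" q] le_degree[of r k] by (auto simp: r_def coeff_poly_cutoff)
      then have lc: "lead_coeff r = coeff q k" by (simp add: r_def coeff_poly_cutoff)
      then have "r \<noteq> 0" using \<open>coeff q k \<noteq> 0\<close> by auto
      have above: "\<phi> (coeff q i) = 0" if "i > k" for i
        using that coeff_eq_0[of "map_poly \<phi> q" i] by (simp add: k_def coeff_map_poly_hom[OF \<phi>])
      then have above': "\<psi> (coeff q i) = 0" if "i > k" for i
        using that coeff_zero[OF q(1)] by blast
      have mr: "map_poly \<phi> r = q1" "map_poly \<psi> r = q2"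
        using above above' by (auto simp: poly_eq_iff r_def q coeff_map_poly_hom[OF \<phi>]
            coeff_map_poly_hom[OF \<psi>] coeff_poly_cutoff is_ring_homD[OF \<phi>] is_ring_homD[OF \<psi>])
      have cut: "same_cut G a b" using mono_pairs_same_cut[OF G(2) ab] .
      then have "same_sign (poly q1 a) (poly q2 b)"
        using sim[OF q(1)] unfolding sim_on_def q by blast
      then have root2: "poly q2 b = 0" using root same_sign_zeroD by blast
      obtain e s where es: "smult ((lead_coeff r ^ e)\<^sup>2) p = r * s + signed_rem p r"
        using signed_rem(1)[OF \<open>r \<noteq> 0\<close>] by blast
      \<comment> \<open>At a root of \<open>r\<close> the division identity leaves only the
        remainder, up to a factor that is a square and so does not affect signs.\<close>
      have ev: "(\<theta> (coeff q k) ^ e)\<^sup>2 * poly (map_poly \<theta> p) x = poly (map_poly \<theta> (signed_rem p r)) x"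
        if \<theta>: "is_ring_hom \<theta>" and "poly (map_poly \<theta> r) x = 0" for x and \<theta> :: "'d \<Rightarrow> 'e::linordered_field"
        using arg_cong[OF es, of "\<lambda>u. poly (map_poly \<theta> u) x"] that(2)
        by (simp add: map_poly_hom_add[OF \<theta>] map_poly_hom_mult[OF \<theta>] map_poly_hom_smult[OF \<theta>]
            is_ring_homD[OF \<theta>] lc)
      have "same_sign (poly (map_poly \<phi> (signed_rem p r)) a) (poly (map_poly \<psi> (signed_rem p r)) b)"
        using simr[OF r \<open>r \<noteq> 0\<close>] cut unfolding sim_on_def by blast
      then have "same_sign ((\<phi> (coeff q k) ^ e)\<^sup>2 * poly (map_poly \<phi> p) a)
          ((\<psi> (coeff q k) ^ e)\<^sup>2 * poly (map_poly \<psi> p) b)"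
        using ev[OF \<phi>] ev[OF \<psi>] root root2 by (simp add: mr)
      then show "same_sign (poly (map_poly \<phi> p) a) (poly (map_poly \<psi> p) b)"
        by (rule same_sign_mult_cancel[rotated 2]) (use \<phi>k \<psi>k in auto)
    qed
    then obtain G' where G': "finite G'" "mono_pairs G'" "sim_on G' (map_poly \<phi> p) (map_poly \<psi> p)"
        "\<And>q1 q2. (q1, q2) \<in> N \<Longrightarrow> sim_on G' q1 q2" by blast
    have "sim_on G' (map_poly \<phi> q) (map_poly \<psi> q)" if "q \<in> P" for q
    proof -
      have q: "q \<in> truncations Q" using that truncations_superset Q by blast
      show ?thesis
      proof (cases "map_poly \<phi> q = 0")
        case True
        then show ?thesis using zero_iff[OF q] by (simp add: sim_on_def)
      next
        case False
        then show ?thesis using G'(4) q by (auto simp: N_def)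
      qed
    qed
    with G' show ?thesis by blast
  qed
qed

text \<open>Induction on a bound \<open>d\<close> for the degrees and, inside it, on the number of
  polynomials of the top degree. Removing one such \<open>p\<close> brings in only polynomials of
  smaller degree besides those already present.\<close>

theorem ex_transfers:
  fixes P :: "'d::idom poly set"
  assumes ivp: "poly_ivp TYPE('b::linordered_field)" "poly_ivp TYPE('c::linordered_field)" and "finite P"
  shows "\<exists>E. finite E \<and> (\<forall>(\<phi> :: 'd \<Rightarrow> 'b) (\<psi> :: 'd \<Rightarrow> 'c). transfers P E \<phi> \<psi>)"
proof -
  have "\<exists>E. finite E \<and> (\<forall>(\<phi> :: 'd \<Rightarrow> 'b) (\<psi> :: 'd \<Rightarrow> 'c). transfers P E \<phi> \<psi>)"
    if "finite P" "\<forall>p\<in>P. degree p < d" for d and P :: "'d poly set"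
    using that
  proof (induction d arbitrary: P)
    case 0
    then have "P = {}" by auto
    have "finite ({} :: ('b \<times> 'c) set)" "mono_pairs ({} :: ('b \<times> 'c) set)"
      by (simp_all add: mono_pairs_def)
    then show ?case unfolding transfers_def \<open>P = {}\<close> by (intro exI[of _ "{}"]) blast
  next
    case (Suc d)
    have "\<exists>E. finite E \<and> (\<forall>(\<phi> :: 'd \<Rightarrow> 'b) (\<psi> :: 'd \<Rightarrow> 'c). transfers P E \<phi> \<psi>)"
      if "card {p \<in> P. degree p = d} \<le> n" "finite P" "\<forall>p\<in>P. degree p \<le> d" for n and P :: "'d poly set"
      using that
    proof (induction n arbitrary: P)
      case 0
      then have "{p \<in> P. degree p = d} = {}" by simp
      then have "\<forall>p\<in>P. degree p < d" using "0.prems"(3) by (auto simp: order.order_iff_strict)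
      then show ?case using Suc.IH "0.prems"(2) by blast
    next
      case (Suc n)
      note outer = \<open>\<And>P. finite P \<Longrightarrow> \<forall>p\<in>P. degree p < d \<Longrightarrow>
          \<exists>E. finite E \<and> (\<forall>(\<phi> :: 'd \<Rightarrow> 'b) (\<psi> :: 'd \<Rightarrow> 'c). transfers P E \<phi> \<psi>)\<close>
      show ?case
      proof (cases "\<forall>p\<in>P. degree p < d")
        case True
        then show ?thesis using outer Suc.prems(2) by blast
      next
        case False
        then obtain p where p: "p \<in> P" "degree p = d" using Suc.prems(3) by force
        define P0 where "P0 = P - {p}"
        have P: "P = insert p P0" "finite P0" using p Suc.prems by (auto simp: P0_def)
        have "{q \<in> P0. degree q = d} = {q \<in> P. degree q = d} - {p}" by (auto simp: P0_def)
        then have card0: "card {q \<in> P0. degree q = d} \<le> n"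
          using Suc.prems(1,2) p by simp
        have deg0: "\<forall>q\<in>P0. degree q \<le> d" using Suc.prems(3) P by auto
        have small: "\<exists>E. finite E \<and> (\<forall>(\<phi> :: 'd \<Rightarrow> 'b) (\<psi> :: 'd \<Rightarrow> 'c). transfers P' E \<phi> \<psi>)"
          if "finite P'" "\<forall>q\<in>P'. degree q < d \<or> q \<in> P0" for P'
        proof (rule Suc.IH)
          have "{q \<in> P'. degree q = d} \<subseteq> {q \<in> P0. degree q = d}" using that by auto
          then have "card {q \<in> P'. degree q = d} \<le> card {q \<in> P0. degree q = d}"
            using P(2) by (intro card_mono) auto
          then show "card {q \<in> P'. degree q = d} \<le> n" using card0 by simp
          show "finite P'" "\<forall>q\<in>P'. degree q \<le> d" using that deg0 by (auto simp: order.order_iff_strict)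
        qed
        show ?thesis
        proof (cases "d = 0")
          \<comment> \<open>A constant has nothing to differentiate or divide; its own sign is the
            condition to add.\<close>
          case True
          obtain E0 where E0: "finite E0" "\<forall>(\<phi> :: 'd \<Rightarrow> 'b) (\<psi> :: 'd \<Rightarrow> 'c). transfers P0 E0 \<phi> \<psi>"
            using small[of P0] P by auto
          obtain c where c: "p = [:c:]" using p True degree_eq_zeroE by blast
          have "transfers P (insert c E0) \<phi> \<psi>" for \<phi> :: "'d \<Rightarrow> 'b" and \<psi> :: "'d \<Rightarrow> 'c"
            unfolding transfers_def
          proof (intro impI)
            assume h: "is_ring_hom \<phi>" "is_ring_hom \<psi>" "\<forall>e\<in>insert c E0. same_sign (\<phi> e) (\<psi> e)"
            then obtain G where "finite G" "mono_pairs G" "\<forall>p\<in>P0. sim_on G (map_poly \<phi> p) (map_poly \<psi> p)"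
              using E0(2) unfolding transfers_def by blast
            moreover have "sim_on G (map_poly \<phi> p) (map_poly \<psi> p)"
              using h by (simp add: c sim_on_def map_poly_hom_const)
            ultimately show "\<exists>G. finite G \<and> mono_pairs G \<and> (\<forall>p\<in>P. sim_on G (map_poly \<phi> p) (map_poly \<psi> p))"
              using P by auto
          qed
          then show ?thesis using E0(1) by blast
        next
          case False
          define Q where "Q = insert (pderiv p) P0"
          have finT: "finite (truncations Q)" using P(2) by (simp add: Q_def finite_truncations)
          \<comment> \<open>A truncation that still has degree \<open>d\<close> cuts nothing off, so
            it is one of the polynomials already counted.\<close>
          have dT: "degree q < d \<or> q \<in> P0" if qT: "q \<in> truncations Q" for q
          proof -
            obtain j q' where q: "q = poly_cutoff j q'" "q' \<in> Q"
              using qT by (auto simp: truncations_def)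
            show ?thesis
            proof (cases "q' = pderiv p")
              case True
              have "degree q \<le> degree (pderiv p)" using q True degree_poly_cutoff_le by blast
              also have "\<dots> < d" using False p degree_pderiv_le[of p] by linarith
              finally show ?thesis by simp
            next
              case False
              then have q': "q' \<in> P0" "degree q' \<le> d" using q deg0 by (auto simp: Q_def)
              show ?thesis
              proof (cases "degree q < d")
                case ge: False
                then have "degree q = d" using q(1) q'(2) degree_poly_cutoff_le[of j q'] by simp
                then have "j > d"
                  using \<open>d \<noteq> 0\<close> degree_poly_cutoff_less[of j q'] q(1) poly_cutoff_eq_0I[of j q']
                  by (cases "j = 0") auto
                then have "q = q'" using q(1) q'(2) poly_cutoff_self[of q' j] by simp
                then show ?thesis using q' by simp
              qed simp
            qed
          qed
          have dR: "degree (signed_rem p r) < d" if "r \<in> truncations Q - {0}" for r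
          proof -
            have "degree r \<le> d" using that dT[of r] deg0 by force
            then show ?thesis using signed_rem(2)[of r p] that False by auto
          qed
          have "\<exists>E. finite E \<and> (\<forall>(\<phi> :: 'd \<Rightarrow> 'b) (\<psi> :: 'd \<Rightarrow> 'c).
              transfers (truncations Q \<union> signed_rem p ` (truncations Q - {0})) E \<phi> \<psi>)"
            by (rule small) (use finT dT dR in auto)
          then obtain E1 where E1: "finite E1" "\<And>(\<phi> :: 'd \<Rightarrow> 'b) (\<psi> :: 'd \<Rightarrow> 'c).
              transfers (truncations Q \<union> signed_rem p ` (truncations Q - {0})) E1 \<phi> \<psi>" by blast
          have "\<exists>E. finite E \<and> (\<forall>(\<phi> :: 'd \<Rightarrow> 'b) (\<psi> :: 'd \<Rightarrow> 'c).
              transfers (insert (poly_cutoff (degree p) p) P0) E \<phi> \<psi>)"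
            by (rule small) (use P(2) False p degree_poly_cutoff_less[of d p] in auto)
          then obtain E2 where E2: "finite E2" "\<And>(\<phi> :: 'd \<Rightarrow> 'b) (\<psi> :: 'd \<Rightarrow> 'c).
              transfers (insert (poly_cutoff (degree p) p) P0) E2 \<phi> \<psi>" by blast
          define E where "E = E1 \<union> E2 \<union> (\<Union>q\<in>insert p Q. range (coeff q))"
          have "finite (range (coeff q))" for q :: "'d poly"
          proof -
            have "range (coeff q) \<subseteq> insert 0 (coeff q ` {..degree q})"
              using coeff_eq_0[of q] by (auto simp: not_le[symmetric])
            then show ?thesis by (rule finite_subset) simp
          qed
          then have "finite E" using E1 E2 P(2) by (simp add: E_def Q_def)
          moreover have "transfers P E \<phi> \<psi>" for \<phi> :: "'d \<Rightarrow> 'b" and \<psi> :: "'d \<Rightarrow> 'c"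
            unfolding P(1) E_def using False p
            by (intro transfers_step[OF ivp _ Q_def E1(2) E2(2)]) auto
          ultimately show ?thesis by blast
        qed
      qed
    qed
    then show ?case using Suc.prems by (meson le_refl less_Suc_eq_le)
  qed
  moreover have "\<forall>p\<in>P. degree p < Suc (Max (degree ` P))"
    using \<open>finite P\<close> by (auto simp: less_Suc_eq_le)
  ultimately show ?thesis using \<open>finite P\<close> by blast
qed

section \<open>Elimination of several variables\<close>

definition monom_value :: "('n::finite \<Rightarrow> 'b::comm_monoid_mult) \<Rightarrow> ('n \<Rightarrow>\<^sub>0 nat) \<Rightarrow> 'b" where
  "monom_value x e = (\<Prod>i\<in>UNIV. x i ^ Poly_Mapping.lookup e i)"

text \<open>The homomorphism \<open>\<iota>\<close> lets one polynomial over a ring of parameters be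
  evaluated in different fields, or in one field at different parameter values.\<close>

definition eval_hom :: "('k::comm_ring_1 \<Rightarrow> 'b::comm_ring_1) \<Rightarrow> ('n::finite \<Rightarrow> 'b) \<Rightarrow> ('k, 'n) mpoly \<Rightarrow> 'b"
  where "eval_hom \<iota> x p = (\<Sum>e\<in>Poly_Mapping.keys p. \<iota> (Poly_Mapping.lookup p e) * monom_value x e)"

lemma eval_mpoly_eq_eval_hom: "eval_mpoly p x = eval_hom (\<lambda>c. c) (($) x) p"
  by (simp add: eval_mpoly_def eval_hom_def monom_value_def)

lemma monom_value_add: "monom_value x (e + e') = monom_value x e * monom_value x e'"
  by (simp add: monom_value_def lookup_add power_add prod.distrib)

lemma monom_value_0 [simp]: "monom_value x 0 = 1"
  by (simp add: monom_value_def)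

lemma monom_value_zero_fun:
  "monom_value (\<lambda>_. 0 :: 'b::comm_semiring_1) e = (if e = 0 then 1 else 0)"
proof (cases "e = 0")
  case False
  then obtain i where "Poly_Mapping.lookup e i \<noteq> 0"
    by (metis lookup_zero poly_mapping_eqI)
  then show ?thesis using False unfolding monom_value_def
    by (auto intro!: prod_zero bexI[of _ i] simp: zero_power)
qed simp

lemma monom_value_fun_upd:
  "monom_value (x(v := a)) e = monom_value x (Poly_Mapping.update v 0 e) * a ^ Poly_Mapping.lookup e v"
proof -
  have "(\<Prod>i\<in>UNIV - {v}. (x(v := a)) i ^ Poly_Mapping.lookup e i) =
      (\<Prod>i\<in>UNIV - {v}. x i ^ Poly_Mapping.lookup (Poly_Mapping.update v 0 e) i)"
    by (rule prod.cong) (auto simp: lookup_update)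
  then show ?thesis
    unfolding monom_value_def
    by (simp add: prod.remove[of UNIV v] lookup_update mult.commute)
qed

lemma poly_mapping_sum_single:
  fixes p :: "'a \<Rightarrow>\<^sub>0 'b::comm_monoid_add"
  shows "p = (\<Sum>e\<in>Poly_Mapping.keys p. Poly_Mapping.single e (Poly_Mapping.lookup p e))"
proof (rule poly_mapping_eqI)
  fix k
  have "Poly_Mapping.lookup (\<Sum>e\<in>Poly_Mapping.keys p. Poly_Mapping.single e (Poly_Mapping.lookup p e)) k =
      (\<Sum>e\<in>Poly_Mapping.keys p. if e = k then Poly_Mapping.lookup p k else 0)"
    unfolding lookup_sum by (rule sum.cong) (auto simp: lookup_single when_def)
  then show "Poly_Mapping.lookup p k =
      Poly_Mapping.lookup (\<Sum>e\<in>Poly_Mapping.keys p. Poly_Mapping.single e (Poly_Mapping.lookup p e)) k"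
    by (simp add: in_keys_iff)
qed

context
  fixes \<iota> :: "'k::comm_ring_1 \<Rightarrow> 'b::comm_ring_1" and x :: "'n::finite \<Rightarrow> 'b"
  assumes \<iota>: "is_ring_hom \<iota>"
begin

lemma eval_hom_superset:
  assumes "finite S" "Poly_Mapping.keys p \<subseteq> S"
  shows "eval_hom \<iota> x p = (\<Sum>e\<in>S. \<iota> (Poly_Mapping.lookup p e) * monom_value x e)"
  unfolding eval_hom_def using assms
  by (intro sum.mono_neutral_left) (auto simp: in_keys_iff is_ring_homD[OF \<iota>])

lemma eval_hom_single: "eval_hom \<iota> x (Poly_Mapping.single e c) = \<iota> c * monom_value x e"
  by (subst eval_hom_superset[of "{e}"]) auto

lemma eval_hom_add: "eval_hom \<iota> x (p + q) = eval_hom \<iota> x p + eval_hom \<iota> x q"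
proof -
  define S where "S = Poly_Mapping.keys p \<union> Poly_Mapping.keys q \<union> Poly_Mapping.keys (p + q)"
  have S: "finite S" "Poly_Mapping.keys p \<subseteq> S" "Poly_Mapping.keys q \<subseteq> S" "Poly_Mapping.keys (p + q) \<subseteq> S"
    by (auto simp: S_def)
  show ?thesis
    unfolding eval_hom_superset[OF S(1,2)] eval_hom_superset[OF S(1,3)] eval_hom_superset[OF S(1,4)]
    by (simp add: lookup_add is_ring_homD[OF \<iota>] algebra_simps sum.distrib)
qed

lemma eval_hom_sum: "eval_hom \<iota> x (sum f A) = (\<Sum>a\<in>A. eval_hom \<iota> x (f a))"
  by (induction A rule: infinite_finite_induct) (simp_all add: eval_hom_add, simp_all add: eval_hom_def)

lemma eval_hom_mult: "eval_hom \<iota> x (p * q) = eval_hom \<iota> x p * eval_hom \<iota> x q"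
proof -
  have "p * q = (\<Sum>e\<in>Poly_Mapping.keys p. Poly_Mapping.single e (Poly_Mapping.lookup p e)) *
      (\<Sum>e\<in>Poly_Mapping.keys q. Poly_Mapping.single e (Poly_Mapping.lookup q e))"
    by (simp add: poly_mapping_sum_single[symmetric])
  also have "eval_hom \<iota> x \<dots> = eval_hom \<iota> x p * eval_hom \<iota> x q"
    unfolding sum_product mult_single eval_hom_sum eval_hom_single
    by (simp add: eval_hom_def sum_product monom_value_add is_ring_homD[OF \<iota>] mult_ac)
  finally show ?thesis .
qed

lemma is_ring_hom_eval_hom: "is_ring_hom (eval_hom \<iota> x)"
proof -
  have "eval_hom \<iota> x 1 = 1"
    using eval_hom_single[of 0 1] by (simp add: is_ring_homD[OF \<iota>])
  then show ?thesis by (simp add: is_ring_hom_def eval_hom_add eval_hom_mult)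
qed

end

lemma eval_hom_zero_fun:
  assumes "is_ring_hom \<iota>"
  shows "eval_hom \<iota> (\<lambda>_. 0) p = \<iota> (Poly_Mapping.lookup p 0)"
proof -
  have "eval_hom \<iota> (\<lambda>_. 0) p =
      (\<Sum>e\<in>insert 0 (Poly_Mapping.keys p). \<iota> (Poly_Mapping.lookup p e) * monom_value (\<lambda>_. 0) e)"
    by (rule eval_hom_superset[OF assms]) auto
  also have "\<dots> = \<iota> (Poly_Mapping.lookup p 0)"
    by (subst sum.remove[of _ 0]) (auto simp: monom_value_zero_fun intro: sum.neutral)
  finally show ?thesis .
qed

text \<open>The usual identification with polynomials in the variable \<open>v\<close> over the
  polynomials in the other variables. The index type stays the same; the coefficients simply have
  exponent 0 at \<open>v\<close>.\<close>

definition as_poly :: "'n \<Rightarrow> ('k::comm_ring_1, 'n) mpoly \<Rightarrow> ('k, 'n) mpoly poly" where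
  "as_poly v p = (\<Sum>e\<in>Poly_Mapping.keys p.
    monom (Poly_Mapping.single (Poly_Mapping.update v 0 e) (Poly_Mapping.lookup p e)) (Poly_Mapping.lookup e v))"

lemma poly_as_poly:
  fixes \<iota> :: "'k::comm_ring_1 \<Rightarrow> 'b::comm_ring_1" and c :: "'n::finite \<Rightarrow> 'b"
  assumes \<iota>: "is_ring_hom \<iota>"
  shows "poly (map_poly (eval_hom \<iota> c) (as_poly v p)) x = eval_hom \<iota> (c(v := x)) p"
proof -
  note h = is_ring_hom_eval_hom[OF \<iota>, of c]
  show ?thesis
    unfolding as_poly_def map_poly_hom_sum[OF h] map_poly_hom_monom[OF h] eval_hom_single[OF \<iota>]
      poly_sum poly_monom
    by (simp add: eval_hom_def monom_value_fun_upd mult.assoc)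
qed

text \<open>The values \<open>c\<close> and \<open>c'\<close> matter only outside \<open>W\<close>.
  The parameters \<open>E1\<close> produced by eliminating \<open>v\<close> are themselves
  polynomials in the other variables, so the induction hypothesis can match their signs first; the
  common diagram then yields a value for \<open>v\<close>.\<close>

lemma quantifier_elimination_aux:
  fixes P :: "('k::idom, 'n::{finite,linorder}) mpoly set"
  assumes ivp: "poly_ivp TYPE('b::linordered_field)" "poly_ivp TYPE('c::linordered_field)"
    and "finite W" "finite P"
  shows "\<exists>E. finite E \<and> (\<forall>(\<iota> :: 'k \<Rightarrow> 'b) (\<kappa> :: 'k \<Rightarrow> 'c) c c'. is_ring_hom \<iota> \<longrightarrow> is_ring_hom \<kappa> \<longrightarrow>
    (\<forall>e\<in>E. same_sign (eval_hom \<iota> c e) (eval_hom \<kappa> c' e)) \<longrightarrow>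
    (\<forall>y. \<exists>x. \<forall>p\<in>P. same_sign (eval_hom \<iota> (override_on c x W) p) (eval_hom \<kappa> (override_on c' y W) p)))"
  using assms(3,4)
proof (induction W arbitrary: P rule: finite_induct)
  case empty
  then show ?case by (intro exI[of _ P]) simp
next
  case (insert v W)
  have "finite (as_poly v ` P)" using insert.prems by simp
  from ex_transfers[OF ivp this] obtain E1 where E1: "finite E1 \<and>
      (\<forall>(\<phi> :: ('k, 'n) mpoly \<Rightarrow> 'b) (\<psi> :: ('k, 'n) mpoly \<Rightarrow> 'c). transfers (as_poly v ` P) E1 \<phi> \<psi>)" ..
  from insert.IH[OF conjunct1[OF E1]] obtain E where E': "finite E \<and>
    (\<forall>(\<iota> :: 'k \<Rightarrow> 'b) (\<kappa> :: 'k \<Rightarrow> 'c) c c'. is_ring_hom \<iota> \<longrightarrow> is_ring_hom \<kappa> \<longrightarrow>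
    (\<forall>e\<in>E. same_sign (eval_hom \<iota> c e) (eval_hom \<kappa> c' e)) \<longrightarrow>
    (\<forall>y. \<exists>x. \<forall>p\<in>E1. same_sign (eval_hom \<iota> (override_on c x W) p) (eval_hom \<kappa> (override_on c' y W) p)))" ..
  then have E: "finite E"
    "\<And>(\<iota> :: 'k \<Rightarrow> 'b) (\<kappa> :: 'k \<Rightarrow> 'c) c c' y. is_ring_hom \<iota> \<Longrightarrow> is_ring_hom \<kappa> \<Longrightarrow>
    (\<forall>e\<in>E. same_sign (eval_hom \<iota> c e) (eval_hom \<kappa> c' e)) \<Longrightarrow>
    (\<exists>x. \<forall>p\<in>E1. same_sign (eval_hom \<iota> (override_on c x W) p) (eval_hom \<kappa> (override_on c' y W) p))"
    by simp_all
  have "\<exists>x. \<forall>p\<in>P. same_sign (eval_hom \<iota> (override_on c x (insert v W)) p)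
        (eval_hom \<kappa> (override_on c' y (insert v W)) p)"
    if \<iota>: "is_ring_hom \<iota>" and \<kappa>: "is_ring_hom \<kappa>"
      and sgn: "\<forall>e\<in>E. same_sign (eval_hom \<iota> c e) (eval_hom \<kappa> c' e)"
    for \<iota> :: "'k \<Rightarrow> 'b" and \<kappa> :: "'k \<Rightarrow> 'c" and c c' y
  proof -
    from E(2)[OF \<iota> \<kappa> sgn, of y] obtain x where
      x: "\<forall>p\<in>E1. same_sign (eval_hom \<iota> (override_on c x W) p) (eval_hom \<kappa> (override_on c' y W) p)" ..
    obtain G where G: "finite G" "mono_pairs G"
      "\<And>p. p \<in> P \<Longrightarrow> sim_on G (map_poly (eval_hom \<iota> (override_on c x W)) (as_poly v p))
          (map_poly (eval_hom \<kappa> (override_on c' y W)) (as_poly v p))"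
      using conjunct2[OF E1, rule_format, of "eval_hom \<iota> (override_on c x W)" "eval_hom \<kappa> (override_on c' y W)"] x
        is_ring_hom_eval_hom[OF \<iota>, of "override_on c x W"] is_ring_hom_eval_hom[OF \<kappa>, of "override_on c' y W"]
      unfolding transfers_def by auto
    obtain a where "same_cut (G\<inverse>) (y v) a"
      by (rule same_cut_ex[of "G\<inverse>" "y v"]) (use G in \<open>simp_all add: mono_pairs_converse\<close>)
    then have a: "same_cut G a (y v)" by (simp add: same_cut_converse)
    have "same_sign (eval_hom \<iota> (override_on c (x(v := a)) (insert v W)) p)
        (eval_hom \<kappa> (override_on c' y (insert v W)) p)" if "p \<in> P" for p
    proof -
      have "same_sign (eval_hom \<iota> ((override_on c x W)(v := a)) p) (eval_hom \<kappa> ((override_on c' y W)(v := y v)) p)"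
        using G(3)[OF that] a unfolding sim_on_def poly_as_poly[OF \<iota>] poly_as_poly[OF \<kappa>] by blast
      moreover have "override_on c (x(v := a)) (insert v W) = (override_on c x W)(v := a)"
        using insert.hyps by (auto simp: override_on_def fun_eq_iff)
      moreover have "override_on c' y (insert v W) = (override_on c' y W)(v := y v)"
        by (auto simp: override_on_def fun_eq_iff)
      ultimately show ?thesis by simp
    qed
    then show ?thesis by blast
  qed
  with E(1) show ?case by (intro exI[of _ E]) simp
qed

text \<open>Quantifier elimination without formulas: whether a system of sign conditions on
  \<open>P\<close> has a solution depends only on the signs of the finitely many parameters in
  \<open>E\<close>.\<close>

theorem quantifier_elimination:
  fixes P :: "('k::idom, 'n::{finite,linorder}) mpoly set"
  assumes ivp: "poly_ivp TYPE('b::linordered_field)" "poly_ivp TYPE('c::linordered_field)" and "finite P"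
  obtains E where "finite E"
    "\<And>(\<iota> :: 'k \<Rightarrow> 'b) (\<kappa> :: 'k \<Rightarrow> 'c) y. is_ring_hom \<iota> \<Longrightarrow> is_ring_hom \<kappa> \<Longrightarrow>
      (\<And>e. e \<in> E \<Longrightarrow> same_sign (\<iota> e) (\<kappa> e)) \<Longrightarrow>
      \<exists>x. \<forall>p\<in>P. same_sign (eval_hom \<iota> x p) (eval_hom \<kappa> y p)"
proof -
  from quantifier_elimination_aux[OF ivp finite[of UNIV] assms(3)] obtain E where "finite E \<and>
    (\<forall>(\<iota> :: 'k \<Rightarrow> 'b) (\<kappa> :: 'k \<Rightarrow> 'c) c c'. is_ring_hom \<iota> \<longrightarrow> is_ring_hom \<kappa> \<longrightarrow>
    (\<forall>e\<in>E. same_sign (eval_hom \<iota> c e) (eval_hom \<kappa> c' e)) \<longrightarrow>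
    (\<forall>y. \<exists>x. \<forall>p\<in>P. same_sign (eval_hom \<iota> (override_on c x UNIV) p) (eval_hom \<kappa> (override_on c' y UNIV) p)))" ..
  then have E: "finite E"
    "\<And>(\<iota> :: 'k \<Rightarrow> 'b) (\<kappa> :: 'k \<Rightarrow> 'c) c c' y. is_ring_hom \<iota> \<Longrightarrow> is_ring_hom \<kappa> \<Longrightarrow>
    (\<forall>e\<in>E. same_sign (eval_hom \<iota> c e) (eval_hom \<kappa> c' e)) \<Longrightarrow>
    (\<exists>x. \<forall>p\<in>P. same_sign (eval_hom \<iota> (override_on c x UNIV) p) (eval_hom \<kappa> (override_on c' y UNIV) p))"
    by simp_all
  have ov: "override_on c y UNIV = y" for c y :: "'n \<Rightarrow> 'e"
    by (auto simp: override_on_def)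
  show thesis
  proof (rule that)
    \<comment> \<open>With all variables eliminated the values outside \<open>W\<close> are
      irrelevant. Choosing them to be 0 reduces each condition to the sign of a constant
      term.\<close>
    show "finite ((\<lambda>e. Poly_Mapping.lookup e 0) ` E)" using E(1) by simp
    fix \<iota> :: "'k \<Rightarrow> 'b" and \<kappa> :: "'k \<Rightarrow> 'c" and y
    assume \<iota>: "is_ring_hom \<iota>" and \<kappa>: "is_ring_hom \<kappa>"
      and sgn: "\<And>e. e \<in> (\<lambda>e. Poly_Mapping.lookup e 0) ` E \<Longrightarrow> same_sign (\<iota> e) (\<kappa> e)"
    have "\<forall>e\<in>E. same_sign (eval_hom \<iota> (\<lambda>_. 0) e) (eval_hom \<kappa> (\<lambda>_. 0) e)"
      using sgn by (simp add: eval_hom_zero_fun[OF \<iota>] eval_hom_zero_fun[OF \<kappa>])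
    from E(2)[OF \<iota> \<kappa> this, of y] show "\<exists>x. \<forall>p\<in>P. same_sign (eval_hom \<iota> x p) (eval_hom \<kappa> y p)"
      by (simp only: ov)
  qed
qed

section \<open>Real closed fields have the intermediate value property\<close>

notation fps_nth (infixl \<open>$\<close> 75)

section \<open>Symmetric functions over a subfield\<close>

definition is_subfield :: "'a::field set \<Rightarrow> bool" where
  "is_subfield K \<longleftrightarrow> 1 \<in> K \<and> (\<forall>x\<in>K. \<forall>y\<in>K. x + y \<in> K \<and> x * y \<in> K) \<and> (\<forall>x\<in>K. - x \<in> K \<and> inverse x \<in> K)"

context
  fixes K :: "'a::field set"
  assumes K: "is_subfield K"
begin

lemma is_subfieldD:
  "1 \<in> K" "x \<in> K \<Longrightarrow> y \<in> K \<Longrightarrow> x + y \<in> K" "x \<in> K \<Longrightarrow> y \<in> K \<Longrightarrow> x * y \<in> K"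
  "x \<in> K \<Longrightarrow> - x \<in> K" "x \<in> K \<Longrightarrow> inverse x \<in> K"
  using K by (auto simp: is_subfield_def)

lemma is_subfield_diff: "x \<in> K \<Longrightarrow> y \<in> K \<Longrightarrow> x - y \<in> K"
  using is_subfieldD(2)[of x "- y"] is_subfieldD(4)[of y] by simp

lemma is_subfield_divide: "x \<in> K \<Longrightarrow> y \<in> K \<Longrightarrow> x / y \<in> K"
  using is_subfieldD(3)[of x "inverse y"] is_subfieldD(5)[of y] by (simp add: divide_inverse)

lemma is_subfield_zero: "0 \<in> K"
  using is_subfield_diff[OF is_subfieldD(1) is_subfieldD(1)] by simp

lemma is_subfield_sum: "(\<And>x. x \<in> A \<Longrightarrow> f x \<in> K) \<Longrightarrow> sum f A \<in> K"
  by (induction A rule: infinite_finite_induct) (auto simp: is_subfield_zero is_subfieldD)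

lemma is_subfield_of_nat: "of_nat n \<in> K"
  by (induction n) (auto simp: is_subfield_zero is_subfieldD)

end

text \<open>The logarithmic derivative of the product of the \<open>1 - \<alpha> i * X\<close> is
  minus the generating function of the power sums. Comparing coefficients gives Newton's
  identities.\<close>

lemma newton_fps:
  fixes \<alpha> :: "'i \<Rightarrow> 'a::field"
  assumes "finite I"
  shows "fps_deriv (\<Prod>i\<in>I. 1 - fps_const (\<alpha> i) * fps_X) =
    - ((\<Prod>i\<in>I. 1 - fps_const (\<alpha> i) * fps_X) * Abs_fps (\<lambda>k. \<Sum>i\<in>I. \<alpha> i ^ Suc k))"
  using assms
proof (induction I rule: finite_induct)
  case empty
  then show ?case by (simp add: fps_eq_iff)
next
  case (insert j I)
  define F where "F = (\<Prod>i\<in>I. 1 - fps_const (\<alpha> i) * fps_X)"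
  define S where "S = Abs_fps (\<lambda>k. \<Sum>i\<in>I. \<alpha> i ^ Suc k)"
  define g where "g = Abs_fps (\<lambda>k. \<alpha> j ^ Suc k)"
  define l where "l = 1 - fps_const (\<alpha> j) * fps_X"
  have geo: "l * g = fps_const (\<alpha> j)"
  proof (rule fps_ext)
    fix n
    have "l * g = g - fps_const (\<alpha> j) * (fps_X * g)"
      by (simp add: l_def algebra_simps)
    then show "(l * g) $ n = fps_const (\<alpha> j) $ n"
      by (cases n) (simp_all add: g_def)
  qed
  have "Abs_fps (\<lambda>k. \<Sum>i\<in>insert j I. \<alpha> i ^ Suc k) = g + S"
    using insert.hyps by (intro fps_ext) (simp add: g_def S_def)
  moreover have "fps_deriv l = - fps_const (\<alpha> j)"
    by (simp add: l_def)
  moreover have "fps_deriv F = - (F * S)"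
    using insert.IH by (simp add: F_def S_def)
  moreover have "(\<Prod>i\<in>insert j I. 1 - fps_const (\<alpha> i) * fps_X) = l * F"
    using insert.hyps by (simp add: F_def l_def)
  moreover have "l * (- (F * S)) + (- (l * g)) * F = - (l * F * (g + S))"
    by (simp add: algebra_simps)
  ultimately show ?case by (simp only: fps_deriv_mult geo)
qed

lemma newton_identity:
  fixes \<alpha> :: "'i \<Rightarrow> 'a::field"
  assumes "finite I"
  defines "F \<equiv> \<Prod>i\<in>I. 1 - fps_const (\<alpha> i) * fps_X"
  shows "of_nat (Suc n) * F $ Suc n = - (\<Sum>k=0..n. F $ k * (\<Sum>i\<in>I. \<alpha> i ^ Suc (n - k)))"
proof -
  have "fps_deriv F $ n = (- (F * Abs_fps (\<lambda>k. \<Sum>i\<in>I. \<alpha> i ^ Suc k))) $ n"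
    using newton_fps[OF assms(1), of \<alpha>] by (simp add: F_def)
  then show ?thesis by (simp add: fps_mult_nth)
qed

text \<open>Newton's identity is solved for the highest power sum, whose coefficient is the constant
  term 1 of the product.\<close>

lemma power_sums_in_subfield:
  fixes \<alpha> :: "'i \<Rightarrow> 'a::field"
  assumes K: "is_subfield K" and "finite I" and F: "\<And>n. (\<Prod>i\<in>I. 1 - fps_const (\<alpha> i) * fps_X) $ n \<in> K"
  shows "(\<Sum>i\<in>I. \<alpha> i ^ n) \<in> K"
proof (induction n rule: less_induct)
  case (less n)
  show ?case
  proof (cases n)
    case 0
    then show ?thesis using is_subfield_of_nat[OF K, of "card I"] by simp
  next
    case (Suc m)
    define F where "F = (\<Prod>i\<in>I. 1 - fps_const (\<alpha> i) * fps_X)"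
    have F0: "F $ 0 = 1" using assms(2) unfolding F_def by (induction I rule: finite_induct) auto
    have "of_nat (Suc m) * F $ Suc m = - (\<Sum>k=0..m. F $ k * (\<Sum>i\<in>I. \<alpha> i ^ Suc (m - k)))"
      using newton_identity[OF assms(2), of m \<alpha>] by (simp add: F_def)
    also have "(\<Sum>k=0..m. F $ k * (\<Sum>i\<in>I. \<alpha> i ^ Suc (m - k))) =
        (\<Sum>i\<in>I. \<alpha> i ^ n) + (\<Sum>k=Suc 0..m. F $ k * (\<Sum>i\<in>I. \<alpha> i ^ Suc (m - k)))"
      by (subst sum.atLeast_Suc_atMost) (simp_all add: F0 Suc)
    finally have *: "of_nat (Suc m) * F $ Suc m = - ((\<Sum>i\<in>I. \<alpha> i ^ n) +
        (\<Sum>k=Suc 0..m. F $ k * (\<Sum>i\<in>I. \<alpha> i ^ Suc (m - k))))" .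
    have "(\<Sum>i\<in>I. \<alpha> i ^ n) = - (of_nat (Suc m) * F $ Suc m) -
        (\<Sum>k=Suc 0..m. F $ k * (\<Sum>i\<in>I. \<alpha> i ^ Suc (m - k)))"
      unfolding * by (simp only: minus_minus add_diff_cancel_right')
    also have "\<dots> \<in> K"
    proof -
      have FK: "F $ k \<in> K" for k using F by (simp add: F_def)
      have "F $ k * (\<Sum>i\<in>I. \<alpha> i ^ Suc (m - k)) \<in> K" if "k \<in> {Suc 0..m}" for k
        using that Suc by (intro is_subfieldD[OF K] FK less.IH) auto
      then have "(\<Sum>k=Suc 0..m. F $ k * (\<Sum>i\<in>I. \<alpha> i ^ Suc (m - k))) \<in> K"
        by (rule is_subfield_sum[OF K])
      then show ?thesis
        by (intro is_subfield_diff[OF K] is_subfieldD(3,4)[OF K] is_subfield_of_nat[OF K] FK)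
    qed
    finally show ?thesis .
  qed
qed

text \<open>The same identity is solved for the coefficient of index \<open>Suc m\<close>, which
  requires dividing by \<open>Suc m\<close> and hence characteristic 0.\<close>

lemma elementary_in_subfield:
  fixes \<alpha> :: "'i \<Rightarrow> 'a::field_char_0"
  assumes K: "is_subfield K" and "finite I" and S: "\<And>n. (\<Sum>i\<in>I. \<alpha> i ^ n) \<in> K"
  shows "(\<Prod>i\<in>I. 1 - fps_const (\<alpha> i) * fps_X) $ n \<in> K"
proof (induction n rule: less_induct)
  case (less n)
  define F where "F = (\<Prod>i\<in>I. 1 - fps_const (\<alpha> i) * fps_X)"
  show ?case
  proof (cases n)
    case 0
    have "F $ 0 = 1" using assms(2) unfolding F_def by (induction I rule: finite_induct) auto
    then show ?thesis using 0 is_subfieldD(1)[OF K] by (simp add: F_def)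
  next
    case (Suc m)
    have "of_nat (Suc m) * F $ Suc m = - (\<Sum>k=0..m. F $ k * (\<Sum>i\<in>I. \<alpha> i ^ Suc (m - k)))"
      using newton_identity[OF assms(2), of m \<alpha>] by (simp add: F_def)
    then have "F $ n = (- (\<Sum>k=0..m. F $ k * (\<Sum>i\<in>I. \<alpha> i ^ Suc (m - k)))) / of_nat (Suc m)"
      by (simp add: Suc field_simps del: of_nat_Suc)
    also have "\<dots> \<in> K"
      by (intro is_subfield_divide[OF K] is_subfieldD[OF K] is_subfield_sum[OF K] is_subfield_of_nat[OF K] S)
        (use less.IH Suc in \<open>simp add: F_def\<close>)
    finally show ?thesis by (simp add: F_def)
  qed
qed

lemma fps_of_reflected_linear_product:
  fixes \<alpha> :: "'i \<Rightarrow> 'a::field"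
  assumes "finite I"
  shows "fps_of_poly (reflect_poly (\<Prod>i\<in>I. [:- \<alpha> i, 1:])) = (\<Prod>i\<in>I. 1 - fps_const (\<alpha> i) * fps_X)"
proof -
  have "reflect_poly [:- a, 1:] = [:1, - a:]" for a :: 'a
    by (rule poly_eqI) (auto simp: coeff_reflect_poly coeff_pCons split: nat.splits)
  then show ?thesis
    by (simp add: reflect_poly_prod fps_of_poly_prod fps_of_poly_linear' fps_const_neg[symmetric]
        del: fps_const_neg)
qed

lemma coeffs_in_subfield_iff_reflect:
  fixes p :: "'a::field poly"
  assumes K: "is_subfield K"
  shows "(\<forall>n. coeff (reflect_poly p) n \<in> K) \<longleftrightarrow> (\<forall>n. coeff p n \<in> K)"
proof
  assume *: "\<forall>n. coeff (reflect_poly p) n \<in> K"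
  show "\<forall>n. coeff p n \<in> K"
  proof
    fix n
    show "coeff p n \<in> K"
      using *[rule_format, of "degree p - n"] is_subfield_zero[OF K] coeff_eq_0[of p n]
      by (cases "n \<le> degree p") (auto simp: coeff_reflect_poly split: if_splits)
  qed
qed (auto simp: coeff_reflect_poly is_subfield_zero[OF K])

text \<open>This takes the place of the theorem on symmetric polynomials: to show that a polynomial
  with prescribed roots is defined over \<open>K\<close>, only power sums of the roots have to be
  computed.\<close>

lemma coeffs_in_subfield_iff_power_sums:
  fixes \<alpha> :: "'i \<Rightarrow> 'a::field_char_0"
  assumes K: "is_subfield K" and "finite I"
  shows "(\<forall>n. coeff (\<Prod>i\<in>I. [:- \<alpha> i, 1:]) n \<in> K) \<longleftrightarrow> (\<forall>n. (\<Sum>i\<in>I. \<alpha> i ^ n) \<in> K)"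
proof -
  have "(\<forall>n. coeff (\<Prod>i\<in>I. [:- \<alpha> i, 1:]) n \<in> K) \<longleftrightarrow>
      (\<forall>n. (\<Prod>i\<in>I. 1 - fps_const (\<alpha> i) * fps_X) $ n \<in> K)"
    using coeffs_in_subfield_iff_reflect[OF K, of "\<Prod>i\<in>I. [:- \<alpha> i, 1:]"]
    unfolding fps_of_reflected_linear_product[OF assms(2), symmetric] fps_of_poly_nth by simp
  also have "\<dots> \<longleftrightarrow> (\<forall>n. (\<Sum>i\<in>I. \<alpha> i ^ n) \<in> K)"
    using power_sums_in_subfield[OF assms, of \<alpha>] elementary_in_subfield[OF assms, of \<alpha>] by blast
  finally show ?thesis .
qed

lemma sum_square_decompose:
  fixes f :: "nat \<Rightarrow> nat \<Rightarrow> 'a::comm_semiring_1"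
  assumes "\<And>i j. f i j = f j i"
  shows "(\<Sum>i<d. \<Sum>j<d. f i j) = 2 * (\<Sum>(i, j)\<in>{(i, j). i < j \<and> j < d}. f i j) + (\<Sum>i<d. f i i)"
proof (induction d)
  case 0
  then show ?case by simp
next
  case (Suc d)
  have set: "{(i, j). i < j \<and> j < Suc d} = {(i, j). i < j \<and> j < d} \<union> (\<lambda>i. (i, d)) ` {..<d}"
    by auto
  have fin: "finite {(i, j). i < j \<and> j < d}"
    by (rule finite_subset[of _ "{..<d} \<times> {..<d}"]) auto
  have "(\<Sum>(i, j)\<in>{(i, j). i < j \<and> j < Suc d}. f i j) =
      (\<Sum>(i, j)\<in>{(i, j). i < j \<and> j < d}. f i j) + (\<Sum>(i, j)\<in>(\<lambda>i. (i, d)) ` {..<d}. f i j)"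
    unfolding set using fin by (intro sum.union_disjoint) auto
  also have "(\<Sum>(i, j)\<in>(\<lambda>i. (i, d)) ` {..<d}. f i j) = (\<Sum>i<d. f i d)"
    by (subst sum.reindex) (auto simp: inj_on_def)
  finally have 1: "(\<Sum>(i, j)\<in>{(i, j). i < j \<and> j < Suc d}. f i j) =
      (\<Sum>(i, j)\<in>{(i, j). i < j \<and> j < d}. f i j) + (\<Sum>i<d. f i d)" .
  have "(\<Sum>j<d. f d j) = (\<Sum>i<d. f i d)" using assms by simp
  then show ?case
    using Suc.IH by (simp add: 1 sum.distrib algebra_simps mult_2)
qed

section \<open>Adjoining a square root of minus one\<close>

lemma is_ring_hom_to_ac: "is_ring_hom (to_ac :: 'a::field \<Rightarrow> 'a alg_closure)"
  by (simp add: is_ring_hom_def)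

lemma is_subfield_range_to_ac: "is_subfield (range (to_ac :: 'a::field \<Rightarrow> 'a alg_closure))"
  unfolding is_subfield_def
  by (auto simp flip: to_ac_1 to_ac_add to_ac_mult to_ac_minus to_ac_inverse)

lemma real_closed_sqrt:
  fixes x :: "'a::linordered_field"
  assumes "real_closed TYPE('a)" "0 \<le> x"
  obtains y where "0 \<le> y" "y * y = x"
proof -
  obtain y where "x = y * y" using assms unfolding real_closed_def by blast
  then show thesis using that[of "\<bar>y\<bar>"] by simp
qed

text \<open>The half-angle formulas, with \<open>r\<close> the modulus of \<open>a + b i\<close>.
  They determine \<open>u\<close> and \<open>v\<close> up to sign, and the sign of \<open>v\<close>
  is then adapted to \<open>b\<close>.\<close>

lemma complex_sqrt:
  fixes a b :: "'a::linordered_field"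
  assumes rc: "real_closed TYPE('a)"
  obtains u v where "u * u - v * v = a" "2 * u * v = b"
proof -
  obtain r where r: "0 \<le> r" "r * r = a * a + b * b"
    by (rule real_closed_sqrt[OF rc sum_squares_ge_zero])
  have "\<bar>a\<bar> \<le> \<bar>r\<bar>"
    unfolding abs_le_square_iff using r by (simp add: power2_eq_square)
  then have "\<bar>a\<bar> \<le> r" using r by simp
  then have "0 \<le> (r + a) / 2" "0 \<le> (r - a) / 2" by (auto simp: abs_le_iff)
  note nonneg = this
  obtain u where u: "u * u = (r + a) / 2" by (rule real_closed_sqrt[OF rc nonneg(1)])
  obtain v where v: "v * v = (r - a) / 2" by (rule real_closed_sqrt[OF rc nonneg(2)])
  note uv = u v
  have "u * u - v * v = a" unfolding uv by (simp add: field_simps)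
  have "(2 * u * v) * (2 * u * v) = 4 * (u * u) * (v * v)" by (simp add: algebra_simps)
  also have "\<dots> = r * r - a * a" unfolding uv by (simp add: field_simps)
  also have "\<dots> = b * b" using r by simp
  finally have "2 * u * v = b \<or> 2 * u * v = - b" by (simp only: square_eq_iff)
  then show thesis
  proof
    assume "2 * u * v = b"
    with \<open>u * u - v * v = a\<close> that show thesis by blast
  next
    assume "2 * u * v = - b"
    then have "2 * u * (- v) = b" by simp
    moreover have "u * u - (- v) * (- v) = a" using \<open>u * u - v * v = a\<close> by simp
    ultimately show thesis using that by blast
  qed
qed

text \<open>For a square root \<open>i\<close> of \<open>- 1\<close> this is the quadratic extension
  \<open>R(i)\<close> inside the algebraic closure.\<close>

definition gaussian :: "'a::field alg_closure \<Rightarrow> 'a alg_closure set" where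
  "gaussian i = {to_ac a + to_ac b * i | a b. True}"

lemma gaussianI: "to_ac a + to_ac b * i \<in> gaussian i"
  unfolding gaussian_def by blast

lemma gaussian_closed:
  assumes i: "i * i = - 1" and "x \<in> gaussian i" "y \<in> gaussian i"
  shows "x + y \<in> gaussian i" "x * y \<in> gaussian i" "x - y \<in> gaussian i" "- x \<in> gaussian i"
    "to_ac c * x \<in> gaussian i"
proof -
  obtain a b c' d where xy: "x = to_ac a + to_ac b * i" "y = to_ac c' + to_ac d * i"
    using assms(2,3) unfolding gaussian_def by blast
  have "x + y = to_ac (a + c') + to_ac (b + d) * i" by (simp add: xy algebra_simps)
  then show "x + y \<in> gaussian i" by (simp only: gaussianI)
  have "x - y = to_ac (a - c') + to_ac (b - d) * i" by (simp add: xy algebra_simps)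
  then show "x - y \<in> gaussian i" by (simp only: gaussianI)
  have "- x = to_ac (- a) + to_ac (- b) * i" by (simp add: xy algebra_simps)
  then show "- x \<in> gaussian i" by (simp only: gaussianI)
  have "to_ac c * x = to_ac (c * a) + to_ac (c * b) * i" by (simp add: xy algebra_simps)
  then show "to_ac c * x \<in> gaussian i" by (simp only: gaussianI)
  have "x * y = to_ac a * to_ac c' + to_ac b * to_ac d * (i * i) + (to_ac a * to_ac d + to_ac b * to_ac c') * i"
    by (simp add: xy algebra_simps)
  also have "\<dots> = to_ac (a * c' - b * d) + to_ac (a * d + b * c') * i"
    by (simp add: i)
  finally show "x * y \<in> gaussian i" by (simp only: gaussianI)
qed

lemma gaussian_sqrt:
  fixes z :: "'a::linordered_field alg_closure"
  assumes rc: "real_closed TYPE('a)" and i: "i * i = - 1" and "z \<in> gaussian i"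
  obtains w where "w \<in> gaussian i" "w * w = z"
proof -
  obtain a b where z: "z = to_ac a + to_ac b * i" using assms(3) unfolding gaussian_def by blast
  obtain u v where uv: "u * u - v * v = a" "2 * u * v = b" by (rule complex_sqrt[OF rc])
  define w where "w = to_ac u + to_ac v * i"
  have "w * w = to_ac u * to_ac u + to_ac v * to_ac v * (i * i) + 2 * to_ac u * to_ac v * i"
    by (simp add: w_def algebra_simps)
  also have "\<dots> = to_ac (u * u - v * v) + to_ac (2 * u * v) * i"
    by (simp add: i)
  finally have "w * w = z" by (simp only: uv z)
  then show thesis using that[of w] gaussianI[of u v i] by (simp add: w_def)
qed

text \<open>Over all ordered pairs the sum expands into products of power sums of the
  \<open>\<alpha> i\<close>; subtracting the diagonal and halving leaves the pairs
  \<open>i < j\<close>. The additional exponents \<open>a\<close> and \<open>b\<close> let the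
  induction multiply out one factor at a time.\<close>

lemma pair_power_sums_in_subfield:
  fixes \<alpha> :: "nat \<Rightarrow> 'a::field_char_0"
  assumes K: "is_subfield K" and S: "\<And>n. (\<Sum>i<d. \<alpha> i ^ n) \<in> K" and t: "t \<in> K"
  shows "(\<Sum>(i, j)\<in>{(i, j). i < j \<and> j < d}. (\<alpha> i + \<alpha> j + t * \<alpha> i * \<alpha> j) ^ n) \<in> K"
proof -
  have 1: "(\<Sum>i<d. \<Sum>j<d. (\<alpha> i + \<alpha> j + t * \<alpha> i * \<alpha> j) ^ n * \<alpha> i ^ a * \<alpha> j ^ b) \<in> K" for a b
  proof (induction n arbitrary: a b)
    case 0
    have "(\<Sum>i<d. \<Sum>j<d. \<alpha> i ^ a * \<alpha> j ^ b) = (\<Sum>i<d. \<alpha> i ^ a) * (\<Sum>j<d. \<alpha> j ^ b)"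
      by (simp add: sum_product)
    then show ?case using is_subfieldD(3)[OF K S S] by simp
  next
    case (Suc n)
    have "(\<Sum>i<d. \<Sum>j<d. (\<alpha> i + \<alpha> j + t * \<alpha> i * \<alpha> j) ^ Suc n * \<alpha> i ^ a * \<alpha> j ^ b) =
      (\<Sum>i<d. \<Sum>j<d. (\<alpha> i + \<alpha> j + t * \<alpha> i * \<alpha> j) ^ n * \<alpha> i ^ Suc a * \<alpha> j ^ b) +
      (\<Sum>i<d. \<Sum>j<d. (\<alpha> i + \<alpha> j + t * \<alpha> i * \<alpha> j) ^ n * \<alpha> i ^ a * \<alpha> j ^ Suc b) +
      t * (\<Sum>i<d. \<Sum>j<d. (\<alpha> i + \<alpha> j + t * \<alpha> i * \<alpha> j) ^ n * \<alpha> i ^ Suc a * \<alpha> j ^ Suc b)"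
      unfolding sum_distrib_left sum.distrib[symmetric]
      by (intro sum.cong refl) (simp add: algebra_simps)
    then show ?case by (simp only:) (intro is_subfieldD[OF K] Suc.IH t)
  qed
  have 2: "(\<Sum>i<d. (\<alpha> i + \<alpha> i + t * \<alpha> i * \<alpha> i) ^ n * \<alpha> i ^ a) \<in> K" for a
  proof (induction n arbitrary: a)
    case 0
    then show ?case using S by simp
  next
    case (Suc n)
    have "(\<Sum>i<d. (\<alpha> i + \<alpha> i + t * \<alpha> i * \<alpha> i) ^ Suc n * \<alpha> i ^ a) =
      (\<Sum>i<d. (\<alpha> i + \<alpha> i + t * \<alpha> i * \<alpha> i) ^ n * \<alpha> i ^ Suc a) +
      (\<Sum>i<d. (\<alpha> i + \<alpha> i + t * \<alpha> i * \<alpha> i) ^ n * \<alpha> i ^ Suc a) +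
      t * (\<Sum>i<d. (\<alpha> i + \<alpha> i + t * \<alpha> i * \<alpha> i) ^ n * \<alpha> i ^ Suc (Suc a))"
      unfolding sum_distrib_left sum.distrib[symmetric]
      by (intro sum.cong refl) (simp add: algebra_simps)
    then show ?case by (simp only:) (intro is_subfieldD[OF K] Suc.IH t)
  qed
  have "2 * (\<Sum>(i, j)\<in>{(i, j). i < j \<and> j < d}. (\<alpha> i + \<alpha> j + t * \<alpha> i * \<alpha> j) ^ n) =
      (\<Sum>i<d. \<Sum>j<d. (\<alpha> i + \<alpha> j + t * \<alpha> i * \<alpha> j) ^ n) - (\<Sum>i<d. (\<alpha> i + \<alpha> i + t * \<alpha> i * \<alpha> i) ^ n)"
    by (subst sum_square_decompose) (simp_all add: algebra_simps)
  also have "\<dots> \<in> K" using 1[of 0 0] 2[of 0] is_subfield_diff[OF K] by simp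
  finally have "(2 * (\<Sum>(i, j)\<in>{(i, j). i < j \<and> j < d}. (\<alpha> i + \<alpha> j + t * \<alpha> i * \<alpha> j) ^ n)) / of_nat 2 \<in> K"
    by (rule is_subfield_divide[OF K _ is_subfield_of_nat[OF K]])
  then show ?thesis by simp
qed

no_notation fps_nth (infixl \<open>$\<close> 75)

text \<open>Laplace's argument: the polynomial with roots \<open>\<alpha>\<^sub>i + \<alpha>\<^sub>j + t \<alpha>\<^sub>i \<alpha>\<^sub>j\<close> (\<open>i < j\<close>) has a degree with one
  factor 2 less, and two values of \<open>t\<close> with the same pair \<open>(i, j)\<close> yield \<open>\<alpha>\<^sub>i + \<alpha>\<^sub>j\<close> and \<open>\<alpha>\<^sub>i \<alpha>\<^sub>j\<close>.\<close>

lemma real_closed_poly_has_gaussian_root: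
  fixes p :: "'a::linordered_field poly"
  assumes rc: "real_closed TYPE('a)" and i: "i * i = - 1" and "degree p = 2 ^ k * m" "odd m"
  shows "\<exists>z\<in>gaussian i. poly (map_poly to_ac p) z = 0"
  using assms(3,4)
proof (induction k arbitrary: p m)
  case 0
  then obtain x where x: "poly p x = 0"
    using rc unfolding real_closed_def by auto
  have "poly (map_poly to_ac p) (to_ac x) = 0"
    unfolding poly_map_poly_hom[OF is_ring_hom_to_ac] x by simp
  moreover have "to_ac x \<in> gaussian i" using gaussianI[of x 0 i] by simp
  ultimately show ?case by blast
next
  case (Suc k)
  let ?K = "range (to_ac :: 'a \<Rightarrow> 'a alg_closure)"
  note K = is_subfield_range_to_ac[where 'a = 'a]
  define d where "d = degree p"
  have d: "d = 2 * (2 ^ k * m)" "even d" "d > 0"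
    using Suc.prems by (auto simp: d_def odd_pos)
  have "p \<noteq> 0" using d d_def by auto
  define q where "q = map_poly to_ac p"
  have degq: "degree q = d"
    unfolding q_def d_def using \<open>p \<noteq> 0\<close> by (intro degree_map_poly_hom is_ring_hom_to_ac) simp
  then have "q \<noteq> 0" using d by auto
  then obtain A where A: "size A = d" "q = smult (lead_coeff q) (\<Prod>x\<in>#A. [:-x, 1:])"
    using alg_closed_imp_factorization[of q] degq by auto
  obtain xs where xs: "mset xs = A" using ex_mset by blast
  define \<alpha> where "\<alpha> = (\<lambda>i. xs ! i)"
  have len: "length xs = d" using A xs by (metis size_mset)
  have "(\<Prod>x\<in>#A. [:-x, 1:]) = prod_list (map (\<lambda>x. [:-x, 1:]) xs)"
    unfolding xs[symmetric] by (simp flip: mset_map prod_mset_prod_list)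
  also have "\<dots> = (\<Prod>i<d. [:- \<alpha> i, 1:])"
    by (subst prod.list_conv_set_nth) (simp add: len \<alpha>_def atLeast0LessThan)
  finally have fact: "q = smult (lead_coeff q) (\<Prod>i<d. [:- \<alpha> i, 1:])" using A by simp
  have coeffK: "coeff q n \<in> ?K" for n
    by (simp add: q_def coeff_map_poly_hom[OF is_ring_hom_to_ac])
  then have lc: "lead_coeff q \<in> ?K" "lead_coeff q \<noteq> 0"
    using \<open>q \<noteq> 0\<close> by simp_all
  have coeffs: "coeff (\<Prod>i<d. [:- \<alpha> i, 1:]) n \<in> ?K" for n
  proof -
    have "coeff q n = lead_coeff q * coeff (\<Prod>i<d. [:- \<alpha> i, 1:]) n"
      by (subst (1) fact) simp
    then have "coeff (\<Prod>i<d. [:- \<alpha> i, 1:]) n = coeff q n / lead_coeff q"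
      using lc(2) by (simp add: field_simps)
    also have "\<dots> \<in> ?K"
      by (rule is_subfield_divide[OF K coeffK lc(1)])
    finally show ?thesis .
  qed
  then have psums: "(\<Sum>i<d. \<alpha> i ^ n) \<in> ?K" for n
    using coeffs_in_subfield_iff_power_sums[OF K, of "{..<d}" \<alpha>] by blast
  define I where "I = {(i, j). i < j \<and> j < d}"
  have finI: "finite I"
    unfolding I_def by (rule finite_subset[of _ "{..<d} \<times> {..<d}"]) auto
  have "(\<Sum>i<d. \<Sum>j<d. (1::nat)) = 2 * (\<Sum>(i, j)\<in>I. 1) + (\<Sum>i<d. 1)"
    unfolding I_def by (rule sum_square_decompose) simp
  then have "d * d = 2 * card I + d"
    by (simp add: case_prod_unfold)
  then have "2 * card I = d * (d - 1)" by (simp add: algebra_simps)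
  then have cardI: "card I = 2 ^ k * (m * (d - 1))" using d(1) by simp
  have oddI: "odd (m * (d - 1))" using Suc.prems d by simp
  define \<beta> where "\<beta> = (\<lambda>(t::nat) (i, j). \<alpha> i + \<alpha> j + of_nat t * \<alpha> i * \<alpha> j)"
  have "\<exists>ij\<in>I. \<beta> t ij \<in> gaussian i" for t
  proof -
    define Q where "Q = (\<Prod>ij\<in>I. [:- \<beta> t ij, 1:])"
    have "(\<Sum>ij\<in>I. \<beta> t ij ^ n) \<in> ?K" for n
      using pair_power_sums_in_subfield[OF K psums is_subfield_of_nat[OF K], of t n]
      by (simp add: I_def \<beta>_def case_prod_unfold)
    then have QK: "coeff Q n \<in> ?K" for n
      using coeffs_in_subfield_iff_power_sums[OF K finI, of "\<beta> t"] unfolding Q_def by blast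
    \<comment> \<open>The coefficients of \<open>Q\<close> come from the base field, so
      \<open>Q\<close> descends to a polynomial to which the induction hypothesis applies.\<close>
    define r where "r = map_poly of_ac Q"
    have Q: "Q = map_poly to_ac r"
      by (rule poly_eqI)
        (simp add: r_def coeff_map_poly to_ac_of_ac[OF QK])
    have degQ: "degree Q = card I"
      unfolding Q_def by (subst degree_prod_eq_sum_degree) auto
    have "degree r = card I"
      unfolding degQ[symmetric] Q by (rule degree_map_poly[symmetric]) simp
    then obtain z where z: "z \<in> gaussian i" "poly Q z = 0"
      using Suc.IH[of r "m * (d - 1)"] cardI oddI Q by auto
    then obtain ij where "ij \<in> I" "z = \<beta> t ij"
      using finI by (auto simp: Q_def poly_prod prod_zero_iff)
    with z show ?thesis by blast
  qed
  then obtain f where f: "\<And>t. f t \<in> I" "\<And>t. \<beta> t (f t) \<in> gaussian i" by metis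
  have "\<not> inj f"
  proof
    assume "inj f"
    moreover have "range f \<subseteq> I" using f by auto
    ultimately have "finite (UNIV :: nat set)" using finI finite_imageD finite_subset by blast
    then show False by simp
  qed
  then obtain t t' where t: "t \<noteq> t'" "f t = f t'" by (auto simp: inj_def)
  obtain a b where ab: "f t = (a, b)" by (cases "f t")
  define S where "S = \<alpha> a + \<alpha> b"
  define R where "R = \<alpha> a * \<alpha> b"
  have g: "S + of_nat t * R \<in> gaussian i" "S + of_nat t' * R \<in> gaussian i"
    using f(2)[of t, unfolded ab \<beta>_def] f(2)[of t', folded t(2), unfolded ab \<beta>_def]
    by (simp_all add: S_def R_def mult.assoc)
  note diff_g = gaussian_closed(3)[OF i g]
  have "to_ac (inverse (of_nat t - of_nat t')) * ((S + of_nat t * R) - (S + of_nat t' * R)) \<in> gaussian i"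
    by (rule gaussian_closed(5)[OF i diff_g diff_g])
  moreover have "to_ac (inverse (of_nat t - of_nat t')) * ((S + of_nat t * R) - (S + of_nat t' * R)) = R"
  proof -
    have "(of_nat t - of_nat t' :: 'a alg_closure) \<noteq> 0" using t(1) by simp
    then show ?thesis by (simp add: field_simps)
  qed
  ultimately have R: "R \<in> gaussian i" by simp
  have "(S + of_nat t * R) - to_ac (of_nat t) * R \<in> gaussian i"
    by (rule gaussian_closed(3)[OF i g(1) gaussian_closed(5)[OF i R R]])
  then have S: "S \<in> gaussian i" by simp
  \<comment> \<open>This is the discriminant of the quadratic with roots \<open>\<alpha> a\<close>
    and \<open>\<alpha> b\<close>.\<close>
  have "S * S - to_ac 4 * R \<in> gaussian i"
    by (rule gaussian_closed(3)[OF i gaussian_closed(2)[OF i S S] gaussian_closed(5)[OF i R R]])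
  then obtain w where w: "w \<in> gaussian i" "w * w = S * S - to_ac 4 * R"
    by (rule gaussian_sqrt[OF rc i])
  have "w * w = (\<alpha> a - \<alpha> b) * (\<alpha> a - \<alpha> b)"
    unfolding w(2) by (simp add: S_def R_def algebra_simps)
  then have "\<alpha> a - \<alpha> b = w \<or> \<alpha> a - \<alpha> b = - w"
    by (metis square_eq_iff)
  then have "\<alpha> a - \<alpha> b \<in> gaussian i" using w(1) gaussian_closed(4)[OF i w(1) w(1)] by auto
  note sum_g = gaussian_closed(1)[OF i S this]
  have "to_ac (1/2) * (S + (\<alpha> a - \<alpha> b)) \<in> gaussian i"
    by (rule gaussian_closed(5)[OF i sum_g sum_g])
  moreover have "to_ac (1/2) * (S + (\<alpha> a - \<alpha> b)) = \<alpha> a" by (simp add: S_def field_simps)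
  ultimately have "\<alpha> a \<in> gaussian i" by (simp only:)
  moreover have "poly q (\<alpha> a) = 0"
  proof -
    have "a < d" using f(1)[of t] ab by (auto simp: I_def)
    then have "poly (\<Prod>i<d. [:- \<alpha> i, 1:]) (\<alpha> a) = 0"
      by (auto simp: poly_prod intro!: prod_zero)
    then show ?thesis by (subst fact) simp
  qed
  ultimately show ?case unfolding q_def by blast
qed

lemma power_two_times_odd:
  assumes "0 < (n::nat)"
  obtains k m where "n = 2 ^ k * m" "odd m"
proof -
  have "\<exists>k m. n = 2 ^ k * m \<and> odd m" using assms
  proof (induction n rule: less_induct)
    case (less n)
    show ?case
    proof (cases "even n")
      case True
      then obtain n' where n': "n = 2 * n'" by blast
      have "n' < n" "0 < n'" using n' less.prems by auto
      then obtain k m where "n' = 2 ^ k * m" "odd m" using less.IH[of n'] by blast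
      then have "n = 2 ^ Suc k * m \<and> odd m" using n' by simp
      then show ?thesis by blast
    next
      case False
      then have "n = 2 ^ 0 * n \<and> odd n" by simp
      then show ?thesis by blast
    qed
  qed
  then show thesis using that by blast
qed

text \<open>Take a root \<open>u + v i\<close> of \<open>p\<close>. If \<open>v = 0\<close> the root
  is already in the field. Otherwise the quadratic with value
  \<open>(x - u) * (x - u) + v * v\<close> divides \<open>p\<close> and is positive everywhere, so
  the cofactor inherits the sign change.\<close>

theorem real_closed_imp_poly_ivp:
  assumes rc: "real_closed TYPE('a::linordered_field)"
  shows "poly_ivp TYPE('a)"
proof (rule poly_ivpI)
  fix p :: "'a poly" and a b
  assume "poly p a * poly p b < 0"
  then show "\<exists>x. poly p x = 0"
  proof (induction "degree p" arbitrary: p rule: less_induct)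
    case less
    have "degree p > 0"
    proof (rule ccontr)
      assume "\<not> ?thesis"
      then obtain c where "p = [:c:]" using degree_eq_zeroE by blast
      then show False using less.prems by (simp add: mult_less_0_iff)
    qed
    then obtain k m where km: "degree p = 2 ^ k * m" "odd m" by (rule power_two_times_odd)
    obtain i :: "'a alg_closure" where "poly [:1, 0, 1:] i = 0"
      using alg_closed_imp_poly_has_root[of "[:1, 0, 1:]"] by auto
    then have i: "i * i = - 1" by (simp add: add_eq_0_iff)
    \<comment> \<open>Otherwise \<open>i\<close> would come from the field, where \<open>- 1\<close>
      would then be a square.\<close>
    have indep: "x = 0 \<and> y = 0" if "to_ac x + to_ac y * i = 0" for x y :: 'a
    proof -
      have "y = 0"
      proof (rule ccontr)
        assume "y \<noteq> 0"
        then have "i = to_ac (- x / y)" using that by (simp add: field_simps add_eq_0_iff)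
        then have "to_ac ((- x / y) * (- x / y)) = to_ac (- 1)"
          using i by (simp only: to_ac_mult to_ac_minus to_ac_1)
        then have "(- x / y) * (- x / y) = - 1" by (simp only: to_ac_eq_iff)
        moreover have "0 \<le> (- x / y) * (- x / y)" by (rule zero_le_square)
        ultimately show False by simp
      qed
      then show ?thesis using that by simp
    qed
    obtain z where z: "z \<in> gaussian i" "poly (map_poly to_ac p) z = 0"
      using real_closed_poly_has_gaussian_root[OF rc i km] by blast
    obtain u v where uv: "z = to_ac u + to_ac v * i" using z(1) unfolding gaussian_def by blast
    show ?case
    proof (cases "v = 0")
      case True
      then have "to_ac (poly p u) = 0"
        using z(2) uv by (simp add: poly_map_poly_hom[OF is_ring_hom_to_ac])
      then show ?thesis by auto
    next
      case False
      define q where "q = [:u * u + v * v, - (2 * u), 1:]"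
      have qz: "poly (map_poly to_ac q) z = 0"
      proof -
        have "poly (map_poly to_ac q) z = to_ac u * to_ac u + to_ac v * to_ac v - 2 * to_ac u * z + z * z"
          by (simp add: q_def map_poly_pCons algebra_simps)
        also have "\<dots> = to_ac v * to_ac v + to_ac v * to_ac v * (i * i)"
          unfolding uv by (simp add: algebra_simps)
        finally show ?thesis by (simp add: i)
      qed
      have "q \<noteq> 0" by (simp add: q_def)
      have "degree (p mod q) < 2"
        using degree_mod_less[OF \<open>q \<noteq> 0\<close>, of p] by (auto simp: q_def)
      then have "p mod q = [:coeff (p mod q) 0, coeff (p mod q) 1:]"
        by (intro poly_eqI) (auto simp: coeff_pCons coeff_eq_0 split: nat.splits)
      then obtain c0 c1 where c: "p mod q = [:c0, c1:]" by blast
      have p: "p = q * (p div q) + [:c0, c1:]" using c by (metis mult_div_mod_eq)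
      have "poly (map_poly to_ac p) z = to_ac c0 + z * to_ac c1"
        by (subst p) (simp add: map_poly_hom_add[OF is_ring_hom_to_ac] map_poly_hom_mult[OF is_ring_hom_to_ac]
            qz map_poly_pCons)
      \<comment> \<open>The remainder modulo \<open>q\<close> is linear and vanishes at the nonreal
        \<open>z\<close>; comparing the real and imaginary parts shows that it is zero.\<close>
      then have "to_ac (c0 + u * c1) + to_ac (v * c1) * i = 0"
        using z(2) uv by (simp add: algebra_simps)
      from indep[OF this] have "c1 = 0" "c0 = 0" using False by auto
      then have p': "p = q * (p div q)" using p by simp
      have pe: "poly p x = poly q x * poly (p div q) x" for x
        using arg_cong[OF p', of "\<lambda>r. poly r x"] by (simp only: poly_mult)
      have qpos: "poly q x > 0" for x
      proof -
        have "poly q x = (x - u) * (x - u) + v * v" by (simp add: q_def algebra_simps)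
        moreover have "v * v > 0" using False by (metis mult_neg_neg mult_pos_pos linorder_neqE_linordered_idom)
        ultimately show ?thesis by (simp add: add_nonneg_pos)
      qed
      have "poly p a * poly p b = (poly q a * poly q b) * (poly (p div q) a * poly (p div q) b)"
        unfolding pe by (simp only: mult_ac)
      moreover have "poly q a * poly q b > 0" using qpos by simp
      ultimately have neg: "poly (p div q) a * poly (p div q) b < 0"
        using less.prems by (metis mult_less_cancel_left_pos mult_zero_right)
      have "p div q \<noteq> 0" using neg by auto
      have "degree p = degree q + degree (p div q)"
        using degree_mult_eq[OF \<open>q \<noteq> 0\<close> \<open>p div q \<noteq> 0\<close>] p' by simp
      then have "degree (p div q) < degree p" by (simp add: q_def)
      from less.hyps[OF this neg] obtain x where "poly (p div q) x = 0" ..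
      then have "poly p x = 0" by (simp add: pe)
      then show ?thesis ..
    qed
  qed
qed

section \<open>Generic values of rational functions\<close>

lemma is_ring_hom_id: "is_ring_hom (\<lambda>c. c)"
  by (simp add: is_ring_hom_def)

lemma is_ring_hom_eval_mpoly: "is_ring_hom (\<lambda>p. eval_mpoly p x)"
  unfolding eval_mpoly_eq_eval_hom by (rule is_ring_hom_eval_hom[OF is_ring_hom_id])

lemmas eval_mpoly_simps = is_ring_homD[OF is_ring_hom_eval_mpoly]

lemma eval_mpoly_single_0: "eval_mpoly (Poly_Mapping.single 0 c) x = (c::'a::comm_ring_1)"
  unfolding eval_mpoly_eq_eval_hom eval_hom_single[OF is_ring_hom_id] by simp

lemma lookup_coeff_as_poly:
  "Poly_Mapping.lookup (coeff (as_poly v p) k) e' =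
    (\<Sum>e\<in>Poly_Mapping.keys p. if Poly_Mapping.lookup e v = k \<and> Poly_Mapping.update v 0 e = e'
      then Poly_Mapping.lookup p e else 0)"
  unfolding as_poly_def coeff_sum lookup_sum
  by (rule sum.cong) (auto simp: lookup_single when_def)

text \<open>\<open>W\<close> contains the variables that occur. Some coefficient of \<open>p\<close>
  as a polynomial in \<open>v\<close> is nonzero and can be made nonvanishing by induction; only
  finitely many values of \<open>v\<close> are then excluded.\<close>

lemma nonzero_mpoly_nonvanishing_aux:
  fixes p :: "('a::field, 'n::finite) mpoly"
  assumes S: "\<And>i. infinite (S i)" and "finite W" and "p \<noteq> 0"
    and "\<And>e i. e \<in> Poly_Mapping.keys p \<Longrightarrow> i \<notin> W \<Longrightarrow> Poly_Mapping.lookup e i = 0"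
  shows "\<exists>x. (\<forall>i. x i \<in> S i) \<and> eval_hom (\<lambda>c. c) x p \<noteq> 0"
  using assms(2-4)
proof (induction W arbitrary: p rule: finite_induct)
  case empty
  have "e = 0" if "e \<in> Poly_Mapping.keys p" for e
    using empty(2)[OF that] by (simp add: poly_mapping_eqI)
  moreover have "Poly_Mapping.keys p \<noteq> {}" using \<open>p \<noteq> 0\<close> by simp
  ultimately have keys: "Poly_Mapping.keys p = {0}" by blast
  have "\<forall>i. \<exists>s. s \<in> S i" using S by (metis equals0I finite.emptyI)
  then obtain x where "\<forall>i. x i \<in> S i" by metis
  moreover have "eval_hom (\<lambda>c. c) x p = Poly_Mapping.lookup p 0"
    by (simp add: eval_hom_def keys)
  moreover have "Poly_Mapping.lookup p 0 \<noteq> 0" using keys by (simp flip: in_keys_iff)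
  ultimately show ?case by auto
next
  case (insert v W)
  obtain e0 where e0: "e0 \<in> Poly_Mapping.keys p" using insert.prems(1) by (meson ex_in_conv keys_eq_empty)
  define k where "k = Poly_Mapping.lookup e0 v"
  define c where "c = coeff (as_poly v p) k"
  have upd: "e = e0" if "Poly_Mapping.lookup e v = k" "Poly_Mapping.update v 0 e = Poly_Mapping.update v 0 e0" for e
  proof (rule poly_mapping_eqI)
    fix i
    have "Poly_Mapping.lookup (Poly_Mapping.update v 0 e) i = Poly_Mapping.lookup (Poly_Mapping.update v 0 e0) i"
      using that(2) by simp
    then show "Poly_Mapping.lookup e i = Poly_Mapping.lookup e0 i"
      using that(1) by (cases "i = v") (auto simp: lookup_update k_def)
  qed
  have "Poly_Mapping.lookup c (Poly_Mapping.update v 0 e0) =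
      (\<Sum>e\<in>Poly_Mapping.keys p. if e = e0 then Poly_Mapping.lookup p e0 else 0)"
    unfolding c_def lookup_coeff_as_poly
    using upd by (intro sum.cong) (auto simp: k_def)
  also have "\<dots> = Poly_Mapping.lookup p e0" using e0 by simp
  finally have "c \<noteq> 0" using e0 by (auto simp: in_keys_iff)
  moreover have "Poly_Mapping.lookup e' i = 0" if e': "e' \<in> Poly_Mapping.keys c" and i: "i \<notin> W" for e' i
  proof (rule ccontr)
    assume nz: "Poly_Mapping.lookup e' i \<noteq> 0"
    have "Poly_Mapping.lookup c e' = 0"
      unfolding c_def lookup_coeff_as_poly
    proof (rule sum.neutral, safe)
      fix e assume e: "e \<in> Poly_Mapping.keys p"
      have "Poly_Mapping.update v 0 e \<noteq> e'"
      proof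
        assume "Poly_Mapping.update v 0 e = e'"
        then have "Poly_Mapping.lookup e' i = (if i = v then 0 else Poly_Mapping.lookup e i)"
          by (auto simp: lookup_update)
        then show False using nz i insert.prems(2)[OF e, of i] by (auto split: if_splits)
      qed
      then show "(if Poly_Mapping.lookup e v = k \<and> Poly_Mapping.update v 0 e = e'
          then Poly_Mapping.lookup p e else 0) = 0" by simp
    qed
    then show False using e' by (simp add: in_keys_iff)
  qed
  ultimately obtain x where x: "\<forall>i. x i \<in> S i" "eval_hom (\<lambda>c. c) x c \<noteq> 0"
    using insert.IH[of c] by blast
  define P where "P = map_poly (eval_hom (\<lambda>c. c) x) (as_poly v p)"
  have "coeff P k \<noteq> 0"
    using x(2) by (simp add: P_def c_def coeff_map_poly_hom[OF is_ring_hom_eval_hom[OF is_ring_hom_id]])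
  then have "P \<noteq> 0" by auto
  then have "finite {a. poly P a = 0}" by (rule poly_roots_finite)
  then have "\<not> S v \<subseteq> {a. poly P a = 0}" using S[of v] finite_subset by blast
  then obtain a where a: "a \<in> S v" "poly P a \<noteq> 0" by blast
  then have "eval_hom (\<lambda>c. c) (x(v := a)) p \<noteq> 0"
    unfolding P_def poly_as_poly[OF is_ring_hom_id] by simp
  moreover have "\<forall>i. (x(v := a)) i \<in> S i" using x a by simp
  ultimately show ?case by blast
qed

lemma nonzero_mpoly_nonvanishing:
  fixes p :: "('a::field, 'n::finite) mpoly"
  assumes "\<And>i. infinite (S i)" "p \<noteq> 0"
  obtains x where "\<And>i. x $ i \<in> S i" "eval_mpoly p x \<noteq> 0"
proof -
  obtain x where "\<forall>i. x i \<in> S i" "eval_hom (\<lambda>c. c) x p \<noteq> 0"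
    using nonzero_mpoly_nonvanishing_aux[of S UNIV p, OF assms(1) finite assms(2)] by auto
  moreover have "($) (vec_lambda x) = x" by (simp add: fun_eq_iff)
  ultimately show thesis using that[of "vec_lambda x"] by (simp add: eval_mpoly_eq_eval_hom)
qed

text \<open>Truth off a proper hypersurface. Such conditions can be combined and are met in every
  box (\<open>generically_box\<close>), so the domains of definition of rational functions need no
  further attention.\<close>

definition generically :: "(('a::field, 'n::{finite,linorder}) vec \<Rightarrow> bool) \<Rightarrow> bool" where
  "generically P \<longleftrightarrow> (\<exists>q. q \<noteq> 0 \<and> (\<forall>x. eval_mpoly q x \<noteq> 0 \<longrightarrow> P x))"

lemma generically_conj:
  assumes "generically P" "generically Q"
  shows "generically (\<lambda>x. P x \<and> Q x)"
proof -
  obtain p q where "p \<noteq> 0" "\<forall>x. eval_mpoly p x \<noteq> 0 \<longrightarrow> P x" "q \<noteq> 0" "\<forall>x. eval_mpoly q x \<noteq> 0 \<longrightarrow> Q x"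
    using assms unfolding generically_def by blast
  then show ?thesis
    unfolding generically_def by (intro exI[of _ "p * q"]) (simp add: eval_mpoly_simps)
qed

lemma generically_mono: "generically P \<Longrightarrow> (\<And>x. P x \<Longrightarrow> Q x) \<Longrightarrow> generically Q"
  unfolding generically_def by blast

lemma generically_True: "(\<And>x. P x) \<Longrightarrow> generically P"
  unfolding generically_def by (intro exI[of _ 1]) simp

lemma generically_nonzero: "q \<noteq> 0 \<Longrightarrow> generically (\<lambda>x. eval_mpoly q x \<noteq> 0)"
  unfolding generically_def by blast

lemma generically_ball:
  "finite A \<Longrightarrow> (\<And>a. a \<in> A \<Longrightarrow> generically (P a)) \<Longrightarrow> generically (\<lambda>x. \<forall>a\<in>A. P a x)"
  by (induction A rule: finite_induct) (auto intro: generically_True generically_conj)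

lemma generically_box:
  fixes P :: "('a::linordered_field, 'n::{finite,linorder}) vec \<Rightarrow> bool"
  assumes "generically P" "0 < \<epsilon>"
  obtains x where "\<And>i. \<bar>x $ i - b $ i\<bar> < \<epsilon>" "P x"
proof -
  obtain q where q: "q \<noteq> 0" "\<forall>x. eval_mpoly q x \<noteq> 0 \<longrightarrow> P x"
    using assms(1) unfolding generically_def by blast
  have "infinite {b $ i - \<epsilon> <..< b $ i + \<epsilon>}" for i
    using assms(2) by (intro infinite_Ioo) simp
  then obtain x where x: "\<And>i. x $ i \<in> {b $ i - \<epsilon> <..< b $ i + \<epsilon>}" "eval_mpoly q x \<noteq> 0"
    using nonzero_mpoly_nonvanishing[of "\<lambda>i. {b $ i - \<epsilon> <..< b $ i + \<epsilon>}" q] q(1) by blast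
  have "\<bar>x $ i - b $ i\<bar> < \<epsilon>" for i
    using x(1)[of i] by (auto simp: abs_less_iff algebra_simps)
  then show thesis using that x(2) q(2) by blast
qed

section \<open>Arithmetic of values\<close>

lemma ratfun_has_valueI:
  "eval_mpoly q x \<noteq> 0 \<Longrightarrow> ratfun_has_value (Fract p q) x (eval_mpoly p x / eval_mpoly q x)"
  unfolding ratfun_has_value_def by blast

lemma ratfun_has_value_unique:
  assumes "ratfun_has_value f x y" "ratfun_has_value f x z"
  shows "y = z"
proof -
  obtain p q p' q' where pq: "f = Fract p q" "eval_mpoly q x \<noteq> 0" "y = eval_mpoly p x / eval_mpoly q x"
    and pq': "f = Fract p' q'" "eval_mpoly q' x \<noteq> 0" "z = eval_mpoly p' x / eval_mpoly q' x"
    using assms unfolding ratfun_has_value_def by blast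
  have "q \<noteq> 0" "q' \<noteq> 0" using pq pq' by (auto simp: eval_mpoly_simps)
  then have "p * q' = p' * q" using pq(1) pq'(1) by (simp add: eq_fract)
  then have "eval_mpoly p x * eval_mpoly q' x = eval_mpoly p' x * eval_mpoly q x"
    by (metis eval_mpoly_simps(3))
  then show ?thesis
    unfolding pq(3) pq'(3) using pq(2) pq'(2) by (simp add: frac_eq_eq)
qed

lemma ratfun_has_value_add:
  assumes "ratfun_has_value f x y" "ratfun_has_value g x z"
  shows "ratfun_has_value (f + g) x (y + z)"
proof -
  obtain p q p' q' where pq: "f = Fract p q" "eval_mpoly q x \<noteq> 0" "y = eval_mpoly p x / eval_mpoly q x"
    and pq': "g = Fract p' q'" "eval_mpoly q' x \<noteq> 0" "z = eval_mpoly p' x / eval_mpoly q' x"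
    using assms unfolding ratfun_has_value_def by blast
  have "q \<noteq> 0" "q' \<noteq> 0" using pq pq' by (auto simp: eval_mpoly_simps)
  then have "f + g = Fract (p * q' + p' * q) (q * q')" using pq pq' by simp
  moreover have "y + z = eval_mpoly (p * q' + p' * q) x / eval_mpoly (q * q') x"
    using pq pq' by (simp add: eval_mpoly_simps field_simps)
  moreover have "eval_mpoly (q * q') x \<noteq> 0" using pq pq' by (simp add: eval_mpoly_simps)
  ultimately show ?thesis unfolding ratfun_has_value_def by blast
qed

lemma ratfun_has_value_mult:
  assumes "ratfun_has_value f x y" "ratfun_has_value g x z"
  shows "ratfun_has_value (f * g) x (y * z)"
proof -
  obtain p q p' q' where pq: "f = Fract p q" "eval_mpoly q x \<noteq> 0" "y = eval_mpoly p x / eval_mpoly q x"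
    and pq': "g = Fract p' q'" "eval_mpoly q' x \<noteq> 0" "z = eval_mpoly p' x / eval_mpoly q' x"
    using assms unfolding ratfun_has_value_def by blast
  have "f * g = Fract (p * p') (q * q')" using pq pq' by simp
  moreover have "y * z = eval_mpoly (p * p') x / eval_mpoly (q * q') x"
    using pq pq' by (simp add: eval_mpoly_simps)
  moreover have "eval_mpoly (q * q') x \<noteq> 0" using pq pq' by (simp add: eval_mpoly_simps)
  ultimately show ?thesis unfolding ratfun_has_value_def by blast
qed

lemma ratfun_has_value_to_fract: "ratfun_has_value (to_fract p) x (eval_mpoly p x)"
  unfolding ratfun_has_value_def
  by (intro exI[of _ p] exI[of _ 1]) (simp add: to_fract_def eval_mpoly_simps)

lemma ratfun_has_value_const: "ratfun_has_value (ratfun_const c) x c"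
  using ratfun_has_value_to_fract[of "Poly_Mapping.single 0 c" x]
  by (simp add: ratfun_const_def eval_mpoly_single_0)

lemma is_ring_hom_ratfun_const: "is_ring_hom (ratfun_const :: 'a::field \<Rightarrow> ('a, 'n::linorder) ratfun)"
  by (simp add: is_ring_hom_def ratfun_const_def single_add mult_single[of 0 _ 0, simplified, symmetric])

lemmas ratfun_const_simps = is_ring_homD[OF is_ring_hom_ratfun_const]

lemma ratfun_has_value_1: "ratfun_has_value 1 x 1"
  using ratfun_has_value_const[of 1 x] by (simp add: ratfun_const_simps)

lemma ratfun_has_value_uminus:
  assumes "ratfun_has_value f x y"
  shows "ratfun_has_value (- f) x (- y)"
  using ratfun_has_value_mult[OF ratfun_has_value_const[of "- 1"] assms] by (simp add: ratfun_const_simps)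

lemma ratfun_has_value_diff:
  "ratfun_has_value f x y \<Longrightarrow> ratfun_has_value g x z \<Longrightarrow> ratfun_has_value (f - g) x (y - z)"
  using ratfun_has_value_add[OF _ ratfun_has_value_uminus, of f x y g z] by simp

lemma ratfun_has_value_power: "ratfun_has_value f x y \<Longrightarrow> ratfun_has_value (f ^ n) x (y ^ n)"
  by (induction n) (auto intro: ratfun_has_value_1 ratfun_has_value_mult)

lemma ratfun_has_value_inverse:
  assumes "ratfun_has_value f x y" "y \<noteq> 0"
  shows "ratfun_has_value (inverse f) x (inverse y)"
proof -
  obtain p q where pq: "f = Fract p q" "eval_mpoly q x \<noteq> 0" "y = eval_mpoly p x / eval_mpoly q x"
    using assms unfolding ratfun_has_value_def by blast
  then have "inverse f = Fract q p" "eval_mpoly p x \<noteq> 0" "inverse y = eval_mpoly q x / eval_mpoly p x"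
    using assms(2) by auto
  then show ?thesis unfolding ratfun_has_value_def by blast
qed

lemma ratfun_has_value_divide:
  "ratfun_has_value f x y \<Longrightarrow> ratfun_has_value g x z \<Longrightarrow> z \<noteq> 0 \<Longrightarrow> ratfun_has_value (f / g) x (y / z)"
  unfolding divide_inverse by (intro ratfun_has_value_mult ratfun_has_value_inverse)

lemma generically_has_value: "generically (\<lambda>x. \<exists>y. ratfun_has_value f x y)"
proof (cases f rule: Fract_cases_nonzero)
  case (Fract a b)
  then show ?thesis
    by (intro generically_mono[OF generically_nonzero[of b]]) (auto intro: ratfun_has_valueI)
next
  case 0
  then show ?thesis
    using ratfun_has_value_const[of 0] by (intro generically_True) (auto simp: ratfun_const_simps)
qed

section \<open>Positive cones of rational functions\<close>

lemma is_positive_cone_Cone: "is_positive_cone (Cone ps)"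
  unfolding Cone_def hull_def is_positive_cone_def by blast

lemma Cone_superset: "p \<in> set ps \<Longrightarrow> to_fract p \<in> Cone ps"
  unfolding Cone_def by (rule hull_inc) simp

lemma Cone_minimal: "is_positive_cone C \<Longrightarrow> to_fract ` set ps \<subseteq> C \<Longrightarrow> Cone ps \<subseteq> C"
  unfolding Cone_def by (rule hull_minimal)

lemma is_positive_coneD:
  assumes "is_positive_cone C"
  shows "x * x \<in> C" "x \<in> C \<Longrightarrow> y \<in> C \<Longrightarrow> x + y \<in> C" "x \<in> C \<Longrightarrow> y \<in> C \<Longrightarrow> x * y \<in> C" "0 \<in> C" "1 \<in> C"
    "x ^ 2 \<in> C" "x \<in> C \<Longrightarrow> inverse x \<in> C"
proof -
  show sq: "x * x \<in> C" and "x \<in> C \<Longrightarrow> y \<in> C \<Longrightarrow> x + y \<in> C" and mult: "x \<in> C \<Longrightarrow> y \<in> C \<Longrightarrow> x * y \<in> C" for x y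
    using assms unfolding is_positive_cone_def by blast+
  show "0 \<in> C" "1 \<in> C" "x ^ 2 \<in> C" using sq[of 0] sq[of 1] sq[of x] by (simp_all add: power2_eq_square)
  show "inverse x \<in> C" if "x \<in> C"
    using mult[OF that sq[of "inverse x"]] that by (cases "x = 0") (simp_all flip: mult.assoc)
qed

text \<open>The functions with this property form a positive cone containing \<open>ps\<close>. Only
  generic values are considered because the squares in the cone may have poles.\<close>

lemma Cone_generically_nonneg:
  fixes f :: "('a::linordered_field, 'n::{finite,linorder}) ratfun"
  assumes "f \<in> Cone ps"
  shows "generically (\<lambda>x. (\<forall>p\<in>set ps. eval_mpoly p x > 0) \<longrightarrow> (\<exists>y\<ge>0. ratfun_has_value f x y))"
proof -
  define C where "C = {f :: ('a, 'n) ratfun. generically (\<lambda>x. (\<forall>p\<in>set ps. eval_mpoly p x > 0) \<longrightarrow>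
      (\<exists>y\<ge>0. ratfun_has_value f x y))}"
  have "f * f \<in> C" for f
    unfolding C_def
    by (rule CollectI, rule generically_mono[OF generically_has_value[of f]])
      (metis ratfun_has_value_mult zero_le_square)
  moreover have "f + g \<in> C" "f * g \<in> C" if "f \<in> C" "g \<in> C" for f g
  proof -
    have *: "generically (\<lambda>x. ((\<forall>p\<in>set ps. eval_mpoly p x > 0) \<longrightarrow> (\<exists>y\<ge>0. ratfun_has_value f x y)) \<and>
        ((\<forall>p\<in>set ps. eval_mpoly p x > 0) \<longrightarrow> (\<exists>y\<ge>0. ratfun_has_value g x y)))"
      using that by (auto simp: C_def intro: generically_conj)
    show "f + g \<in> C"
      unfolding C_def by (rule CollectI, rule generically_mono[OF *])
        (metis ratfun_has_value_add add_nonneg_nonneg)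
    show "f * g \<in> C"
      unfolding C_def by (rule CollectI, rule generically_mono[OF *])
        (metis ratfun_has_value_mult mult_nonneg_nonneg)
  qed
  ultimately have "is_positive_cone C" by (auto simp: is_positive_cone_def)
  moreover have "to_fract ` set ps \<subseteq> C"
  proof (rule image_subsetI)
    fix p assume "p \<in> set ps"
    then have "(\<forall>p\<in>set ps. eval_mpoly p x > 0) \<longrightarrow> (\<exists>y\<ge>0. ratfun_has_value (to_fract p) x y)" for x :: "('a, 'n) vec"
      using ratfun_has_value_to_fract[of p x] order.strict_implies_order by blast
    then show "to_fract p \<in> C" unfolding C_def by (intro CollectI generically_True)
  qed
  ultimately show ?thesis using Cone_minimal[of C ps] assms by (auto simp: C_def)
qed

text \<open>The function field is formally real. This provides a proper cone for
  \<open>base_cone\<close> to fall back on, and shows that 2 is invertible in the function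
  field.\<close>

lemma minus_one_notin_Cone_Nil: "- 1 \<notin> (Cone [] :: ('a::linordered_field, 'n::{finite,linorder}) ratfun set)"
proof
  assume "- 1 \<in> (Cone [] :: ('a, 'n) ratfun set)"
  from Cone_generically_nonneg[OF this]
  have "generically (\<lambda>x :: ('a, 'n) vec. \<exists>y\<ge>0. ratfun_has_value (- 1) x y)" by simp
  then obtain x :: "('a, 'n) vec" where "\<exists>y\<ge>0. ratfun_has_value (- 1) x y"
    using generically_box[of _ 1 0] zero_less_one by blast
  moreover have "ratfun_has_value (- 1) x (- 1)"
    using ratfun_has_value_uminus[OF ratfun_has_value_1] .
  ultimately show False using ratfun_has_value_unique by fastforce
qed

section \<open>Maximal preorderings\<close>

text \<open>Sums of squares with nonnegative constant weights. The weights are kept because in the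
  field where this is applied nonnegative constants are not yet known to be squares.\<close>

inductive_set wsos :: "'a::linordered_field poly set" where
  zero: "0 \<in> wsos"
| step: "s \<in> wsos \<Longrightarrow> 0 \<le> c \<Longrightarrow> s + smult c (r * r) \<in> wsos"

lemma wsos_square: "0 \<le> c \<Longrightarrow> smult c (r * r) \<in> wsos"
  using wsos.step[OF wsos.zero, of c r] by simp

lemma wsos_add: "s \<in> wsos \<Longrightarrow> t \<in> wsos \<Longrightarrow> s + t \<in> wsos"
proof (induction s rule: wsos.induct)
  case (step s c r)
  then have "(s + t) + smult c (r * r) \<in> wsos" by (intro wsos.step) auto
  then show ?case by (simp add: algebra_simps)
qed simp

lemma wsos_mult_square: "s \<in> wsos \<Longrightarrow> 0 \<le> c \<Longrightarrow> smult c (r * r) * s \<in> wsos"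
proof (induction s rule: wsos.induct)
  case (step s d q)
  have "smult (c * d) ((r * q) * (r * q)) \<in> wsos" using step by (intro wsos_square) simp
  moreover have "smult c (r * r) * s \<in> wsos" using step by simp
  moreover have "smult c (r * r) * (s + smult d (q * q)) = smult c (r * r) * s + smult (c * d) ((r * q) * (r * q))"
    by (simp add: algebra_simps smult_add_right)
  ultimately show ?case by (simp only: wsos_add)
qed (simp add: wsos.zero)

lemma wsos_mult: "s \<in> wsos \<Longrightarrow> t \<in> wsos \<Longrightarrow> s * t \<in> wsos"
proof (induction s rule: wsos.induct)
  case (step s c r)
  then show ?case using wsos_mult_square[of t c r] by (simp add: distrib_right wsos_add)
qed (simp add: wsos.zero)

lemma wsos_nonneg: "s \<in> wsos \<Longrightarrow> poly s x \<ge> 0"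
  by (induction s rule: wsos.induct) auto

text \<open>Reducing the root of each square modulo \<open>p\<close> keeps the element a weighted
  sum of squares. The degree bound will make the cofactor of \<open>p\<close> smaller than
  \<open>p\<close>.\<close>

lemma wsos_reduce:
  assumes "s \<in> wsos" "degree p > 0"
  shows "\<exists>s'\<in>wsos. p dvd s - s' \<and> degree s' \<le> 2 * (degree p - 1)"
  using assms
proof (induction s rule: wsos.induct)
  case zero
  then show ?case using wsos.zero by force
next
  case (step s c r)
  then obtain s' where s': "s' \<in> wsos" "p dvd s - s'" "degree s' \<le> 2 * (degree p - 1)" by blast
  define r' where "r' = r mod p"
  have "p \<noteq> 0" using step.prems by auto
  have "degree r' \<le> degree p - 1"
    using degree_mod_less[OF \<open>p \<noteq> 0\<close>, of r] by (auto simp: r'_def)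
  then have "degree (smult c (r' * r')) \<le> 2 * (degree p - 1)"
    using degree_smult_le[of c "r' * r'"] degree_mult_le[of r' r'] by simp
  then have "degree (s' + smult c (r' * r')) \<le> 2 * (degree p - 1)"
    using s'(3) by (intro degree_add_le)
  moreover have "p dvd (s + smult c (r * r)) - (s' + smult c (r' * r'))"
  proof -
    have "p dvd r - r'" unfolding r'_def by (simp add: minus_mod_eq_mult_div)
    then have "p dvd (s - s') + smult c ((r - r') * (r + r'))"
      using s'(2) by (intro dvd_add dvd_smult dvd_mult2)
    moreover have "(s - s') + smult c ((r - r') * (r + r')) = (s + smult c (r * r)) - (s' + smult c (r' * r'))"
      by (simp add: algebra_simps smult_add_right smult_diff_right)
    ultimately show ?thesis by simp
  qed
  moreover have "s' + smult c (r' * r') \<in> wsos" using s' step by (intro wsos.step)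
  ultimately show ?case by blast
qed

text \<open>If \<open>p\<close> divides \<open>1 + s\<close> then, after reducing \<open>s\<close> modulo \<open>p\<close>, the cofactor again changes sign and
  has smaller degree.\<close>

lemma sign_change_not_dvd_one_plus_wsos:
  fixes p :: "'a::linordered_field poly"
  assumes "poly p a * poly p b < 0" "s \<in> wsos"
  shows "\<not> p dvd 1 + s"
  using assms
proof (induction "degree p" arbitrary: p s rule: less_induct)
  case less
  have deg: "degree p > 0"
  proof (rule ccontr)
    assume "\<not> ?thesis"
    then obtain c where "p = [:c:]" using degree_eq_zeroE by blast
    then show False using less.prems(1) by (simp add: mult_less_0_iff)
  qed
  show ?case
  proof
    assume dvd: "p dvd 1 + s"
    obtain s' where s': "s' \<in> wsos" "p dvd s - s'" "degree s' \<le> 2 * (degree p - 1)"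
      using wsos_reduce[OF less.prems(2) deg] by blast
    have "p dvd (1 + s) - (s - s')" using dvd s'(2) by (rule dvd_diff)
    then obtain q where q: "1 + s' = p * q" by (auto elim: dvdE)
    have pos: "poly p x * poly q x > 0" for x
    proof -
      have "poly p x * poly q x = 1 + poly s' x" using arg_cong[OF q, of "\<lambda>u. poly u x"] by simp
      then show ?thesis using wsos_nonneg[OF s'(1), of x] by simp
    qed
    have "p \<noteq> 0" "q \<noteq> 0" using pos[of 0] by auto
    then have "degree p + degree q = degree (1 + s')" using q by (simp add: degree_mult_eq)
    also have "\<dots> \<le> 2 * (degree p - 1)" using s'(3) by (intro degree_add_le) auto
    finally have "degree q < degree p" using deg by simp
    moreover have "poly q a * poly q b < 0"
    proof -
      have "(poly p a * poly q a) * (poly p b * poly q b) > 0" using pos by simp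
      then have "(poly p a * poly p b) * (poly q a * poly q b) > 0" by (simp only: mult_ac)
      then have "\<not> 0 \<le> poly q a * poly q b"
        using mult_nonpos_nonneg[of "poly p a * poly p b" "poly q a * poly q b"] less.prems(1) by linarith
      then show ?thesis by simp
    qed
    ultimately have "\<not> q dvd 1 + s'" using less.hyps s'(1) by blast
    then show False using q by simp
  qed
qed

text \<open>The cones live in an algebraically closed field, where \<open>- 1\<close> is a square,
  so they cannot contain all squares. Only squares of differences of members are required, that is,
  squares from the subfield \<open>diffs_of Q\<close> in which \<open>Q\<close> is a
  preordering.\<close>

definition preorder_cone :: "'w::field set \<Rightarrow> bool" where
  "preorder_cone Q \<longleftrightarrow> 1 \<in> Q \<and> (\<forall>a\<in>Q. \<forall>b\<in>Q. a + b \<in> Q \<and> a * b \<in> Q \<and> (a - b) * (a - b) \<in> Q) \<and>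
    (\<forall>a\<in>Q. inverse a \<in> Q) \<and> - 1 \<notin> Q"

definition diffs_of :: "'w::field set \<Rightarrow> 'w set" where
  "diffs_of Q = {a - b | a b. a \<in> Q \<and> b \<in> Q}"

text \<open>The subfield may grow together with the cone. Maximality therefore yields two things at
  once: a total order on \<open>diffs_of Q\<close>, and a subfield with no further ordered extension
  inside the algebraic closure.\<close>

definition maximal_cone :: "'w::field set \<Rightarrow> bool" where
  "maximal_cone Q \<longleftrightarrow> preorder_cone Q \<and> (\<forall>Q'. preorder_cone Q' \<longrightarrow> Q \<subseteq> Q' \<longrightarrow> Q' = Q)"

lemma ex_maximal_cone:
  assumes "preorder_cone Q0"
  obtains Q where "maximal_cone Q" "Q0 \<subseteq> Q"
proof -
  define A where "A = {Q. preorder_cone Q \<and> Q0 \<subseteq> Q}"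
  have "\<exists>M\<in>A. \<forall>S\<in>A. M \<subseteq> S \<longrightarrow> S = M"
  proof (rule subset_Zorn_nonempty)
    show "A \<noteq> {}" using assms by (auto simp: A_def)
    fix K assume ne: "K \<noteq> {}" and chain: "subset.chain A K"
    have mem: "preorder_cone Q" "Q0 \<subseteq> Q" if "Q \<in> K" for Q
      using chain that by (auto simp: subset.chain_def A_def)
    have two: "\<exists>Q\<in>K. a \<in> Q \<and> b \<in> Q" if ab: "a \<in> \<Union>K" "b \<in> \<Union>K" for a b
    proof -
      obtain S T where ST: "S \<in> K" "T \<in> K" "a \<in> S" "b \<in> T" using ab by blast
      have "S \<subseteq> T \<or> T \<subseteq> S" using chain ST by (auto simp: subset.chain_def)
      then show ?thesis using ST by blast
    qed
    have "preorder_cone (\<Union>K)"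
      unfolding preorder_cone_def
    proof (intro conjI ballI)
      show "1 \<in> \<Union>K" using ne mem(1) by (auto simp: preorder_cone_def)
      show "- 1 \<notin> \<Union>K" using mem(1) by (auto simp: preorder_cone_def)
      fix a assume a: "a \<in> \<Union>K"
      show "inverse a \<in> \<Union>K" using a mem(1) unfolding preorder_cone_def by blast
      fix b assume b: "b \<in> \<Union>K"
      obtain Q where "Q \<in> K" "a \<in> Q" "b \<in> Q" using two[OF a b] by blast
      then show "a + b \<in> \<Union>K" "a * b \<in> \<Union>K" "(a - b) * (a - b) \<in> \<Union>K"
        using mem(1)[of Q] unfolding preorder_cone_def by blast+
    qed
    moreover have "Q0 \<subseteq> \<Union>K" using ne mem(2) by blast
    ultimately show "\<Union>K \<in> A" by (simp add: A_def)
  qed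
  then obtain M where M: "M \<in> A" "\<And>S. S \<in> A \<Longrightarrow> M \<subseteq> S \<Longrightarrow> S = M" by blast
  have "maximal_cone M"
    unfolding maximal_cone_def using M by (auto simp: A_def)
  then show thesis using that M(1) by (auto simp: A_def)
qed

context
  fixes Q :: "'w::field set"
  assumes Q: "preorder_cone Q"
begin

lemma preorder_coneD:
  "1 \<in> Q" "a \<in> Q \<Longrightarrow> b \<in> Q \<Longrightarrow> a + b \<in> Q" "a \<in> Q \<Longrightarrow> b \<in> Q \<Longrightarrow> a * b \<in> Q" "0 \<in> Q"
  "a \<in> Q \<Longrightarrow> inverse a \<in> Q" "- 1 \<notin> Q" "a \<in> diffs_of Q \<Longrightarrow> a * a \<in> Q"
proof -
  show 1: "1 \<in> Q" "a \<in> Q \<Longrightarrow> b \<in> Q \<Longrightarrow> a + b \<in> Q" "a \<in> Q \<Longrightarrow> b \<in> Q \<Longrightarrow> a * b \<in> Q"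
    "a \<in> Q \<Longrightarrow> inverse a \<in> Q" "- 1 \<notin> Q" "a \<in> diffs_of Q \<Longrightarrow> a * a \<in> Q"
    using Q unfolding preorder_cone_def diffs_of_def by blast+
  have "(1 - 1) * (1 - 1) \<in> Q" using Q 1(1) unfolding preorder_cone_def by blast
  then show "0 \<in> Q" by simp
qed

lemma subset_diffs_of: "Q \<subseteq> diffs_of Q"
proof
  fix a assume "a \<in> Q"
  then have "a = a - 0 \<and> a \<in> Q \<and> 0 \<in> Q" using preorder_coneD(4) by simp
  then show "a \<in> diffs_of Q" unfolding diffs_of_def by blast
qed

lemma is_subfield_diffs_of: "is_subfield (diffs_of Q)"
proof -
  have I: "a - b \<in> diffs_of Q" if "a \<in> Q" "b \<in> Q" for a b
    using that unfolding diffs_of_def by blast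
  have E: "\<exists>a\<in>Q. \<exists>b\<in>Q. x = a - b" if "x \<in> diffs_of Q" for x
    using that unfolding diffs_of_def by blast
  have add: "x + y \<in> diffs_of Q" and mult: "x * y \<in> diffs_of Q" if xy: "x \<in> diffs_of Q" "y \<in> diffs_of Q" for x y
  proof -
    obtain a b c d where q: "a \<in> Q" "b \<in> Q" "c \<in> Q" "d \<in> Q" and *: "x = a - b" "y = c - d"
      using E[OF xy(1)] E[OF xy(2)] by blast
    have "x + y = (a + c) - (b + d)" "x * y = (a * c + b * d) - (a * d + b * c)"
      by (simp_all add: * algebra_simps)
    moreover have "a + c \<in> Q" "b + d \<in> Q" "a * c + b * d \<in> Q" "a * d + b * c \<in> Q"
      using q by (simp_all add: preorder_coneD)
    ultimately show "x + y \<in> diffs_of Q" "x * y \<in> diffs_of Q" using I by (simp_all only:)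
  qed
  have minus: "- x \<in> diffs_of Q" if x: "x \<in> diffs_of Q" for x
  proof -
    obtain a b where q: "a \<in> Q" "b \<in> Q" and *: "x = a - b" using E[OF x] by blast
    have "- x = b - a" by (simp add: *)
    then show ?thesis using I[OF q(2,1)] by simp
  qed
  have inv: "inverse x \<in> diffs_of Q" if x: "x \<in> diffs_of Q" for x
  proof -
    have "inverse (x * x) \<in> diffs_of Q"
      using preorder_coneD(5)[OF preorder_coneD(7)[OF x]] subset_diffs_of by blast
    then have "x * inverse (x * x) \<in> diffs_of Q" by (rule mult[OF x])
    moreover have "x * inverse (x * x) = inverse x"
      by (cases "x = 0") (simp_all flip: mult.assoc)
    ultimately show ?thesis by (simp only:)
  qed
  have "1 \<in> diffs_of Q" using preorder_coneD(1) subset_diffs_of by blast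
  then show ?thesis unfolding is_subfield_def by (intro conjI ballI add mult minus inv)
qed

lemma preorder_cone_antisym:
  assumes "a \<in> Q" "- a \<in> Q"
  shows "a = 0"
proof (rule ccontr)
  assume "a \<noteq> 0"
  have "inverse a * (- a) \<in> Q" using assms by (intro preorder_coneD(3,5))
  then show False using \<open>a \<noteq> 0\<close> preorder_coneD(6) by simp
qed

end

text \<open>If \<open>- x\<close> is not in \<open>Q\<close>, then the sums \<open>u + x * v\<close>
  with \<open>u\<close> and \<open>v\<close> in \<open>Q\<close> still form a proper cone:
  \<open>- 1 = u + x * v\<close> would give \<open>- x = (1 + u) / v\<close> in \<open>Q\<close>.
  Maximality puts \<open>x\<close> into \<open>Q\<close>.\<close>

lemma maximal_cone_total:
  assumes max: "maximal_cone Q" and x: "x \<in> diffs_of Q"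
  shows "x \<in> Q \<or> - x \<in> Q"
proof (rule disjCI)
  assume "- x \<notin> Q"
  define y where "y = - x"
  have Q: "preorder_cone Q" using max by (simp add: maximal_cone_def)
  note F = is_subfield_diffs_of[OF Q]
  note D = preorder_coneD[OF Q]
  have y: "y \<in> diffs_of Q" "y \<notin> Q" using \<open>- x \<notin> Q\<close> is_subfieldD(4)[OF F x] by (simp_all add: y_def)
  define Q' where "Q' = {u - y * v | u v. u \<in> Q \<and> v \<in> Q}"
  have I: "u - y * v \<in> Q'" if "u \<in> Q" "v \<in> Q" for u v using that unfolding Q'_def by blast
  have sub: "Q \<subseteq> Q'" using I[OF _ D(4)] by auto
  have Q'F: "Q' \<subseteq> diffs_of Q"
    using subset_diffs_of[OF Q] y(1) is_subfield_diff[OF F] is_subfieldD(3)[OF F] unfolding Q'_def by blast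
  have mult: "a * b \<in> Q'" and add: "a + b \<in> Q'" if ab: "a \<in> Q'" "b \<in> Q'" for a b
  proof -
    obtain u v u' v' where q: "u \<in> Q" "v \<in> Q" "u' \<in> Q" "v' \<in> Q" and *: "a = u - y * v" "b = u' - y * v'"
      using ab unfolding Q'_def by blast
    have "a * b = (u * u' + (y * y) * (v * v')) - y * (u * v' + v * u')" "a + b = (u + u') - y * (v + v')"
      by (simp_all add: * algebra_simps)
    moreover have "u * u' + (y * y) * (v * v') \<in> Q" "u * v' + v * u' \<in> Q" "u + u' \<in> Q" "v + v' \<in> Q"
      using q D(7)[OF y(1)] by (simp_all add: D)
    ultimately show "a * b \<in> Q'" "a + b \<in> Q'" using I by (simp_all only:)
  qed
  have "preorder_cone Q'"
    unfolding preorder_cone_def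
  proof (intro conjI ballI)
    show "1 \<in> Q'" using sub D(1) by blast
    show "- 1 \<notin> Q'"
    proof
      assume "- 1 \<in> Q'"
      then obtain u v where uv: "u \<in> Q" "v \<in> Q" "- 1 = u - y * v" unfolding Q'_def by blast
      then have yv: "y * v = 1 + u" by (simp add: algebra_simps)
      have "v \<noteq> 0" using uv D(6) by auto
      then have "y = (1 + u) * inverse v" using yv by (simp add: field_simps)
      also have "\<dots> \<in> Q" using uv by (simp add: D)
      finally show False using y(2) by blast
    qed
    fix a assume a: "a \<in> Q'"
    have "inverse a * inverse a \<in> Q"
      using Q'F a is_subfieldD(5)[OF F] by (intro D(7)) blast
    then have "a * (inverse a * inverse a) \<in> Q'" using mult a sub by blast
    then show "inverse a \<in> Q'" by (cases "a = 0") (simp_all flip: mult.assoc)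
    fix b assume b: "b \<in> Q'"
    show "a + b \<in> Q'" "a * b \<in> Q'" using add mult a b by auto
    have "a - b \<in> diffs_of Q" using a b Q'F is_subfield_diff[OF F] by blast
    then show "(a - b) * (a - b) \<in> Q'" using D(7) sub by blast
  qed
  then have "Q' = Q" using max sub unfolding maximal_cone_def by blast
  moreover have "0 - y * 1 \<in> Q'" by (rule I[OF D(4,1)])
  ultimately show "x \<in> Q" by (simp add: y_def)
qed

lemma positive_cone_image_preorder_cone:
  assumes "is_positive_cone C" "- 1 \<notin> C"
  shows "preorder_cone (to_ac ` C)"
  unfolding preorder_cone_def
proof (intro conjI ballI)
  note D = is_positive_coneD[OF assms(1)]
  show "1 \<in> to_ac ` C" using D(5) by (metis image_eqI to_ac_1)
  show "- 1 \<notin> to_ac ` C" using assms(2) by (auto simp flip: to_ac_1 to_ac_minus)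
  fix a assume "a \<in> to_ac ` C"
  then obtain a' where a: "a = to_ac a'" "a' \<in> C" by blast
  then show "inverse a \<in> to_ac ` C" using D(7)[of a'] by (auto simp flip: to_ac_inverse)
  fix b assume "b \<in> to_ac ` C"
  then obtain b' where b: "b = to_ac b'" "b' \<in> C" by blast
  show "a + b \<in> to_ac ` C" "a * b \<in> to_ac ` C" "(a - b) * (a - b) \<in> to_ac ` C"
    using a b D by (auto simp flip: to_ac_add to_ac_mult to_ac_diff)
qed

section \<open>A real closed extension of the function field\<close>

definition artin_lang_fails :: "('a::linordered_field, 'n::{finite,linorder}) ratfun set \<Rightarrow> bool" where
  "artin_lang_fails C \<longleftrightarrow> (\<exists>P. finite P \<and> (\<forall>p\<in>P. p \<noteq> 0 \<and> to_fract p \<in> C) \<and>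
    \<not> (\<exists>b. \<forall>p\<in>P. 0 < eval_mpoly p b))"

definition base_cone :: "('a::linordered_field, 'n::{finite,linorder}) ratfun set" where
  "base_cone = (SOME C. is_positive_cone C \<and> - 1 \<notin> C \<and>
    ((\<exists>C' :: ('a, 'n) ratfun set. is_positive_cone C' \<and> - 1 \<notin> C' \<and> artin_lang_fails C') \<longrightarrow> artin_lang_fails C))"

definition closure_cone :: "('a::linordered_field, 'n::{finite,linorder}) ratfun alg_closure set" where
  "closure_cone = (SOME Q. maximal_cone Q \<and> to_ac ` (base_cone :: ('a, 'n) ratfun set) \<subseteq> Q)"

lemma base_cone:
  fixes C' :: "('a::linordered_field, 'n::{finite,linorder}) ratfun set"
  defines "C \<equiv> base_cone :: ('a, 'n) ratfun set"
  shows "is_positive_cone C" "- 1 \<notin> C"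
    "is_positive_cone C' \<Longrightarrow> - 1 \<notin> C' \<Longrightarrow> artin_lang_fails C' \<Longrightarrow> artin_lang_fails C"
proof -
  let ?P = "\<lambda>C :: ('a, 'n) ratfun set. is_positive_cone C \<and> - 1 \<notin> C \<and>
    ((\<exists>C' :: ('a, 'n) ratfun set. is_positive_cone C' \<and> - 1 \<notin> C' \<and> artin_lang_fails C') \<longrightarrow> artin_lang_fails C)"
  have "\<exists>C. ?P C"
  proof (cases "\<exists>C' :: ('a, 'n) ratfun set. is_positive_cone C' \<and> - 1 \<notin> C' \<and> artin_lang_fails C'")
    case True
    then show ?thesis by blast
  next
    case False
    then have "?P (Cone [])" using is_positive_cone_Cone minus_one_notin_Cone_Nil by blast
    then show ?thesis by (rule exI)
  qed
  then have *: "?P C" unfolding C_def base_cone_def by (rule someI_ex)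
  show "is_positive_cone C" "- 1 \<notin> C" using * by blast+
  show "is_positive_cone C' \<Longrightarrow> - 1 \<notin> C' \<Longrightarrow> artin_lang_fails C' \<Longrightarrow> artin_lang_fails C"
    using * by blast
qed

lemma closure_cone:
  "maximal_cone (closure_cone :: ('a::linordered_field, 'n::{finite,linorder}) ratfun alg_closure set)"
  "to_ac ` (base_cone :: ('a, 'n) ratfun set) \<subseteq> closure_cone"
proof -
  let ?P = "\<lambda>Q. maximal_cone Q \<and> to_ac ` (base_cone :: ('a, 'n) ratfun set) \<subseteq> Q"
  have "preorder_cone (to_ac ` (base_cone :: ('a, 'n) ratfun set))"
    by (rule positive_cone_image_preorder_cone[OF base_cone(1,2)])
  then obtain Q where "maximal_cone Q" "to_ac ` (base_cone :: ('a, 'n) ratfun set) \<subseteq> Q"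
    by (rule ex_maximal_cone)
  then have "\<exists>Q. ?P Q" by blast
  then have "?P closure_cone" unfolding closure_cone_def by (rule someI_ex)
  then show "maximal_cone (closure_cone :: ('a, 'n) ratfun alg_closure set)"
    "to_ac ` (base_cone :: ('a, 'n) ratfun set) \<subseteq> closure_cone" by blast+
qed

lemma preorder_closure_cone:
  "preorder_cone (closure_cone :: ('a::linordered_field, 'n::{finite,linorder}) ratfun alg_closure set)"
  by (rule closure_cone(1)[unfolded maximal_cone_def, THEN conjunct1])

lemmas closure_coneD = preorder_coneD[OF preorder_closure_cone]
lemmas closure_subfield = is_subfield_diffs_of[OF preorder_closure_cone]

text \<open>A type cannot depend on a preordering, so the preordering is chosen once and for all: it is a
  counterexample to the Artin-Lang property if there is one.\<close>

typedef (overloaded) ('a, 'n) real_closure =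
  "diffs_of (closure_cone :: ('a::linordered_field, 'n::{finite,linorder}) ratfun alg_closure set)"
  morphisms rep_rc abs_rc
  using closure_coneD(1) subset_diffs_of[OF preorder_closure_cone] by blast

setup_lifting type_definition_real_closure

instantiation real_closure :: (linordered_field, "{finite,linorder}") field
begin

lift_definition zero_real_closure :: "('a, 'b) real_closure" is 0
  by (rule is_subfield_zero[OF closure_subfield])
lift_definition one_real_closure :: "('a, 'b) real_closure" is 1
  by (rule is_subfieldD[OF closure_subfield])
lift_definition plus_real_closure :: "('a, 'b) real_closure \<Rightarrow> ('a, 'b) real_closure \<Rightarrow> ('a, 'b) real_closure" is "(+)"
  by (rule is_subfieldD[OF closure_subfield])
lift_definition minus_real_closure :: "('a, 'b) real_closure \<Rightarrow> ('a, 'b) real_closure \<Rightarrow> ('a, 'b) real_closure" is "(-)"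
  by (rule is_subfield_diff[OF closure_subfield])
lift_definition times_real_closure :: "('a, 'b) real_closure \<Rightarrow> ('a, 'b) real_closure \<Rightarrow> ('a, 'b) real_closure" is "(*)"
  by (rule is_subfieldD[OF closure_subfield])
lift_definition divide_real_closure :: "('a, 'b) real_closure \<Rightarrow> ('a, 'b) real_closure \<Rightarrow> ('a, 'b) real_closure" is "(/)"
  by (rule is_subfield_divide[OF closure_subfield])
lift_definition uminus_real_closure :: "('a, 'b) real_closure \<Rightarrow> ('a, 'b) real_closure" is uminus
  by (rule is_subfieldD[OF closure_subfield])
lift_definition inverse_real_closure :: "('a, 'b) real_closure \<Rightarrow> ('a, 'b) real_closure" is inverse
  by (rule is_subfieldD[OF closure_subfield])

instance
proof
  fix x y z :: "('a, 'b) real_closure"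
  note rep = rep_rc_inject[symmetric] zero_real_closure.rep_eq one_real_closure.rep_eq
    plus_real_closure.rep_eq minus_real_closure.rep_eq times_real_closure.rep_eq
    divide_real_closure.rep_eq uminus_real_closure.rep_eq inverse_real_closure.rep_eq
  show "x + y + z = x + (y + z)" by (simp add: rep algebra_simps)
  show "x + y = y + x" by (simp add: rep algebra_simps)
  show "0 + x = x" by (simp add: rep algebra_simps)
  show "- x + x = 0" by (simp add: rep algebra_simps)
  show "x - y = x + - y" by (simp add: rep algebra_simps)
  show "x * y * z = x * (y * z)" by (simp add: rep algebra_simps)
  show "x * y = y * x" by (simp add: rep algebra_simps)
  show "1 * x = x" by (simp add: rep algebra_simps)
  show "(x + y) * z = x * z + y * z" by (simp add: rep algebra_simps)
  show "0 \<noteq> (1 :: ('a, 'b) real_closure)" by (simp add: rep algebra_simps)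
  show "inverse (0 :: ('a, 'b) real_closure) = 0" by (simp add: rep algebra_simps)
  show "x \<noteq> 0 \<Longrightarrow> inverse x * x = 1" by (simp add: rep)
  show "x div y = x * inverse y" by (simp add: rep divide_inverse)
qed

end

instantiation real_closure :: (linordered_field, "{finite,linorder}") linordered_field
begin

definition less_eq_real_closure :: "('a, 'b) real_closure \<Rightarrow> ('a, 'b) real_closure \<Rightarrow> bool" where
  "less_eq_real_closure x y \<longleftrightarrow> rep_rc (y - x) \<in> closure_cone"
definition less_real_closure :: "('a, 'b) real_closure \<Rightarrow> ('a, 'b) real_closure \<Rightarrow> bool" where
  "less_real_closure x y \<longleftrightarrow> x \<le> y \<and> \<not> y \<le> x"
definition abs_real_closure :: "('a, 'b) real_closure \<Rightarrow> ('a, 'b) real_closure" where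
  "abs_real_closure x = (if x < 0 then - x else x)"
definition sgn_real_closure :: "('a, 'b) real_closure \<Rightarrow> ('a, 'b) real_closure" where
  "sgn_real_closure x = (if x = 0 then 0 else if 0 < x then 1 else - 1)"

instance
proof
  fix x y z :: "('a, 'b) real_closure"
  show "(x < y) = (x \<le> y \<and> \<not> y \<le> x)" by (rule less_real_closure_def)
  show "x \<le> x"
    unfolding less_eq_real_closure_def minus_real_closure.rep_eq using closure_coneD(4) by simp
  show trans: "x \<le> z" if "x \<le> y" "y \<le> z"
    using closure_coneD(2)[of "rep_rc (y - x)" "rep_rc (z - y)"] that
    unfolding less_eq_real_closure_def minus_real_closure.rep_eq by simp
  show anti: "x = y" if "x \<le> y" "y \<le> x" for x y :: "('a, 'b) real_closure"
  proof -
    have "rep_rc y - rep_rc x = 0"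
      using that unfolding less_eq_real_closure_def minus_real_closure.rep_eq
      by (intro preorder_cone_antisym[OF preorder_closure_cone]) simp_all
    then show ?thesis by (simp add: rep_rc_inject)
  qed
  show "x \<le> y \<or> y \<le> x"
    using maximal_cone_total[OF closure_cone(1) rep_rc[of "y - x"]]
    unfolding less_eq_real_closure_def minus_real_closure.rep_eq by simp
  show "z + x \<le> z + y" if "x \<le> y"
    using that unfolding less_eq_real_closure_def minus_real_closure.rep_eq plus_real_closure.rep_eq by simp
  show "z * x < z * y" if "x < y" "0 < z"
  proof -
    have "rep_rc (y - x) \<in> closure_cone" "rep_rc (z - 0) \<in> closure_cone"
      using that unfolding less_real_closure_def less_eq_real_closure_def by auto
    then have "rep_rc z * (rep_rc y - rep_rc x) \<in> closure_cone"
      by (intro closure_coneD(3)) (simp_all add: minus_real_closure.rep_eq zero_real_closure.rep_eq)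
    then have le: "z * x \<le> z * y"
      unfolding less_eq_real_closure_def minus_real_closure.rep_eq times_real_closure.rep_eq
      by (simp add: right_diff_distrib)
    have "z \<noteq> 0" "x \<noteq> y" using that by (auto simp: less_real_closure_def)
    then have "rep_rc z * rep_rc x \<noteq> rep_rc z * rep_rc y"
      by (simp add: rep_rc_inject flip: zero_real_closure.rep_eq)
    then have "z * x \<noteq> z * y" by (metis times_real_closure.rep_eq)
    then have "\<not> z * y \<le> z * x" using le anti by blast
    then show ?thesis using le by (simp add: less_real_closure_def)
  qed
  show "\<bar>x\<bar> = (if x < 0 then - x else x)" by (rule abs_real_closure_def)
  show "sgn x = (if x = 0 then 0 else if 0 < x then 1 else - 1)" by (rule sgn_real_closure_def)
qed

end

section \<open>The intermediate value property of the extension\<close>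

lemma is_ring_hom_rep_rc: "is_ring_hom rep_rc"
  by (simp add: is_ring_hom_def one_real_closure.rep_eq plus_real_closure.rep_eq times_real_closure.rep_eq)

lemma rep_rc_eq_0_iff: "rep_rc x = 0 \<longleftrightarrow> x = 0"
  by (simp add: rep_rc_inject flip: zero_real_closure.rep_eq)

lemma zero_le_iff_rep_rc: "0 \<le> x \<longleftrightarrow> rep_rc x \<in> closure_cone"
  by (simp add: less_eq_real_closure_def)

text \<open>Division with remainder in an ideal. It is applied to the polynomials vanishing at an
  algebraic element and to the ideal generated by two polynomials.\<close>

lemma poly_min_degree_divides:
  fixes S :: "'r::field poly set"
  assumes "m \<in> S" "m \<noteq> 0" "\<And>r. r \<in> S \<Longrightarrow> r \<noteq> 0 \<Longrightarrow> degree m \<le> degree r"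
    and "\<And>r q. r \<in> S \<Longrightarrow> r - m * q \<in> S" and "r \<in> S"
  shows "m dvd r"
proof -
  have "r mod m \<in> S" using assms(4)[OF assms(5), of "r div m"] by (simp add: minus_mult_div_eq_mod)
  then have "r mod m = 0" using assms(3)[of "r mod m"] degree_mod_less[OF assms(2), of r] by force
  then show ?thesis by (simp add: dvd_eq_mod_eq_0)
qed

lemma ex_min_degree:
  assumes "p \<in> S" "p \<noteq> 0"
  obtains m where "m \<in> S" "m \<noteq> 0" "\<And>r. r \<in> S \<Longrightarrow> r \<noteq> 0 \<Longrightarrow> degree m \<le> degree r"
  using ex_has_least_nat[of "\<lambda>r. r \<in> S \<and> r \<noteq> 0" p degree] assms by blast

text \<open>Let \<open>\<beta>\<close> be a root of \<open>p\<close> in the algebraic closure and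
  \<open>m\<close> its minimal polynomial, which still changes sign. By
  \<open>sign_change_not_dvd_one_plus_wsos\<close>, the values at \<open>\<beta>\<close> of weighted
  sums of squares form a proper cone. It contains \<open>closure_cone\<close>, and
  \<open>\<beta>\<close> is a difference of two of its members, so by maximality
  \<open>\<beta>\<close> was in the field from the start.\<close>

lemma real_closure_root:
  fixes p :: "('a::linordered_field, 'n::{finite,linorder}) real_closure poly"
  assumes "poly p a * poly p b < 0"
  shows "\<exists>x. poly p x = 0"
  using assms
proof (induction "degree p" arbitrary: p rule: less_induct)
  case less
  show ?case
  proof (rule ccontr)
    assume noroot: "\<not> (\<exists>x. poly p x = 0)"
    have "p \<noteq> 0" using less.prems by auto
    have "degree p > 0"
    proof (rule ccontr)
      assume "\<not> ?thesis"
      then obtain c where "p = [:c:]" using degree_eq_zeroE by blast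
      then show False using less.prems by (simp add: mult_less_0_iff)
    qed
    note h = is_ring_hom_rep_rc[where 'a = 'a and 'b = 'n]
    have "degree (map_poly rep_rc p) = degree p"
      using \<open>p \<noteq> 0\<close> by (intro degree_map_poly_hom[OF h]) (simp add: rep_rc_eq_0_iff)
    then obtain \<beta> where \<beta>: "poly (map_poly rep_rc p) \<beta> = 0"
      using alg_closed_imp_poly_has_root[of "map_poly rep_rc p"] \<open>degree p > 0\<close> by auto
    define ev where "ev r = poly (map_poly rep_rc r) \<beta>" for r
    have ev: "ev (r + s) = ev r + ev s" "ev (r * s) = ev r * ev s" "ev (r - s) = ev r - ev s"
      "ev (smult c r) = rep_rc c * ev r" "ev [:c:] = rep_rc c" "ev 1 = 1" "ev 0 = 0" for r s c
      by (simp_all add: ev_def map_poly_hom_add[OF h] map_poly_hom_mult[OF h] map_poly_hom_diff[OF h]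
          map_poly_hom_smult[OF h] map_poly_hom_const[OF h] is_ring_homD[OF h])
    define I where "I = {r. ev r = 0}"
    have "p \<in> I" using \<beta> by (simp add: I_def ev_def)
    then obtain m where m: "m \<in> I" "m \<noteq> 0" and mmin: "\<And>r. r \<in> I \<Longrightarrow> r \<noteq> 0 \<Longrightarrow> degree m \<le> degree r"
      using ex_min_degree[OF _ \<open>p \<noteq> 0\<close>] by blast
    have mdvd: "m dvd r" if "r \<in> I" for r
      by (rule poly_min_degree_divides[OF m mmin _ that]) (use m in \<open>simp_all add: I_def ev\<close>)
    have degm: "degree m > 0"
    proof (rule ccontr)
      assume "\<not> ?thesis"
      then obtain c where "m = [:c:]" using degree_eq_zeroE by blast
      then show False using m by (simp add: I_def ev rep_rc_eq_0_iff)
    qed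
    obtain u where u: "p = m * u" using mdvd[OF \<open>p \<in> I\<close>] by (rule dvdE)
    then have "u \<noteq> 0" using \<open>p \<noteq> 0\<close> by auto
    have degp: "degree p = degree m + degree u" using u m \<open>u \<noteq> 0\<close> by (simp add: degree_mult_eq)
    have prod: "(poly m a * poly m b) * (poly u a * poly u b) < 0"
      using less.prems unfolding u poly_mult by (simp only: mult_ac)
    \<comment> \<open>The cofactor \<open>u\<close> has smaller degree than \<open>p\<close>, and
      its roots would be roots of \<open>p\<close>; so the sign change must come from
      \<open>m\<close>.\<close>
    have "\<not> poly u a * poly u b < 0"
      using less.hyps[of u] degp degm noroot u by auto
    then have msign: "poly m a * poly m b < 0"
      using prod by (metis mult_less_0_iff not_less_iff_gr_or_eq)
    \<comment> \<open>Bezout's argument: a generator \<open>e\<close> of the ideal of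
      \<open>s\<close> and \<open>m\<close> divides \<open>m\<close> without vanishing at
      \<open>\<beta>\<close>, so by minimality of \<open>m\<close> it is constant.\<close>
    have inv: "\<exists>r. ev s * ev r = 1" if s: "ev s \<noteq> 0" for s
    proof -
      define J where "J = {x * s + y * m | x y. True}"
      have JI: "x * s + y * m \<in> J" for x y unfolding J_def by blast
      have "s \<noteq> 0" using s ev(7) by auto
      have sJ: "s \<in> J" "m \<in> J" using JI[of 1 0] JI[of 0 1] by simp_all
      then obtain e where e: "e \<in> J" "e \<noteq> 0" and emin: "\<And>r. r \<in> J \<Longrightarrow> r \<noteq> 0 \<Longrightarrow> degree e \<le> degree r"
        using ex_min_degree[OF _ \<open>s \<noteq> 0\<close>] by blast
      obtain x y where xy: "e = x * s + y * m" using e(1) unfolding J_def by blast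
      have closed: "r - e * q \<in> J" if rJ: "r \<in> J" for r q
      proof -
        obtain x' y' where "r = x' * s + y' * m" using rJ unfolding J_def by blast
        then have "r - e * q = (x' - x * q) * s + (y' - y * q) * m"
          using xy by (simp add: algebra_simps)
        then show ?thesis using JI by simp
      qed
      have "e dvd m" "e dvd s"
        using poly_min_degree_divides[OF e emin closed] sJ by blast+
      then obtain f f' where f: "m = e * f" and f': "s = e * f'" by (auto elim!: dvdE)
      have "ev e \<noteq> 0" using s f' ev(2)[of e f'] by auto
      then have "ev f = 0" using m(1) f ev(2)[of e f] by (simp add: I_def)
      moreover have "f \<noteq> 0" using f m by auto
      ultimately have "degree m \<le> degree f" using mmin by (simp add: I_def)
      then have "degree e = 0" using f e(2) \<open>f \<noteq> 0\<close> by (simp add: degree_mult_eq)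
      then obtain c where c: "e = [:c:]" using degree_eq_zeroE by blast
      have "c \<noteq> 0" using e(2) c by simp
      have "rep_rc c = ev x * ev s"
        using arg_cong[OF xy, of ev] m(1) c by (simp add: ev I_def)
      then have "ev s * ev (smult (inverse c) x) = rep_rc (inverse c) * rep_rc c"
        by (simp add: ev)
      also have "\<dots> = rep_rc (inverse c * c)" by (simp only: is_ring_homD[OF h])
      also have "\<dots> = 1" using \<open>c \<noteq> 0\<close> by (simp add: is_ring_homD[OF h])
      finally show ?thesis by blast
    qed
    define Q' where "Q' = ev ` wsos"
    have "preorder_cone Q'"
      unfolding preorder_cone_def
    proof (intro conjI ballI)
      show "1 \<in> Q'" using wsos_square[of 1 1] ev(6) unfolding Q'_def by (metis image_eqI mult_1 smult_1_left zero_le_one)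
      show "- 1 \<notin> Q'"
      proof
        assume "- 1 \<in> Q'"
        then obtain s where s: "s \<in> wsos" "ev s = - 1" unfolding Q'_def by auto
        then have "1 + s \<in> I" by (simp add: I_def ev)
        then show False using sign_change_not_dvd_one_plus_wsos[OF msign s(1)] mdvd by blast
      qed
      fix x assume "x \<in> Q'"
      then obtain s where s: "s \<in> wsos" "x = ev s" unfolding Q'_def by blast
      show "inverse x \<in> Q'"
      proof (cases "x = 0")
        case True
        then show ?thesis using \<open>x \<in> Q'\<close> by simp
      next
        case False
        then obtain r where r: "ev s * ev r = 1" using inv s by blast
        have "smult 1 (r * r) * s \<in> wsos" by (rule wsos_mult_square[OF s(1)]) simp
        moreover have "inverse x = ev (smult 1 (r * r) * s)"
        proof -
          have "ev (smult 1 (r * r) * s) = ev r * (ev s * ev r)"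
            by (simp add: ev(2) mult_ac)
          also have "\<dots> = ev r" by (simp add: r)
          also have "\<dots> = inverse x" using r s(2) by (simp add: inverse_unique)
          finally show ?thesis ..
        qed
        ultimately show ?thesis unfolding Q'_def by blast
      qed
      fix y assume "y \<in> Q'"
      then obtain t where t: "t \<in> wsos" "y = ev t" unfolding Q'_def by blast
      show "x + y \<in> Q'" "x * y \<in> Q'"
        using wsos_add[OF s(1) t(1)] wsos_mult[OF s(1) t(1)] s(2) t(2) unfolding Q'_def
        by (metis ev(1) image_eqI, metis ev(2) image_eqI)
      have "smult 1 ((s - t) * (s - t)) \<in> wsos" by (rule wsos_square) simp
      then show "(x - y) * (x - y) \<in> Q'"
        using s(2) t(2) unfolding Q'_def by (metis ev(2) ev(3) image_eqI smult_1_left)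
    qed
    moreover have "closure_cone \<subseteq> Q'"
    proof
      fix q :: "('a, 'n) ratfun alg_closure" assume q: "q \<in> closure_cone"
      then obtain c where c: "q = rep_rc c"
        using subset_diffs_of[OF preorder_closure_cone] rep_rc_cases by blast
      then have "0 \<le> c" using q by (simp add: zero_le_iff_rep_rc)
      then have "smult c (1 * 1) \<in> wsos" by (rule wsos_square)
      moreover have "ev (smult c (1 * 1)) = q" by (simp add: ev c)
      ultimately show "q \<in> Q'" unfolding Q'_def by blast
    qed
    ultimately have Q': "Q' = closure_cone"
      using closure_cone(1)[where 'a = 'a and 'n = 'n] unfolding maximal_cone_def by blast
    \<comment> \<open>\<open>\<beta>\<close> is the square of \<open>(1 + \<beta>) / 2\<close> minus
      the square of \<open>(1 - \<beta>) / 2\<close>.\<close>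
    have "\<beta> \<in> diffs_of Q'"
    proof -
      have quarter: "0 \<le> (1 / 4 :: ('a, 'n) real_closure)" by simp
      define s where "s = smult (1/4) ([:1, 1:] * [:1, 1 :: ('a, 'n) real_closure:])"
      define t where "t = smult (1/4) ([:1, - 1:] * [:1, - 1 :: ('a, 'n) real_closure:])"
      have "s \<in> wsos" "t \<in> wsos" unfolding s_def t_def by (rule wsos_square[OF quarter])+
      moreover have "\<beta> = ev s - ev t"
      proof -
        have "s - t = [:0, 1:]" by (simp add: s_def t_def)
        then have "ev s - ev t = ev [:0, 1:]" by (simp only: ev(3)[symmetric])
        then show ?thesis by (simp add: ev_def map_poly_pCons is_ring_homD[OF h])
      qed
      ultimately show ?thesis unfolding diffs_of_def Q'_def by blast
    qed
    then obtain x where x: "\<beta> = rep_rc x" unfolding Q' using rep_rc_cases by blast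
    have "rep_rc (poly p x) = 0" using \<beta> unfolding x poly_map_poly_hom[OF h] .
    then show False using noroot by (simp add: rep_rc_eq_0_iff)
  qed
qed

lemma poly_ivp_real_closure: "poly_ivp TYPE(('a::linordered_field, 'n::{finite,linorder}) real_closure)"
  by (rule poly_ivpI) (rule real_closure_root)

section \<open>Positivity on the set where the polynomials are positive\<close>

text \<open>A polynomial is its own value at the generic point. This turns membership of polynomials
  in a cone into sign conditions satisfied by a point over the extension.\<close>

lemma mpoly_hom_to_fract:
  "to_fract p = eval_hom ratfun_const (\<lambda>i. to_fract (Poly_Mapping.single (Poly_Mapping.single i 1) 1))
    (p :: ('a::field, 'n::{finite,linorder}) mpoly)"
proof -
  have hom: "is_ring_hom (to_fract :: ('a, 'n) mpoly \<Rightarrow> _)"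
    by (simp add: is_ring_hom_def)
  have "Poly_Mapping.single (Poly_Mapping.single i 1) (1::'a) ^ k = Poly_Mapping.single (Poly_Mapping.single i k) 1"
    for i :: 'n and k
  proof (induction k)
    case (Suc k)
    then show ?case by (simp add: mult_single flip: single_add)
  qed simp
  note pow = this
  have mon: "(\<Prod>i\<in>A. Poly_Mapping.single (Poly_Mapping.single i 1) (1::'a) ^ Poly_Mapping.lookup e i) =
      Poly_Mapping.single (\<Sum>i\<in>A. Poly_Mapping.single i (Poly_Mapping.lookup e i)) 1" if "finite A" for e and A :: "'n set"
    using that by (induction A rule: finite_induct) (simp_all add: mult_single pow del: One_nat_def)
  have "(\<Sum>i\<in>UNIV. Poly_Mapping.single i (Poly_Mapping.lookup e i)) = e" for e :: "'n \<Rightarrow>\<^sub>0 nat"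
    by (rule poly_mapping_eqI) (simp add: lookup_sum lookup_single when_def)
  then have val: "monom_value (\<lambda>i. to_fract (Poly_Mapping.single (Poly_Mapping.single i 1) (1::'a))) e =
      to_fract (Poly_Mapping.single e 1)" for e :: "'n \<Rightarrow>\<^sub>0 nat"
    unfolding monom_value_def is_ring_homD(7)[OF hom, symmetric] is_ring_hom_prod[OF hom, symmetric]
    by (simp add: mon del: One_nat_def)
  have "to_fract p = to_fract (\<Sum>e\<in>Poly_Mapping.keys p. Poly_Mapping.single e (Poly_Mapping.lookup p e))"
    by (simp flip: poly_mapping_sum_single)
  also have "\<dots> = (\<Sum>e\<in>Poly_Mapping.keys p.
      ratfun_const (Poly_Mapping.lookup p e) * to_fract (Poly_Mapping.single e 1))"
    unfolding is_ring_hom_sum[OF hom] ratfun_const_def to_fract_mult[symmetric] by (simp add: mult_single)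
  finally show ?thesis by (simp only: eval_hom_def val)
qed

lemma eval_hom_comp:
  assumes f: "is_ring_hom f"
  shows "f (eval_hom \<iota> x p) = eval_hom (\<lambda>c. f (\<iota> c)) (\<lambda>i. f (x i)) p"
  unfolding eval_hom_def monom_value_def
  by (simp add: is_ring_hom_sum[OF f] is_ring_hom_prod[OF f] is_ring_homD[OF f])

text \<open>Positive elements are nonzero squares, and homomorphisms of fields preserve these; so
  constants keep their sign in any ordered extension.\<close>

lemma real_closed_hom_same_sign:
  assumes rc: "real_closed TYPE('a::linordered_field)"
    and f: "is_ring_hom (f :: 'a \<Rightarrow> 'b::linordered_field)"
  shows "same_sign c (f c)"
proof -
  have pos: "f c > 0" if c: "c > 0" for c
  proof -
    obtain y where y: "0 \<le> y" "y * y = c" using real_closed_sqrt[OF rc, of c] c by auto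
    then have "y \<noteq> 0" using c by auto
    then have "y * inverse y = 1" by simp
    then have "f y * f (inverse y) = 1" using is_ring_homD(1,3)[OF f] by metis
    then have "f y \<noteq> 0" by auto
    moreover have "f c = f y * f y" using y(2) is_ring_homD(3)[OF f] by metis
    ultimately show ?thesis by (simp add: zero_less_mult_iff linorder_neq_iff disj_commute)
  qed
  have neg: "f c < 0" if "c < 0" for c
    using pos[of "- c"] that by (simp add: is_ring_homD[OF f])
  have "f 0 = 0" by (rule is_ring_homD(4)[OF f])
  then show ?thesis
    unfolding same_sign_def using pos[of c] neg[of c] linorder_less_linear[of c 0] by auto
qed

lemma ratfun_two_neq_0: "(2 :: ('a::linordered_field, 'n::{finite,linorder}) ratfun) \<noteq> 0"
proof
  assume "(2 :: ('a, 'n) ratfun) = 0"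
  then have "- 1 = (1 :: ('a, 'n) ratfun)" by (metis add_eq_0_iff one_add_one)
  then show False
    using minus_one_notin_Cone_Nil[where 'a = 'a and 'n = 'n] is_positive_coneD(5)[OF is_positive_cone_Cone] by metis
qed

text \<open>Hence the differences from any positive cone exhaust the function field, and a cone
  containing \<open>- 1\<close> is the whole field.\<close>

lemma eq_diff_squares:
  fixes x :: "'l::field"
  assumes "(2 :: 'l) \<noteq> 0"
  shows "x = ((x + 1) / 2) * ((x + 1) / 2) - ((x - 1) / 2) * ((x - 1) / 2)"
proof -
  have "((x + 1) / 2) * ((x + 1) / 2) - ((x - 1) / 2) * ((x - 1) / 2) =
      ((x + 1) / 2 - (x - 1) / 2) * ((x + 1) / 2 + (x - 1) / 2)"
    by (simp add: algebra_simps)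
  also have "(x + 1) / 2 - (x - 1) / 2 = 1" using assms by (simp flip: diff_divide_distrib)
  also have "(x + 1) / 2 + (x - 1) / 2 = x" using assms by (simp flip: add_divide_distrib mult_2_right)
  finally show ?thesis by simp
qed

text \<open>If \<open>C\<close> were a counterexample, \<open>base_cone\<close> would be one too. In
  its real closed extension the generic point makes all of \<open>P\<close> positive, and the
  transfer of sign conditions yields such a point over the given field.\<close>

theorem artin_lang:
  fixes C :: "('a::linordered_field, 'n::{finite,linorder}) ratfun set"
  assumes rc: "real_closed TYPE('a)" and C: "is_positive_cone C" "- 1 \<notin> C"
    and P: "finite P" "\<And>p. p \<in> P \<Longrightarrow> p \<noteq> 0 \<and> to_fract p \<in> C"
  obtains b where "\<And>p. p \<in> P \<Longrightarrow> 0 < eval_mpoly p b"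
proof -
  let ?B = "base_cone :: ('a, 'n) ratfun set"
  have "\<not> artin_lang_fails C"
  proof
    assume "artin_lang_fails C"
    then have "artin_lang_fails ?B" using base_cone(3)[OF C] by blast
    then obtain P where P: "finite P" "\<And>p. p \<in> P \<Longrightarrow> p \<noteq> 0 \<and> to_fract p \<in> ?B"
      and fail: "\<not> (\<exists>b :: ('a, 'n) vec. \<forall>p\<in>P. 0 < eval_mpoly p b)"
      unfolding artin_lang_fails_def by blast
    have sub: "to_ac f \<in> diffs_of closure_cone" for f :: "('a, 'n) ratfun"
    proof -
      have "((f + 1) / 2) * ((f + 1) / 2) \<in> ?B" "((f - 1) / 2) * ((f - 1) / 2) \<in> ?B"
        using is_positive_coneD(1)[OF base_cone(1)] by blast+
      then have "to_ac (((f + 1) / 2) * ((f + 1) / 2)) - to_ac (((f - 1) / 2) * ((f - 1) / 2)) \<in> diffs_of closure_cone"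
        using closure_cone(2)[where 'a = 'a and 'n = 'n] unfolding diffs_of_def by blast
      then show ?thesis
        unfolding to_ac_diff[symmetric] eq_diff_squares[OF ratfun_two_neq_0, of f, symmetric] .
    qed
    define j :: "('a, 'n) ratfun \<Rightarrow> ('a, 'n) real_closure" where "j f = abs_rc (to_ac f)" for f
    have rep_j: "rep_rc (j f) = to_ac f" for f unfolding j_def by (rule abs_rc_inverse[OF sub])
    have j: "is_ring_hom j"
      unfolding is_ring_hom_def
      by (simp add: rep_rc_inject[symmetric] rep_j one_real_closure.rep_eq plus_real_closure.rep_eq
          times_real_closure.rep_eq)
    have j_pos: "0 < j f" if "f \<in> ?B" "f \<noteq> 0" for f
    proof -
      have "0 \<le> j f"
        unfolding zero_le_iff_rep_rc rep_j using closure_cone(2)[where 'a = 'a and 'n = 'n] that(1) by blast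
      moreover have "j f \<noteq> 0" using that(2) by (simp flip: rep_rc_eq_0_iff add: rep_j)
      ultimately show ?thesis by simp
    qed
    have jc: "is_ring_hom (\<lambda>c. j (ratfun_const c))"
      by (simp add: is_ring_hom_def is_ring_homD[OF j] ratfun_const_simps)
    define y where "y i = j (to_fract (Poly_Mapping.single (Poly_Mapping.single i 1) 1))" for i
    have eval_y: "eval_hom (\<lambda>c. j (ratfun_const c)) y p = j (to_fract p)" for p
      unfolding y_def mpoly_hom_to_fract[of p] eval_hom_comp[OF j] ..
    obtain E where E: "\<And>(\<iota> :: 'a \<Rightarrow> 'a) (\<kappa> :: 'a \<Rightarrow> ('a, 'n) real_closure) y.
        is_ring_hom \<iota> \<Longrightarrow> is_ring_hom \<kappa> \<Longrightarrow> (\<And>e. e \<in> E \<Longrightarrow> same_sign (\<iota> e) (\<kappa> e)) \<Longrightarrow>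
        \<exists>x. \<forall>p\<in>P. same_sign (eval_hom \<iota> x p) (eval_hom \<kappa> y p)"
      by (rule quantifier_elimination[OF real_closed_imp_poly_ivp[OF rc]
            poly_ivp_real_closure[where 'a = 'a and 'n = 'n] P(1)]) blast
    \<comment> \<open>The parameters are constants here, so their signs agree whatever
      \<open>E\<close> is.\<close>
    obtain x where x: "\<forall>p\<in>P. same_sign (eval_hom (\<lambda>c. c) x p) (eval_hom (\<lambda>c. j (ratfun_const c)) y p)"
      using E[OF is_ring_hom_id jc real_closed_hom_same_sign[OF rc jc], of y] by blast
    have "0 < eval_mpoly p (vec_lambda x)" if "p \<in> P" for p
    proof -
      have "0 < j (to_fract p)" using P(2)[OF that] by (intro j_pos) auto
      moreover have "($) (vec_lambda x) = x" by (simp add: fun_eq_iff)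
      ultimately show ?thesis
        using x that unfolding eval_y same_sign_def eval_mpoly_eq_eval_hom by auto
    qed
    then show False using fail by blast
  qed
  then have "\<exists>b. \<forall>p\<in>P. 0 < eval_mpoly p b"
    unfolding artin_lang_fails_def using P by (auto dest: spec[of _ P])
  then show thesis using that by blast
qed

text \<open>If \<open>f\<close> is not in the preordering \<open>Cone ps\<close>, then adjoining \<open>- f\<close> keeps it proper.\<close>

theorem nonneg_imp_in_Cone:
  fixes f :: "('a::linordered_field, 'n::{finite,linorder}) ratfun"
  assumes rc: "real_closed TYPE('a)" and ps: "\<And>p. p \<in> set ps \<Longrightarrow> p \<noteq> 0" and "q \<noteq> 0"
    and nonneg: "\<And>b y. (\<And>p. p \<in> set ps \<Longrightarrow> 0 < eval_mpoly p b) \<Longrightarrow> eval_mpoly q b \<noteq> 0 \<Longrightarrow>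
      ratfun_has_value f b y \<Longrightarrow> 0 \<le> y"
  shows "f \<in> Cone ps"
proof (rule ccontr)
  assume f: "f \<notin> Cone ps"
  note D = is_positive_coneD[OF is_positive_cone_Cone[of ps]]
  define C where "C = {u - f * v | u v. u \<in> Cone ps \<and> v \<in> Cone ps}"
  have I: "u - f * v \<in> C" if "u \<in> Cone ps" "v \<in> Cone ps" for u v using that unfolding C_def by blast
  have sub: "u \<in> C" if "u \<in> Cone ps" for u using I[OF that D(4)] by simp
  have "is_positive_cone C"
    unfolding is_positive_cone_def
  proof (intro conjI allI ballI)
    show "x * x \<in> C" for x by (rule sub[OF D(1)])
    fix a b assume "a \<in> C" "b \<in> C"
    then obtain u v u' v' where q: "u \<in> Cone ps" "v \<in> Cone ps" "u' \<in> Cone ps" "v' \<in> Cone ps"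
      and *: "a = u - f * v" "b = u' - f * v'" unfolding C_def by blast
    have "a * b = (u * u' + (f * f) * (v * v')) - f * (u * v' + v * u')" "a + b = (u + u') - f * (v + v')"
      by (simp_all add: * algebra_simps)
    moreover have "u * u' + (f * f) * (v * v') \<in> Cone ps" "u * v' + v * u' \<in> Cone ps"
        "u + u' \<in> Cone ps" "v + v' \<in> Cone ps"
      using q by (simp_all add: D)
    ultimately show "a + b \<in> C" "a * b \<in> C" using I by (simp_all only:)
  qed
  moreover have "- 1 \<notin> C"
  proof
    assume "- 1 \<in> C"
    then obtain u v where uv: "u \<in> Cone ps" "v \<in> Cone ps" "- 1 = u - f * v" unfolding C_def by blast
    then have fv: "f * v = 1 + u" by (simp add: algebra_simps)
    show False
    proof (cases "v = 0")
      \<comment> \<open>Then \<open>Cone ps\<close> contains \<open>- 1\<close> and hence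
        everything, including \<open>f\<close>.\<close>
      case True
      then have minus1: "- 1 \<in> Cone ps" using uv by simp
      have "f = ((f + 1) / 2) * ((f + 1) / 2) + (- 1) * (((f - 1) / 2) * ((f - 1) / 2))"
        using eq_diff_squares[OF ratfun_two_neq_0, of f] by simp
      also have "\<dots> \<in> Cone ps" using minus1 D(1-3) by blast
      finally show False using f by blast
    next
      case False
      then have "f = (1 + u) * inverse v" using fv by (simp add: field_simps)
      also have "\<dots> \<in> Cone ps" using uv by (simp add: D)
      finally show False using f by blast
    qed
  qed
  moreover obtain a d where ad: "f = Fract a d" "d \<noteq> 0" by (cases f) auto
  have "f \<noteq> 0" using f D(4) by auto
  then have "a \<noteq> 0" using ad by (auto simp: fract_collapse)
  \<comment> \<open>The added polynomial is \<open>- f\<close> times the square of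
    \<open>d * q\<close>. It is positive exactly at points where \<open>f = a / d\<close> is defined
    and negative and \<open>q\<close> does not vanish, which is where \<open>nonneg\<close> gives a
    contradiction.\<close>
  define P where "P = insert (- (a * d) * (q * q)) (set ps)"
  have "p \<noteq> 0 \<and> to_fract p \<in> C" if "p \<in> P" for p
  proof (cases "p \<in> set ps")
    case True
    then show ?thesis using ps sub Cone_superset by blast
  next
    case False
    then have p: "p = - (a * d) * (q * q)" using that by (simp add: P_def)
    have "to_fract d \<noteq> 0" using ad(2) by simp
    then have "to_fract p = 0 - f * (to_fract (d * q) * to_fract (d * q))"
      unfolding ad(1) p Fract_conv_to_fract by (simp add: field_simps)
    also have "\<dots> \<in> C" by (rule I[OF D(4,1)])
    finally show ?thesis using p \<open>a \<noteq> 0\<close> ad(2) \<open>q \<noteq> 0\<close> by simp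
  qed
  moreover have "finite P" by (simp add: P_def)
  ultimately obtain b where b: "\<And>p. p \<in> P \<Longrightarrow> 0 < eval_mpoly p b"
    using artin_lang[OF rc, of C P] by blast
  have neg: "eval_mpoly a b * eval_mpoly d b * (eval_mpoly q b * eval_mpoly q b) < 0"
    using b[of "- (a * d) * (q * q)"] by (simp add: P_def eval_mpoly_simps)
  then have nz: "eval_mpoly d b \<noteq> 0" "eval_mpoly q b \<noteq> 0" by auto
  have "0 \<le> eval_mpoly a b / eval_mpoly d b"
    by (rule nonneg[OF _ nz(2)]) (use b nz ad(1) in \<open>auto simp: P_def intro: ratfun_has_valueI\<close>)
  then have "0 \<le> eval_mpoly a b * eval_mpoly d b"
    using nz(1) by (simp add: zero_le_divide_iff zero_le_mult_iff)
  then show False using neg mult_nonneg_nonneg[of "eval_mpoly a b * eval_mpoly d b" "eval_mpoly q b * eval_mpoly q b"]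
    by (simp add: not_less[symmetric])
qed

section \<open>Polynomial bounds up to an infinite element\<close>

definition infinite_elt :: "'a::linordered_field \<Rightarrow> bool" where
  "infinite_elt c \<longleftrightarrow> (\<forall>k::nat. of_nat k < c)"

lemma infinite_elt_ge_1: "infinite_elt c \<Longrightarrow> 1 \<le> c"
  unfolding infinite_elt_def by (metis of_nat_1 order.strict_implies_order)

lemma infinite_elt_notin_finite_part: "infinite_elt c \<Longrightarrow> c \<le> x \<Longrightarrow> x \<notin> finite_part"
  unfolding infinite_elt_def finite_part_iff by (metis abs_ge_self not_le order.strict_trans1)

lemma infinite_elt_divide_of_nat:
  assumes "infinite_elt c"
  shows "infinite_elt (c / of_nat (Suc n))"
  unfolding infinite_elt_def
proof
  fix k
  have "of_nat (k * Suc n) < c" using assms unfolding infinite_elt_def by blast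
  then have "of_nat k * of_nat (Suc n) < c" by (simp only: of_nat_mult)
  then show "of_nat k < c / of_nat (Suc n)" by (simp add: pos_less_divide_eq del: of_nat_Suc)
qed

text \<open>Taking \<open>n\<close> successive square roots is enough: since
  \<open>d \<ge> 1\<close>, the power \<open>d ^ n\<close> is at most
  \<open>d ^ (2 ^ n)\<close>.\<close>

lemma infinite_elt_root:
  fixes c :: "'a::linordered_field"
  assumes rc: "real_closed TYPE('a)" and "infinite_elt c"
  obtains d where "infinite_elt d" "d ^ n \<le> c"
proof -
  have "\<exists>d. infinite_elt d \<and> d ^ (2 ^ r) \<le> c" for r :: nat
  proof (induction r)
    case 0
    then show ?case using assms(2) by (intro exI[of _ c]) simp
  next
    case (Suc r)
    then obtain d where d: "infinite_elt d" "d ^ (2 ^ r) \<le> c" by blast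
    obtain e where e: "0 \<le> e" "e * e = d"
      using real_closed_sqrt[OF rc, of d] infinite_elt_ge_1[OF d(1)] by auto
    have "infinite_elt e"
      unfolding infinite_elt_def
    proof (rule allI, rule ccontr)
      fix k :: nat assume "\<not> of_nat k < e"
      then have "e * e \<le> of_nat k * of_nat k" using e(1) by (intro mult_mono) auto
      then have "d \<le> of_nat (k * k)" by (simp add: e(2))
      then show False using d(1) unfolding infinite_elt_def by (meson not_le)
    qed
    moreover have "e ^ (2 ^ Suc r) = d ^ (2 ^ r)"
      by (simp add: power_mult power2_eq_square e(2))
    ultimately show ?case using d(2) by auto
  qed
  then obtain d where d: "infinite_elt d" "d ^ (2 ^ n) \<le> c" by blast
  have "d ^ n \<le> d ^ (2 ^ n)"
    using infinite_elt_ge_1[OF d(1)] less_exp[of n] by (intro power_increasing) auto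
  then show thesis using that d by (meson order.trans)
qed

text \<open>The region contains pairs with \<open>s\<close> a natural number and \<open>t\<close>
  infinite, as well as pairs with \<open>s\<close> infinite. Finitariness excludes solutions for the
  former, and constancy of signs carries this over to the latter.\<close>

definition gap_region :: "nat \<Rightarrow> nat \<Rightarrow> 'a::linordered_field \<Rightarrow> 'a \<Rightarrow> 'a \<Rightarrow> bool" where
  "gap_region N k c s t \<longleftrightarrow> 1 \<le> s \<and> of_nat N \<le> s \<and> s \<le> c \<and> s ^ k \<le> t \<and> t \<le> c"

lemma gap_region_mono:
  assumes "gap_region N k c s t" "N' \<le> N" "k' \<le> k" "c \<le> c'"
  shows "gap_region N' k' c' s t"
proof -
  have "s ^ k' \<le> s ^ k" using assms by (intro power_increasing) (auto simp: gap_region_def)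
  moreover have "of_nat N' \<le> (of_nat N :: 'a)" using assms(2) by simp
  ultimately show ?thesis using assms unfolding gap_region_def by (meson order.trans)
qed

lemma gap_region_ge_1: "gap_region N k c s t \<Longrightarrow> 1 \<le> s \<and> 1 \<le> t"
  unfolding gap_region_def by (meson one_le_power order.trans)

text \<open>A filter: \<open>N\<close> and \<open>k\<close> may be enlarged and \<open>c\<close>
  made smaller as long as it stays infinite.\<close>

definition eventually_gap :: "('a::linordered_field \<Rightarrow> 'a \<Rightarrow> bool) \<Rightarrow> bool" where
  "eventually_gap P \<longleftrightarrow> (\<exists>N k c. infinite_elt c \<and> (\<forall>s t. gap_region N k c s t \<longrightarrow> P s t))"

lemma eventually_gap_conj:
  assumes "eventually_gap P" "eventually_gap Q"
  shows "eventually_gap (\<lambda>s t. P s t \<and> Q s t)"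
proof -
  obtain N k c where 1: "infinite_elt c" "\<forall>s t. gap_region N k c s t \<longrightarrow> P s t"
    using assms(1) unfolding eventually_gap_def by blast
  obtain N' k' c' where 2: "infinite_elt c'" "\<forall>s t. gap_region N' k' c' s t \<longrightarrow> Q s t"
    using assms(2) unfolding eventually_gap_def by blast
  have "infinite_elt (min c c')" using 1 2 by (simp add: infinite_elt_def)
  moreover have "P s t \<and> Q s t" if "gap_region (max N N') (max k k') (min c c') s t" for s t
    using 1(2) 2(2) gap_region_mono[OF that, of N k c] gap_region_mono[OF that, of N' k' c'] by simp
  ultimately show ?thesis unfolding eventually_gap_def by blast
qed

lemma eventually_gap_mono:
  assumes "eventually_gap P" "\<And>s t. 1 \<le> s \<Longrightarrow> 1 \<le> t \<Longrightarrow> P s t \<Longrightarrow> Q s t"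
  shows "eventually_gap Q"
proof -
  obtain N k c where 1: "infinite_elt c" "\<And>s t. gap_region N k c s t \<Longrightarrow> P s t"
    using assms(1) unfolding eventually_gap_def by blast
  have "Q s t" if "gap_region N k c s t" for s t
    using assms(2)[OF _ _ 1(2)[OF that]] gap_region_ge_1[OF that] by blast
  then show ?thesis using 1(1) unfolding eventually_gap_def by blast
qed

lemma eventually_gap_True:
  assumes "non_archimedean TYPE('a::linordered_field)"
  shows "eventually_gap (\<lambda>s t::'a. True)"
  using assms unfolding eventually_gap_def non_archimedean_def infinite_elt_def by blast

lemma eventually_gap_ball:
  assumes na: "non_archimedean TYPE('a::linordered_field)"
    and "finite A" "\<And>a. a \<in> A \<Longrightarrow> eventually_gap (P a :: 'a \<Rightarrow> 'a \<Rightarrow> bool)"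
  shows "eventually_gap (\<lambda>s t. \<forall>a\<in>A. P a s t)"
  using assms(2,3)
  by (induction A rule: finite_induct) (auto simp: eventually_gap_True[OF na] intro: eventually_gap_conj)

lemma power_le_of_le:
  fixes s c :: "'a::linordered_field"
  assumes "0 \<le> s" "s \<le> c" "0 \<le> t" "t \<le> c"
  shows "s ^ i * t ^ j \<le> c ^ (i + j)"
  unfolding power_add using assms by (intro mult_mono power_mono) auto

text \<open>Of two distinct terms one dominates: this is decided by the quotient of the coefficients if it is
  infinite or infinitesimal, and otherwise lexicographically with \<open>t\<close> before \<open>s\<close>.\<close>

lemma gap_dominates_coeff:
  fixes a a' :: "'a::linordered_field"
  assumes rc: "real_closed TYPE('a)" and a: "a' \<noteq> 0" and big: "\<And>n::nat. of_nat n * \<bar>a'\<bar> \<le> \<bar>a\<bar>"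
  shows "eventually_gap (\<lambda>s t. of_nat K * \<bar>a' * s ^ i' * t ^ j'\<bar> \<le> \<bar>a * s ^ i * t ^ j\<bar>)"
proof -
  define \<omega> where "\<omega> = \<bar>a\<bar> / \<bar>a'\<bar>"
  have "infinite_elt \<omega>"
    unfolding infinite_elt_def
  proof
    fix k :: nat
    have "of_nat (Suc k) \<le> \<omega>" using big[of "Suc k"] a by (simp add: \<omega>_def pos_le_divide_eq)
    then show "of_nat k < \<omega>" using less_le_trans[of "of_nat k" "of_nat (Suc k)" \<omega>] by simp
  qed
  \<comment> \<open>On a region bounded by \<open>c\<close>, the monomial in \<open>i'\<close> and
    \<open>j'\<close> is at most \<open>c ^ (i' + j')\<close>, so this \<open>c\<close> keeps it
    below the infinite ratio of the coefficients, with the factor \<open>K\<close> to spare.\<close>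
  then obtain c where c: "infinite_elt c" "c ^ (i' + j') \<le> \<omega> / of_nat (Suc K)"
    using infinite_elt_root[OF rc infinite_elt_divide_of_nat] by metis
  have "of_nat K * \<bar>a' * s ^ i' * t ^ j'\<bar> \<le> \<bar>a * s ^ i * t ^ j\<bar>" if "gap_region 0 0 c s t" for s t
  proof -
    have st: "1 \<le> s" "s \<le> c" "1 \<le> t" "t \<le> c"
      using that gap_region_ge_1[OF that] by (auto simp: gap_region_def)
    have "s ^ i' * t ^ j' \<le> \<omega> / of_nat (Suc K)"
      using power_le_of_le[of s c t i' j'] st c(2) by simp
    then have "of_nat (Suc K) * (s ^ i' * t ^ j') \<le> \<omega>"
      by (simp add: pos_le_divide_eq mult.commute del: of_nat_Suc)
    moreover have "of_nat K * (s ^ i' * t ^ j') \<le> of_nat (Suc K) * (s ^ i' * t ^ j')"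
      using st by (intro mult_right_mono) auto
    ultimately have "of_nat K * (s ^ i' * t ^ j') \<le> \<omega>" by (rule order.trans[rotated])
    then have "of_nat K * (s ^ i' * t ^ j') * \<bar>a'\<bar> \<le> \<bar>a\<bar>"
      using a by (simp add: \<omega>_def pos_le_divide_eq)
    also have "\<bar>a\<bar> * 1 \<le> \<bar>a\<bar> * (s ^ i * t ^ j)"
      using st mult_mono[of 1 "s ^ i" 1 "t ^ j"] by (intro mult_left_mono) auto
    finally have "of_nat K * (s ^ i' * t ^ j') * \<bar>a'\<bar> \<le> \<bar>a\<bar> * (s ^ i * t ^ j)" by simp
    then show ?thesis using st by (simp add: abs_mult mult_ac)
  qed
  then show ?thesis using c(1) unfolding eventually_gap_def by blast
qed

lemma gap_dominates_monomial:
  fixes a a' :: "'a::linordered_field"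
  assumes na: "non_archimedean TYPE('a)" and big: "\<bar>a'\<bar> \<le> of_nat n * \<bar>a\<bar>"
    and lex: "j' < j \<or> j' = j \<and> i' < i"
  shows "eventually_gap (\<lambda>s t. of_nat K * \<bar>a' * s ^ i' * t ^ j'\<bar> \<le> \<bar>a * s ^ i * t ^ j\<bar>)"
proof -
  obtain c :: 'a where c: "infinite_elt c"
    using na unfolding non_archimedean_def infinite_elt_def by blast
  \<comment> \<open>\<open>s ^ Suc i' \<le> t\<close> lets one more factor \<open>t\<close> outweigh
    \<open>s ^ i'\<close> with a factor \<open>s\<close> left over. That factor is at least
    \<open>K * n\<close> and absorbs the constants.\<close>
  have "of_nat K * \<bar>a' * s ^ i' * t ^ j'\<bar> \<le> \<bar>a * s ^ i * t ^ j\<bar>" if g: "gap_region (K * n) (Suc i') c s t" for s t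
  proof -
    have st: "1 \<le> s" "1 \<le> t" "of_nat (K * n) \<le> s" "s ^ Suc i' \<le> t"
      using g gap_region_ge_1[OF g] by (auto simp: gap_region_def)
    have key: "s * (s ^ i' * t ^ j') \<le> s ^ i * t ^ j"
    proof (cases "j' < j")
      case True
      have "s * (s ^ i' * t ^ j') = s ^ Suc i' * t ^ j'" by simp
      also have "\<dots> \<le> t * t ^ j'" using st by (intro mult_right_mono) auto
      also have "\<dots> = t ^ Suc j'" by simp
      also have "\<dots> \<le> t ^ j" using True st by (intro power_increasing) auto
      also have "1 * t ^ j \<le> s ^ i * t ^ j" using st by (intro mult_right_mono) auto
      finally show ?thesis by simp
    next
      case False
      then have "j' = j" "Suc i' \<le> i" using lex by auto
      then have "s ^ Suc i' * t ^ j' \<le> s ^ i * t ^ j"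
        using st by (intro mult_mono power_increasing) auto
      then show ?thesis by (simp add: mult.assoc)
    qed
    have "of_nat K * \<bar>a'\<bar> \<le> of_nat (K * n) * \<bar>a\<bar>"
      using mult_left_mono[OF big, of "of_nat K"] by (simp add: mult.assoc)
    also have "\<dots> \<le> s * \<bar>a\<bar>" using st by (intro mult_right_mono) auto
    finally have "of_nat K * \<bar>a'\<bar> * (s ^ i' * t ^ j') \<le> s * \<bar>a\<bar> * (s ^ i' * t ^ j')"
      using st by (intro mult_right_mono) auto
    also have "\<dots> = \<bar>a\<bar> * (s * (s ^ i' * t ^ j'))" by (simp only: mult_ac)
    also have "\<dots> \<le> \<bar>a\<bar> * (s ^ i * t ^ j)" using key by (intro mult_left_mono) auto
    finally show ?thesis using st by (simp add: abs_mult mult_ac)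
  qed
  then show ?thesis using c unfolding eventually_gap_def by blast
qed

lemma gap_dominates_total:
  fixes a a' :: "'a::linordered_field"
  assumes rc: "real_closed TYPE('a)" and na: "non_archimedean TYPE('a)"
    and "a \<noteq> 0" "a' \<noteq> 0" "(i, j) \<noteq> (i', j')"
  shows "eventually_gap (\<lambda>s t. of_nat K * \<bar>a' * s ^ i' * t ^ j'\<bar> \<le> \<bar>a * s ^ i * t ^ j\<bar>) \<or>
    eventually_gap (\<lambda>s t. of_nat K * \<bar>a * s ^ i * t ^ j\<bar> \<le> \<bar>a' * s ^ i' * t ^ j'\<bar>)"
proof -
  consider "\<forall>n::nat. of_nat n * \<bar>a'\<bar> \<le> \<bar>a\<bar>" | "\<forall>n::nat. of_nat n * \<bar>a\<bar> \<le> \<bar>a'\<bar>"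
    | n n' :: nat where "\<bar>a\<bar> \<le> of_nat n * \<bar>a'\<bar>" "\<bar>a'\<bar> \<le> of_nat n' * \<bar>a\<bar>"
    by (meson linear)
  then show ?thesis
  proof cases
    case 1
    then show ?thesis using gap_dominates_coeff[OF rc assms(4)] by blast
  next
    case 2
    then show ?thesis using gap_dominates_coeff[OF rc assms(3)] by blast
  next
    case 3
    have "(j' < j \<or> j' = j \<and> i' < i) \<or> (j < j' \<or> j = j' \<and> i < i')" using assms(5) by auto
    then show ?thesis using gap_dominates_monomial[OF na] 3 by blast
  qed
qed

lemma gap_dominant_term:
  fixes a :: "nat \<times> nat \<Rightarrow> 'a::linordered_field"
  assumes rc: "real_closed TYPE('a)" and na: "non_archimedean TYPE('a)"
    and "finite I" "I \<noteq> {}" "\<And>x. x \<in> I \<Longrightarrow> a x \<noteq> 0" "1 \<le> K"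
  shows "\<exists>m\<in>I. \<forall>x\<in>I - {m}. eventually_gap (\<lambda>s t. of_nat K * \<bar>a x * s ^ fst x * t ^ snd x\<bar> \<le> \<bar>a m * s ^ fst m * t ^ snd m\<bar>)"
  using assms(3-5)
proof (induction I rule: finite_ne_induct)
  case (singleton x)
  then show ?case by simp
next
  case (insert y I)
  then obtain m where m: "m \<in> I" and dom: "\<And>x. x \<in> I - {m} \<Longrightarrow>
      eventually_gap (\<lambda>s t. of_nat K * \<bar>a x * s ^ fst x * t ^ snd x\<bar> \<le> \<bar>a m * s ^ fst m * t ^ snd m\<bar>)" by blast
  have "y \<noteq> m" using insert m by blast
  then have "(fst m, snd m) \<noteq> (fst y, snd y)" by simp
  then consider
      "eventually_gap (\<lambda>s t. of_nat K * \<bar>a y * s ^ fst y * t ^ snd y\<bar> \<le> \<bar>a m * s ^ fst m * t ^ snd m\<bar>)"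
    | "eventually_gap (\<lambda>s t. of_nat K * \<bar>a m * s ^ fst m * t ^ snd m\<bar> \<le> \<bar>a y * s ^ fst y * t ^ snd y\<bar>)"
    using gap_dominates_total[OF rc na, of "a m" "a y" "fst m" "snd m" "fst y" "snd y" K] insert.prems m by blast
  then show ?case
  proof cases
    case 1
    then show ?thesis using m dom by (intro bexI[of _ m]) auto
  next
    case 2
    have "eventually_gap (\<lambda>s t. of_nat K * \<bar>a x * s ^ fst x * t ^ snd x\<bar> \<le> \<bar>a y * s ^ fst y * t ^ snd y\<bar>)"
      if "x \<in> insert y I - {y}" for x
    proof (cases "x = m")
      case True
      then show ?thesis using 2 by simp
    next
      case False
      then have "x \<in> I - {m}" using that by blast
      from eventually_gap_conj[OF 2 dom[OF this]] show ?thesis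
      proof (rule eventually_gap_mono)
        fix s t :: 'a
        assume *: "of_nat K * \<bar>a m * s ^ fst m * t ^ snd m\<bar> \<le> \<bar>a y * s ^ fst y * t ^ snd y\<bar> \<and>
          of_nat K * \<bar>a x * s ^ fst x * t ^ snd x\<bar> \<le> \<bar>a m * s ^ fst m * t ^ snd m\<bar>"
        have "1 * \<bar>a m * s ^ fst m * t ^ snd m\<bar> \<le> of_nat K * \<bar>a m * s ^ fst m * t ^ snd m\<bar>"
          using \<open>1 \<le> K\<close> by (intro mult_right_mono) auto
        then show "of_nat K * \<bar>a x * s ^ fst x * t ^ snd x\<bar> \<le> \<bar>a y * s ^ fst y * t ^ snd y\<bar>"
          using * by linarith
      qed
    qed
    then show ?thesis by blast
  qed
qed

lemma gap_constant_sign_sum: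
  fixes a :: "nat \<times> nat \<Rightarrow> 'a::linordered_field"
  assumes rc: "real_closed TYPE('a)" and na: "non_archimedean TYPE('a)"
    and "finite I" "\<And>x. x \<in> I \<Longrightarrow> a x \<noteq> 0"
  shows "\<exists>c::'a. eventually_gap (\<lambda>s t. same_sign (\<Sum>x\<in>I. a x * s ^ fst x * t ^ snd x) c)"
proof (cases "I = {}")
  case True
  then show ?thesis using eventually_gap_mono[OF eventually_gap_True[OF na]] by (intro exI[of _ 0]) simp
next
  case False
  \<comment> \<open>With this factor the terms other than the dominant one, fewer than
    \<open>K\<close> of them, cannot cancel it even together.\<close>
  define K where "K = Suc (card I)"
  have "1 \<le> K" by (simp add: K_def)
  from gap_dominant_term[where I = I and a = a and K = K, OF rc na assms(3) False assms(4) this]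
  obtain m where m: "m \<in> I" and dom: "\<And>x. x \<in> I - {m} \<Longrightarrow>
      eventually_gap (\<lambda>s t. of_nat K * \<bar>a x * s ^ fst x * t ^ snd x\<bar> \<le> \<bar>a m * s ^ fst m * t ^ snd m\<bar>)"
    by blast
  have "eventually_gap (\<lambda>s t. \<forall>x\<in>I - {m}. of_nat K * \<bar>a x * s ^ fst x * t ^ snd x\<bar> \<le> \<bar>a m * s ^ fst m * t ^ snd m\<bar>)"
    using assms(3) dom by (intro eventually_gap_ball[OF na]) auto
  then have "eventually_gap (\<lambda>s t. same_sign (\<Sum>x\<in>I. a x * s ^ fst x * t ^ snd x) (a m))"
  proof (rule eventually_gap_mono)
    fix s t :: 'a
    assume st: "1 \<le> s" "1 \<le> t"
      and le: "\<forall>x\<in>I - {m}. of_nat K * \<bar>a x * s ^ fst x * t ^ snd x\<bar> \<le> \<bar>a m * s ^ fst m * t ^ snd m\<bar>"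
    define v where "v x = a x * s ^ fst x * t ^ snd x" for x
    define p where "p = s ^ fst m * t ^ snd m"
    have p: "0 < p" "v m = a m * p" using st by (auto simp: p_def v_def mult.assoc)
    have nz: "a m \<noteq> 0" using m assms(4) by blast
    define S where "S = (\<Sum>x\<in>I - {m}. v x)"
    have "of_nat K * \<bar>S\<bar> \<le> of_nat K * (\<Sum>x\<in>I - {m}. \<bar>v x\<bar>)"
      unfolding S_def by (intro mult_left_mono sum_abs) auto
    also have "\<dots> = (\<Sum>x\<in>I - {m}. of_nat K * \<bar>v x\<bar>)" by (rule sum_distrib_left)
    also have "\<dots> \<le> (\<Sum>x\<in>I - {m}. \<bar>v m\<bar>)" using le by (intro sum_mono) (simp add: v_def)
    also have "\<dots> \<le> of_nat (card I) * \<bar>v m\<bar>"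
      using assms(3) by (simp add: card_Diff_subset_Int) (intro mult_right_mono; simp)
    also have "\<dots> < of_nat K * \<bar>v m\<bar>"
      using nz p by (intro mult_strict_right_mono) (auto simp: K_def)
    finally have small: "\<bar>S\<bar> < \<bar>v m\<bar>" by (simp add: K_def del: of_nat_Suc)
    have "(\<Sum>x\<in>I. a x * s ^ fst x * t ^ snd x) = v m + S"
      unfolding S_def v_def using sum.remove[OF assms(3) m] by blast
    moreover have "same_sign (v m + S) (v m)"
      using small unfolding same_sign_def by (auto simp: abs_if split: if_splits)
    moreover have "same_sign (v m) (a m)"
      using p by (simp add: same_sign_def zero_less_mult_iff mult_less_0_iff)
    ultimately show "same_sign (\<Sum>x\<in>I. a x * s ^ fst x * t ^ snd x) (a m)"
      using same_sign_trans by simp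
  qed
  then show ?thesis by blast
qed

text \<open>The outer variable is \<open>t\<close> and the inner one \<open>s\<close>.\<close>

definition eval2 :: "'a::comm_ring_1 \<Rightarrow> 'a \<Rightarrow> 'a poly poly \<Rightarrow> 'a" where
  "eval2 s t e = poly (poly e [:t:]) s"

lemma is_ring_hom_eval2: "is_ring_hom (eval2 s t)"
  by (simp add: is_ring_hom_def eval2_def)

lemma gap_constant_sign:
  fixes e :: "'a::linordered_field poly poly"
  assumes rc: "real_closed TYPE('a)" and na: "non_archimedean TYPE('a)"
  shows "\<exists>c::'a. eventually_gap (\<lambda>s t. same_sign (eval2 s t e) c)"
proof -
  define A where "A = (\<lambda>(j, i). (i, j)) ` (SIGMA j:{..degree e}. {..degree (coeff e j)})"
  define a where "a = (\<lambda>x. coeff (coeff e (snd x)) (fst x))"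
  define I where "I = {x \<in> A. a x \<noteq> 0}"
  have fin: "finite A" by (auto simp: A_def)
  have eq: "eval2 s t e = (\<Sum>x\<in>I. a x * s ^ fst x * t ^ snd x)" for s t
  proof -
    have "eval2 s t e = (\<Sum>j\<le>degree e. poly (coeff e j) s * t ^ j)"
      by (simp add: eval2_def poly_altdef[of e] poly_sum)
    also have "\<dots> = (\<Sum>j\<le>degree e. \<Sum>i\<le>degree (coeff e j). coeff (coeff e j) i * s ^ i * t ^ j)"
      by (simp add: poly_altdef sum_distrib_right)
    also have "\<dots> = (\<Sum>(j, i)\<in>(SIGMA j:{..degree e}. {..degree (coeff e j)}). coeff (coeff e j) i * s ^ i * t ^ j)"
      by (rule sum.Sigma) auto
    also have "\<dots> = (\<Sum>x\<in>A. a x * s ^ fst x * t ^ snd x)"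
      unfolding A_def by (subst sum.reindex) (auto simp: inj_on_def a_def case_prod_unfold)
    also have "\<dots> = (\<Sum>x\<in>I. a x * s ^ fst x * t ^ snd x)"
      unfolding I_def using fin by (intro sum.mono_neutral_right) auto
    finally show ?thesis .
  qed
  show ?thesis
    unfolding eq by (rule gap_constant_sign_sum[OF rc na]) (use fin in \<open>auto simp: I_def\<close>)
qed

text \<open>Quantifier elimination with both fields equal and the parameters being polynomials in
  \<open>s\<close> and \<open>t\<close>. Each of the finitely many elements of \<open>E\<close> has
  constant sign on a region, so all pairs of a common region allow the same sign conditions.\<close>

lemma gap_transfer:
  fixes P :: "('a::linordered_field poly poly, 'n::{finite,linorder}) mpoly set"
  assumes rc: "real_closed TYPE('a)" and na: "non_archimedean TYPE('a)" and "finite P"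
  obtains N k c where "infinite_elt c"
    "\<And>s t s' t' y. gap_region N k c s t \<Longrightarrow> gap_region N k c s' t' \<Longrightarrow>
      \<exists>x. \<forall>p\<in>P. same_sign (eval_hom (eval2 s' t') x p) (eval_hom (eval2 s t) y p)"
proof -
  note ivp = real_closed_imp_poly_ivp[OF rc]
  obtain E :: "'a poly poly set" where finE: "finite E" and E: "\<And>(\<iota> :: 'a poly poly \<Rightarrow> 'a) (\<kappa> :: 'a poly poly \<Rightarrow> 'a) y.
      is_ring_hom \<iota> \<Longrightarrow> is_ring_hom \<kappa> \<Longrightarrow> (\<And>e. e \<in> E \<Longrightarrow> same_sign (\<iota> e) (\<kappa> e)) \<Longrightarrow>
      \<exists>x. \<forall>p\<in>P. same_sign (eval_hom \<iota> x p) (eval_hom \<kappa> y p)"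
    by (rule quantifier_elimination[OF ivp ivp assms(3)]) blast
  have "\<forall>e::'a poly poly. \<exists>c::'a. eventually_gap (\<lambda>s t. same_sign (eval2 s t e) c)"
    using gap_constant_sign[OF rc na] by blast
  then obtain \<sigma> :: "'a poly poly \<Rightarrow> 'a" where \<sigma>: "\<And>e. eventually_gap (\<lambda>s t. same_sign (eval2 s t e) (\<sigma> e))"
    by metis
  have "eventually_gap (\<lambda>s t. \<forall>e\<in>E. same_sign (eval2 s t e) (\<sigma> e))"
    using finE \<sigma> by (intro eventually_gap_ball[OF na]) auto
  then obtain N k c where c: "infinite_elt c"
    and sgn: "\<And>s t e. gap_region N k c s t \<Longrightarrow> e \<in> E \<Longrightarrow> same_sign (eval2 s t e) (\<sigma> e)"
    unfolding eventually_gap_def by blast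
  show thesis
  proof (rule that[OF c])
    fix s t s' t' y assume g: "gap_region N k c s t" "gap_region N k c s' t'"
    show "\<exists>x. \<forall>p\<in>P. same_sign (eval_hom (eval2 s' t') x p) (eval_hom (eval2 s t) y p)"
      by (rule E[OF is_ring_hom_eval2 is_ring_hom_eval2])
        (rule same_sign_trans[OF sgn[OF g(2)] same_sign_sym[OF sgn[OF g(1)]]])
  qed
qed

definition lift_mpoly :: "('a::comm_ring_1, 'n) mpoly \<Rightarrow> ('a poly poly, 'n) mpoly" where
  "lift_mpoly p = Poly_Mapping.map (\<lambda>c. [:[:c:]:]) p"

lemma eval_hom_lift_mpoly: "eval_hom (eval2 s t) x (lift_mpoly p) = eval_hom (\<lambda>c. c) x p"
proof -
  have lk: "Poly_Mapping.lookup (lift_mpoly p) e = [:[:Poly_Mapping.lookup p e:]:]" for e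
    unfolding lift_mpoly_def by (simp add: map.rep_eq when_def)
  then have "Poly_Mapping.keys (lift_mpoly p) = Poly_Mapping.keys p"
    by (auto simp: in_keys_iff)
  then show ?thesis by (simp add: eval_hom_def lk eval2_def)
qed

text \<open>A point violating the bound \<open>s ^ k\<close> with \<open>ga / d \<le> s\<close> can
  be transferred from the parameters \<open>(s, s ^ k)\<close> to \<open>(M, c)\<close>. There it
  becomes a point where \<open>ga / d\<close> is finite and \<open>ha / d\<close> infinite, against
  \<open>fin\<close>.\<close>

theorem polynomial_bound_up_to_infinite:
  fixes d ga ha :: "('a::linordered_field, 'n::{finite,linorder}) mpoly"
  assumes rc: "real_closed TYPE('a)" and na: "non_archimedean TYPE('a)"
    and g1: "\<And>b. (\<And>p. p \<in> set ps \<Longrightarrow> 0 < eval_mpoly p b) \<Longrightarrow> eval_mpoly d b \<noteq> 0 \<Longrightarrow>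
      1 \<le> eval_mpoly ga b / eval_mpoly d b"
    and fin: "\<And>b. (\<And>p. p \<in> set ps \<Longrightarrow> 0 < eval_mpoly p b) \<Longrightarrow> eval_mpoly d b \<noteq> 0 \<Longrightarrow>
      eval_mpoly ga b / eval_mpoly d b \<in> finite_part \<Longrightarrow> eval_mpoly ha b / eval_mpoly d b \<in> finite_part"
  obtains N k :: nat and c where "0 < k" "infinite_elt c"
    "\<And>b. (\<And>p. p \<in> set ps \<Longrightarrow> 0 < eval_mpoly p b) \<Longrightarrow> eval_mpoly d b \<noteq> 0 \<Longrightarrow>
      eval_mpoly ga b / eval_mpoly d b \<le> c \<Longrightarrow>
      eval_mpoly ha b / eval_mpoly d b \<le> of_nat N * (eval_mpoly ga b / eval_mpoly d b) ^ k"
proof -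
  define S :: "('a poly poly, 'n) mpoly" where "S = Poly_Mapping.single 0 [:[:0, 1:]:]"
  define T :: "('a poly poly, 'n) mpoly" where "T = Poly_Mapping.single 0 [:0, 1:]"
  \<comment> \<open>Where \<open>d\<close> does not vanish, \<open>Ps \<ge> 0\<close> means
    \<open>ga / d \<le> s\<close> and \<open>Pt \<ge> 0\<close> means \<open>ha / d \<ge> t\<close>;
    the additional factor \<open>d\<close> makes this independent of the sign of
    \<open>d\<close>.\<close>
  define Ps where "Ps = (S * lift_mpoly d - lift_mpoly ga) * lift_mpoly d"
  define Pt where "Pt = (lift_mpoly ha - T * lift_mpoly d) * lift_mpoly d"
  define P where "P = insert (lift_mpoly d) (insert Ps (insert Pt (lift_mpoly ` set ps)))"
  have "finite P" by (simp add: P_def)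
  then obtain N k c where c: "infinite_elt c" and trans:
    "\<And>s t s' t' y. gap_region N k c s t \<Longrightarrow> gap_region N k c s' t' \<Longrightarrow>
      \<exists>x. \<forall>p\<in>P. same_sign (eval_hom (eval2 s' t') x p) (eval_hom (eval2 s t) y p)"
    by (rule gap_transfer[OF rc na]) blast
  have evS: "eval_hom (eval2 s t) x S = s" "eval_hom (eval2 s t) x T = t" for s t and x :: "'n \<Rightarrow> 'a"
    by (simp_all add: S_def T_def eval_hom_single[OF is_ring_hom_eval2] eval2_def)
  have vec: "eval_hom (eval2 s t) x (lift_mpoly p) = eval_mpoly p (vec_lambda x)"
    for s t and x :: "'n \<Rightarrow> 'a" and p :: "('a, 'n) mpoly"
  proof -
    have "($) (vec_lambda x) = x" by (simp add: fun_eq_iff)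
    then show ?thesis by (simp add: eval_hom_lift_mpoly eval_mpoly_eq_eval_hom)
  qed
  have evP: "eval_hom (eval2 s t) x Ps = (s * eval_mpoly d (vec_lambda x) - eval_mpoly ga (vec_lambda x)) * eval_mpoly d (vec_lambda x)"
    "eval_hom (eval2 s t) x Pt = (eval_mpoly ha (vec_lambda x) - t * eval_mpoly d (vec_lambda x)) * eval_mpoly d (vec_lambda x)"
    for s t and x :: "'n \<Rightarrow> 'a"
    by (simp_all add: Ps_def Pt_def is_ring_homD[OF is_ring_hom_eval_hom[OF is_ring_hom_eval2]] evS vec)
  have le_iff: "u / v \<le> s \<longleftrightarrow> \<not> (s * v - u) * v < 0" "s \<le> u / v \<longleftrightarrow> \<not> (u - s * v) * v < 0" if "v \<noteq> 0" for u v s :: 'a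
  proof -
    have v: "0 < v * v" using that by (simp add: zero_less_mult_iff linorder_neq_iff disj_commute)
    have 1: "(s * v - u) * v = (s - u / v) * (v * v)" "(u - s * v) * v = (u / v - s) * (v * v)"
      using that by (simp_all add: field_simps)
    show "u / v \<le> s \<longleftrightarrow> \<not> (s * v - u) * v < 0" "s \<le> u / v \<longleftrightarrow> \<not> (u - s * v) * v < 0"
      unfolding 1 using v by (simp_all add: mult_less_0_iff not_less)
  qed
  \<comment> \<open>The region requires \<open>s\<close> to be at least \<open>N\<close> and at
    least 1.\<close>
  define M where "M = max N 1"
  have M: "N \<le> M" "1 \<le> M" by (simp_all add: M_def)
  \<comment> \<open>This power keeps both \<open>s\<close> and \<open>s ^ k\<close> below
    \<open>c\<close> for all \<open>s \<le> D\<close>.\<close>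
  obtain D where D: "infinite_elt D" "D ^ Suc k \<le> c" by (rule infinite_elt_root[OF rc c])
  have D1: "1 \<le> D" using infinite_elt_ge_1[OF D(1)] .
  have Dc: "D \<le> c" "D ^ k \<le> c"
  proof -
    have "D ^ 1 \<le> D ^ Suc k" "D ^ k \<le> D ^ Suc k" using D1 by (intro power_increasing; simp)+
    then show "D \<le> c" "D ^ k \<le> c" using order.trans[OF _ D(2)] by (simp_all only: power_one_right)
  qed
  have base: "gap_region N k c (of_nat M) c"
  proof -
    have "of_nat (M ^ k) \<le> c" "of_nat M \<le> c" using c unfolding infinite_elt_def by (meson order.strict_implies_order)+
    then show ?thesis using M by (simp add: gap_region_def)
  qed
  show thesis
  proof (rule that[of "Suc k" D "M ^ k"])
    show "0 < Suc k" "infinite_elt D" using D by simp_all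
    fix b assume ps: "\<And>p. p \<in> set ps \<Longrightarrow> 0 < eval_mpoly p b" and d: "eval_mpoly d b \<noteq> 0"
      and leD: "eval_mpoly ga b / eval_mpoly d b \<le> D"
    define g where "g = eval_mpoly ga b / eval_mpoly d b"
    \<comment> \<open>The value \<open>g\<close> may be too small for the region, so it is raised to
      \<open>M\<close>; the final estimate pays for this with the factor
      \<open>M ^ k\<close>.\<close>
    define s where "s = max g (of_nat M)"
    have g: "1 \<le> g" "g \<le> D" using g1[OF ps d] leD by (simp_all add: g_def)
    have "of_nat M \<le> D" using D(1) unfolding infinite_elt_def by (meson order.strict_implies_order)
    then have s: "1 \<le> s" "of_nat M \<le> s" "s \<le> D" "g \<le> s" using g by (auto simp: s_def)
    have "s ^ k \<le> D ^ k" using s by (intro power_mono) auto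
    then have "s ^ k \<le> c" using Dc by simp
    moreover have "of_nat N \<le> (of_nat M :: 'a)" using M by simp
    then have "of_nat N \<le> s" "s \<le> c" using s Dc by (meson order.trans)+
    ultimately have reg: "gap_region N k c s (s ^ k)" using s by (simp add: gap_region_def)
    have lt: "eval_mpoly ha b / eval_mpoly d b < s ^ k"
    proof (rule ccontr)
      assume "\<not> ?thesis"
      then have ge: "s ^ k \<le> eval_mpoly ha b / eval_mpoly d b" by simp
      obtain x where x: "\<forall>p\<in>P. same_sign (eval_hom (eval2 (of_nat M) c) x p) (eval_hom (eval2 s (s ^ k)) (($) b) p)"
        using trans[OF reg base] by blast
      define b' where "b' = vec_lambda x"
      have bb: "vec_lambda (($) b) = b" by simp
      have ss: "same_sign (eval_mpoly p b') (eval_mpoly p b)" if "lift_mpoly p \<in> P" for p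
        using x that unfolding b'_def by (metis bb vec)
      have d': "eval_mpoly d b' \<noteq> 0"
        using ss[of d] d same_sign_zeroD by (auto simp: P_def)
      have ps': "0 < eval_mpoly p b'" if "p \<in> set ps" for p
        using ss[of p] ps[OF that] that by (simp add: P_def same_sign_def)
      have "same_sign (eval_hom (eval2 (of_nat M) c) x Ps) (eval_hom (eval2 s (s ^ k)) (($) b) Ps)"
        "same_sign (eval_hom (eval2 (of_nat M) c) x Pt) (eval_hom (eval2 s (s ^ k)) (($) b) Pt)"
        using x by (simp_all add: P_def)
      moreover have "\<not> eval_hom (eval2 s (s ^ k)) (($) b) Ps < 0" "\<not> eval_hom (eval2 s (s ^ k)) (($) b) Pt < 0"
        unfolding evP bb using le_iff(1)[OF d] le_iff(2)[OF d] s(4) ge by (simp_all add: g_def)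
      ultimately have "\<not> eval_hom (eval2 (of_nat M) c) x Ps < 0" "\<not> eval_hom (eval2 (of_nat M) c) x Pt < 0"
        by (simp_all add: same_sign_def)
      then have *: "eval_mpoly ga b' / eval_mpoly d b' \<le> of_nat M" "c \<le> eval_mpoly ha b' / eval_mpoly d b'"
        unfolding evP b'_def[symmetric] le_iff(1)[OF d'] le_iff(2)[OF d'] by simp_all
      have "\<bar>eval_mpoly ga b' / eval_mpoly d b'\<bar> \<le> of_nat M"
        using *(1) g1[OF ps' d'] by (simp add: abs_le_iff)
      then have "eval_mpoly ga b' / eval_mpoly d b' \<in> finite_part" unfolding finite_part_iff by blast
      then have "eval_mpoly ha b' / eval_mpoly d b' \<in> finite_part" using fin[OF ps' d'] by blast
      then show False using infinite_elt_notin_finite_part[OF c *(2)] by blast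
    qed
    have "s \<le> of_nat M * g"
    proof -
      have "1 * g \<le> of_nat M * g" "of_nat M * 1 \<le> of_nat M * g"
        using g M by (intro mult_right_mono mult_left_mono; simp)+
      then show ?thesis by (simp add: s_def)
    qed
    then have "s ^ k \<le> (of_nat M * g) ^ k" using s by (intro power_mono) auto
    also have "\<dots> = of_nat (M ^ k) * g ^ k" by (simp add: power_mult_distrib)
    \<comment> \<open>The region may come with \<open>k = 0\<close>, while a positive exponent is
      promised; since \<open>g \<ge> 1\<close>, one more factor does no harm.\<close>
    also have "\<dots> \<le> of_nat (M ^ k) * g ^ Suc k"
      using g by (intro mult_left_mono power_increasing) auto
    finally show "eval_mpoly ha b / eval_mpoly d b \<le> of_nat (M ^ k) * (eval_mpoly ga b / eval_mpoly d b) ^ Suc k"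
      using lt by (simp add: g_def)
  qed
qed

section \<open>Finitary functions\<close>

lemma finite_part_closed:
  assumes "x \<in> finite_part" "y \<in> finite_part"
  shows "x + y \<in> finite_part" "x * y \<in> finite_part" "- x \<in> finite_part"
proof -
  obtain k l :: nat where kl: "\<bar>x\<bar> \<le> of_nat k" "\<bar>y\<bar> \<le> of_nat l"
    using assms by (auto simp: finite_part_iff)
  have "\<bar>x + y\<bar> \<le> of_nat (k + l)" using kl abs_triangle_ineq[of x y] by simp
  then show "x + y \<in> finite_part" unfolding finite_part_iff by blast
  have "\<bar>x * y\<bar> \<le> of_nat (k * l)" unfolding abs_mult of_nat_mult using kl by (intro mult_mono) auto
  then show "x * y \<in> finite_part" unfolding finite_part_iff by blast
  show "- x \<in> finite_part" using kl unfolding finite_part_iff by auto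
qed

lemma finite_part_abs_le: "y \<in> finite_part \<Longrightarrow> \<bar>x\<bar> \<le> \<bar>y\<bar> \<Longrightarrow> x \<in> finite_part"
  unfolding finite_part_iff by (meson order.trans)

lemma finite_part_of_nat: "of_nat n \<in> finite_part"
  unfolding finite_part_iff by (intro exI[of _ n]) simp

lemma finite_part_1: "1 \<in> finite_part"
  using finite_part_of_nat[of 1] by simp

lemma finite_part_0: "0 \<in> finite_part"
  using finite_part_of_nat[of 0] by simp

lemma finite_part_sum: "(\<And>i. i \<in> I \<Longrightarrow> f i \<in> finite_part) \<Longrightarrow> sum f I \<in> finite_part"
  by (induction I rule: infinite_finite_induct) (auto simp: finite_part_0 finite_part_closed)

lemma finite_part_square_le:
  assumes "y \<in> finite_part" "x * x \<le> y"
  shows "x \<in> finite_part"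
proof -
  have "\<bar>x\<bar> \<le> 1 + \<bar>x\<bar> * \<bar>x\<bar>"
  proof (cases "1 \<le> \<bar>x\<bar>")
    case True
    then show ?thesis using mult_left_mono[of 1 "\<bar>x\<bar>" "\<bar>x\<bar>"] by auto
  next
    case False
    moreover have "0 \<le> \<bar>x\<bar> * \<bar>x\<bar>" by simp
    ultimately show ?thesis by linarith
  qed
  then have "\<bar>x\<bar> \<le> 1 + y" using assms(2) by simp
  then have "\<bar>x\<bar> \<le> \<bar>1 + y\<bar>" by simp
  then show ?thesis using finite_part_abs_le finite_part_closed(1)[OF finite_part_1 assms(1)] by blast
qed

lemma max_ideal_mult_small:
  assumes "m \<in> finite_part_max_ideal" "a \<in> finite_part"
  shows "\<bar>m * a\<bar> * 2 < 1"
proof -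
  obtain k :: nat where k: "\<bar>a\<bar> \<le> of_nat k" using assms by (auto simp: finite_part_iff)
  have "\<bar>m * a\<bar> * 2 \<le> \<bar>m\<bar> * of_nat k * 2"
    unfolding abs_mult using k by (intro mult_right_mono mult_left_mono) auto
  also have "\<dots> = of_nat (k * 2) * \<bar>m\<bar>" by simp
  also have "\<dots> < 1" using assms(1) unfolding finite_part_max_ideal_iff by blast
  finally show ?thesis .
qed

text \<open>Boxes with radius in the field itself. They are a base of the product topology
  (\<open>open_box\<close>, \<open>open_imp_near\<close>), and generic points can be found in
  them.\<close>

definition near :: "('a::linordered_field, 'n::finite) vec \<Rightarrow> (('a, 'n) vec \<Rightarrow> bool) \<Rightarrow> bool" where
  "near b P \<longleftrightarrow> (\<exists>\<epsilon>>0. \<forall>x. (\<forall>i. \<bar>x $ i - b $ i\<bar> < \<epsilon>) \<longrightarrow> P x)"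

lemma near_conj:
  assumes "near b P" "near b Q"
  shows "near b (\<lambda>x. P x \<and> Q x)"
proof -
  obtain \<epsilon> \<delta> where "\<epsilon> > 0" "\<delta> > 0" "\<forall>x. (\<forall>i. \<bar>x $ i - b $ i\<bar> < \<epsilon>) \<longrightarrow> P x"
      "\<forall>x. (\<forall>i. \<bar>x $ i - b $ i\<bar> < \<delta>) \<longrightarrow> Q x"
    using assms unfolding near_def by blast
  then show ?thesis unfolding near_def by (intro exI[of _ "min \<epsilon> \<delta>"]) simp
qed

lemma near_mono: "near b P \<Longrightarrow> (\<And>x. P x \<Longrightarrow> Q x) \<Longrightarrow> near b Q"
  unfolding near_def by blast

lemma near_True: "(\<And>x. P x) \<Longrightarrow> near b P"
  unfolding near_def using zero_less_one by blast

lemma near_ball: "finite A \<Longrightarrow> (\<And>a. a \<in> A \<Longrightarrow> near b (P a)) \<Longrightarrow> near b (\<lambda>x. \<forall>a\<in>A. P a x)"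
  by (induction A rule: finite_induct) (auto intro: near_True near_conj)

lemma near_generically:
  fixes b :: "('a::linordered_field, 'n::{finite,linorder}) vec"
  assumes "near b P" "generically Q"
  obtains x where "P x" "Q x"
proof -
  obtain \<epsilon> where e: "\<epsilon> > 0" "\<And>x. (\<forall>i. \<bar>x $ i - b $ i\<bar> < \<epsilon>) \<Longrightarrow> P x"
    using assms(1) unfolding near_def by blast
  obtain x where "\<And>i. \<bar>x $ i - b $ i\<bar> < \<epsilon>" "Q x"
    using generically_box[OF assms(2) e(1), of b] by blast
  then show thesis using that e(2) by blast
qed

lemma open_box:
  fixes b :: "('a::{linordered_field,linorder_topology}, 'n::finite) vec"
  shows "open {x. \<forall>i. \<bar>x $ i - b $ i\<bar> < \<epsilon>}"
proof -
  have "{x. \<forall>i. \<bar>x $ i - b $ i\<bar> < \<epsilon>} = {x. \<forall>i. x $ i \<in> {b $ i - \<epsilon> <..< b $ i + \<epsilon>}}"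
    by (auto simp: abs_less_iff algebra_simps)
  moreover have "open {x. \<forall>i. x $ i \<in> {b $ i - \<epsilon> <..< b $ i + \<epsilon>}}"
    by (rule open_vector_box) simp
  ultimately show ?thesis by (simp only:)
qed

lemma open_imp_near:
  fixes b :: "('a::{linordered_field,linorder_topology}, 'n::finite) vec"
  assumes "open U" "b \<in> U"
  shows "near b (\<lambda>x. x \<in> U)"
proof -
  obtain A where A: "\<And>i. open (A i)" "\<And>i. b $ i \<in> A i" "\<And>y. (\<forall>i. y $ i \<in> A i) \<Longrightarrow> y \<in> U"
    using assms unfolding open_vec_def by metis
  have "\<exists>e>0. \<forall>y. \<bar>y - b $ i\<bar> < e \<longrightarrow> y \<in> A i" for i
  proof -
    obtain u where u: "b $ i < u" "{b $ i ..< u} \<subseteq> A i"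
      using open_right[OF A(1) A(2), of i "b $ i + 1"] by auto
    obtain l where l: "l < b $ i" "{l <.. b $ i} \<subseteq> A i"
      using open_left[OF A(1) A(2), of "b $ i - 1" i] by auto
    have "y \<in> A i" if "\<bar>y - b $ i\<bar> < min (u - b $ i) (b $ i - l)" for y
    proof (cases "b $ i \<le> y")
      case True
      then show ?thesis using u that by (intro subsetD[OF u(2)]) auto
    next
      case False
      then show ?thesis using l that by (intro subsetD[OF l(2)]) auto
    qed
    then show ?thesis using u(1) l(1) by (intro exI[of _ "min (u - b $ i) (b $ i - l)"]) simp
  qed
  then obtain e where e: "\<And>i. e i > 0" "\<And>i y. \<bar>y - b $ i\<bar> < e i \<Longrightarrow> y \<in> A i" by metis
  define \<epsilon> where "\<epsilon> = Min (range e)"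
  have "\<epsilon> > 0" using e(1) by (simp add: \<epsilon>_def)
  moreover have "x \<in> U" if "\<forall>i. \<bar>x $ i - b $ i\<bar> < \<epsilon>" for x
  proof (rule A(3), rule allI, rule e(2))
    fix i
    have "\<epsilon> \<le> e i" by (simp add: \<epsilon>_def)
    then show "\<bar>x $ i - b $ i\<bar> < e i" using that by (meson order.strict_trans2)
  qed
  ultimately show ?thesis unfolding near_def by blast
qed

section \<open>Continuity of polynomials and rational functions\<close>

definition cont_at :: "(('a::linordered_field, 'n::finite) vec \<Rightarrow> 'a) \<Rightarrow> ('a, 'n) vec \<Rightarrow> bool" where
  "cont_at f b \<longleftrightarrow> (\<forall>\<eta>>0. near b (\<lambda>x. \<bar>f x - f b\<bar> < \<eta>))"

lemma cont_at_const: "cont_at (\<lambda>x. c) b"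
  by (auto simp: cont_at_def intro: near_True)

lemma cont_at_component: "cont_at (\<lambda>x. x $ i) b"
  unfolding cont_at_def near_def by blast

lemma cont_at_add:
  assumes "cont_at f b" "cont_at g b"
  shows "cont_at (\<lambda>x. f x + g x) b"
  unfolding cont_at_def
proof (intro allI impI)
  fix \<eta> :: 'a assume "0 < \<eta>"
  then have half: "0 < \<eta> / 2" by simp
  have "near b (\<lambda>x. \<bar>f x - f b\<bar> < \<eta> / 2 \<and> \<bar>g x - g b\<bar> < \<eta> / 2)"
    using assms half unfolding cont_at_def by (intro near_conj) blast+
  then show "near b (\<lambda>x. \<bar>f x + g x - (f b + g b)\<bar> < \<eta>)"
  proof (rule near_mono)
    fix x assume "\<bar>f x - f b\<bar> < \<eta> / 2 \<and> \<bar>g x - g b\<bar> < \<eta> / 2"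
    then have "\<bar>f x - f b\<bar> + \<bar>g x - g b\<bar> < \<eta>" by (simp add: field_simps)
    moreover have "\<bar>f x + g x - (f b + g b)\<bar> \<le> \<bar>f x - f b\<bar> + \<bar>g x - g b\<bar>"
      using abs_triangle_ineq[of "f x - f b" "g x - g b"] by (simp add: algebra_simps)
    ultimately show "\<bar>f x + g x - (f b + g b)\<bar> < \<eta>" by linarith
  qed
qed

lemma cont_at_mult:
  assumes "cont_at f b" "cont_at g b"
  shows "cont_at (\<lambda>x. f x * g x) b"
  unfolding cont_at_def
proof (intro allI impI)
  fix \<eta> :: 'a assume \<eta>: "0 < \<eta>"
  define F where "F = \<bar>f b\<bar> + 1"
  define G where "G = \<bar>g b\<bar> + 1"
  have FG: "0 < F" "0 < G" by (simp_all add: F_def G_def add_nonneg_pos)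
  have "near b (\<lambda>x. \<bar>f x - f b\<bar> < \<eta> / (2 * G) \<and> \<bar>g x - g b\<bar> < \<eta> / (2 * F) \<and> \<bar>g x - g b\<bar> < 1)"
  proof -
    have "0 < \<eta> / (2 * G)" "0 < \<eta> / (2 * F)" using \<eta> FG by simp_all
    then show ?thesis using assms zero_less_one unfolding cont_at_def by (intro near_conj) blast+
  qed
  then show "near b (\<lambda>x. \<bar>f x * g x - f b * g b\<bar> < \<eta>)"
  proof (rule near_mono)
    fix x assume x: "\<bar>f x - f b\<bar> < \<eta> / (2 * G) \<and> \<bar>g x - g b\<bar> < \<eta> / (2 * F) \<and> \<bar>g x - g b\<bar> < 1"
    have "\<bar>g x\<bar> \<le> G" using x abs_triangle_ineq[of "g x - g b" "g b"] by (simp add: G_def)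
    have "f x * g x - f b * g b = (f x - f b) * g x + f b * (g x - g b)" by (simp add: algebra_simps)
    then have "\<bar>f x * g x - f b * g b\<bar> \<le> \<bar>f x - f b\<bar> * \<bar>g x\<bar> + \<bar>f b\<bar> * \<bar>g x - g b\<bar>"
      using abs_triangle_ineq[of "(f x - f b) * g x" "f b * (g x - g b)"] by (simp add: abs_mult)
    also have "\<dots> \<le> \<bar>f x - f b\<bar> * G + F * \<bar>g x - g b\<bar>"
      using \<open>\<bar>g x\<bar> \<le> G\<close> by (intro add_mono mult_left_mono mult_right_mono) (auto simp: F_def)
    also have "\<dots> < \<eta> / (2 * G) * G + F * (\<eta> / (2 * F))"
      using x FG by (intro add_strict_mono mult_strict_right_mono mult_strict_left_mono) auto
    also have "\<dots> = \<eta>" using FG by (simp add: field_simps)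
    finally show "\<bar>f x * g x - f b * g b\<bar> < \<eta>" .
  qed
qed

lemma cont_at_power: "cont_at f b \<Longrightarrow> cont_at (\<lambda>x. f x ^ n) b"
  by (induction n) (auto intro: cont_at_const cont_at_mult)

lemma cont_at_sum: "(\<And>a. a \<in> A \<Longrightarrow> cont_at (f a) b) \<Longrightarrow> cont_at (\<lambda>x. \<Sum>a\<in>A. f a x) b"
  by (induction A rule: infinite_finite_induct) (auto intro: cont_at_const cont_at_add)

lemma cont_at_prod: "(\<And>a. a \<in> A \<Longrightarrow> cont_at (f a) b) \<Longrightarrow> cont_at (\<lambda>x. \<Prod>a\<in>A. f a x) b"
  by (induction A rule: infinite_finite_induct) (auto intro: cont_at_const cont_at_mult)

lemma cont_at_eval_mpoly: "cont_at (\<lambda>x. eval_mpoly p x) b"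
  unfolding eval_mpoly_def
  by (intro cont_at_sum cont_at_mult cont_at_const cont_at_prod cont_at_power cont_at_component)

lemma near_pos:
  assumes "cont_at f b" "0 < f b"
  shows "near b (\<lambda>x. 0 < f x)"
proof -
  have "near b (\<lambda>x. \<bar>f x - f b\<bar> < f b)" using assms unfolding cont_at_def by blast
  then show ?thesis by (rule near_mono) (simp add: abs_less_iff)
qed

lemma near_abs_gt:
  assumes "cont_at f b" "f b \<noteq> 0"
  shows "near b (\<lambda>x. \<bar>f b\<bar> / 2 < \<bar>f x\<bar>)"
proof -
  have "0 < \<bar>f b\<bar> / 2" using assms(2) by simp
  then have "near b (\<lambda>x. \<bar>f x - f b\<bar> < \<bar>f b\<bar> / 2)" using assms(1) unfolding cont_at_def by blast
  then show ?thesis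
  proof (rule near_mono)
    fix x assume "\<bar>f x - f b\<bar> < \<bar>f b\<bar> / 2"
    moreover have "\<bar>f b\<bar> \<le> \<bar>f x\<bar> + \<bar>f x - f b\<bar>" using abs_triangle_ineq[of "f x" "f b - f x"] by (simp add: abs_minus_commute)
    moreover have "\<bar>f b\<bar> = \<bar>f b\<bar> / 2 + \<bar>f b\<bar> / 2" by simp
    ultimately show "\<bar>f b\<bar> / 2 < \<bar>f x\<bar>" by linarith
  qed
qed

lemma cont_at_inverse:
  assumes "cont_at f b" "f b \<noteq> 0"
  shows "cont_at (\<lambda>x. inverse (f x)) b"
  unfolding cont_at_def
proof (intro allI impI)
  fix \<eta> :: 'a assume \<eta>: "0 < \<eta>"
  define B where "B = \<bar>f b\<bar>"
  have B: "0 < B" using assms(2) by (simp add: B_def)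
  have "near b (\<lambda>x. \<bar>f b\<bar> / 2 < \<bar>f x\<bar> \<and> \<bar>f x - f b\<bar> < \<eta> * (B * B / 2))"
  proof (intro near_conj near_abs_gt[OF assms])
    have "0 < \<eta> * (B * B / 2)" using \<eta> B by simp
    then show "near b (\<lambda>x. \<bar>f x - f b\<bar> < \<eta> * (B * B / 2))" using assms(1) unfolding cont_at_def by blast
  qed
  then show "near b (\<lambda>x. \<bar>inverse (f x) - inverse (f b)\<bar> < \<eta>)"
  proof (rule near_mono)
    fix x assume x: "\<bar>f b\<bar> / 2 < \<bar>f x\<bar> \<and> \<bar>f x - f b\<bar> < \<eta> * (B * B / 2)"
    have nz: "f x \<noteq> 0" using x B by (auto simp: B_def)
    have "inverse (f x) - inverse (f b) = (f b - f x) / (f x * f b)"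
      using nz assms(2) by (simp add: field_simps)
    then have eq: "\<bar>inverse (f x) - inverse (f b)\<bar> = \<bar>f x - f b\<bar> / (\<bar>f x\<bar> * B)"
      by (simp add: abs_mult abs_minus_commute B_def)
    have "\<bar>f x - f b\<bar> < \<eta> * (B / 2 * B)" using x by (simp add: mult_ac)
    also have "\<dots> \<le> \<eta> * (\<bar>f x\<bar> * B)" using x \<eta> B by (intro mult_left_mono mult_right_mono) (auto simp: B_def)
    finally show "\<bar>inverse (f x) - inverse (f b)\<bar> < \<eta>"
      unfolding eq using nz B by (simp add: pos_divide_less_eq)
  qed
qed

lemma ratfun_has_value_near:
  fixes f :: "('a::linordered_field, 'n::{finite,linorder}) ratfun"
  assumes "ratfun_has_value f b y" "0 < \<eta>"
  shows "near b (\<lambda>x. \<exists>z. ratfun_has_value f x z \<and> \<bar>z - y\<bar> < \<eta>)"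
proof -
  obtain p q where pq: "f = Fract p q" "eval_mpoly q b \<noteq> 0" "y = eval_mpoly p b / eval_mpoly q b"
    using assms(1) unfolding ratfun_has_value_def by blast
  define F where "F x = eval_mpoly p x * inverse (eval_mpoly q x)" for x
  have "cont_at F b"
    unfolding F_def by (intro cont_at_mult cont_at_inverse cont_at_eval_mpoly pq(2))
  then have "near b (\<lambda>x. \<bar>F x - F b\<bar> < \<eta>)" using assms(2) unfolding cont_at_def by blast
  moreover have "near b (\<lambda>x. \<bar>eval_mpoly q b\<bar> / 2 < \<bar>eval_mpoly q x\<bar>)"
    by (intro near_abs_gt cont_at_eval_mpoly pq(2))
  ultimately have "near b (\<lambda>x. \<bar>F x - F b\<bar> < \<eta> \<and> \<bar>eval_mpoly q b\<bar> / 2 < \<bar>eval_mpoly q x\<bar>)" by (rule near_conj)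
  then show ?thesis
  proof (rule near_mono)
    fix x assume x: "\<bar>F x - F b\<bar> < \<eta> \<and> \<bar>eval_mpoly q b\<bar> / 2 < \<bar>eval_mpoly q x\<bar>"
    then have "eval_mpoly q x \<noteq> 0" using pq(2) by auto
    then have "ratfun_has_value f x (F x)" using ratfun_has_valueI[of q x p] by (simp add: pq(1) F_def divide_inverse)
    moreover have "F b = y" by (simp add: F_def pq(3) divide_inverse)
    ultimately show "\<exists>z. ratfun_has_value f x z \<and> \<bar>z - y\<bar> < \<eta>" using x by auto
  qed
qed

lemma finite_part_near:
  assumes "y \<in> finite_part" "\<bar>z - y\<bar> < 1"
  shows "z \<in> finite_part"
proof -
  have "z - y \<in> finite_part" by (rule finite_part_abs_le[OF finite_part_1]) (use assms in simp)
  then show ?thesis using finite_part_closed(1)[OF _ assms(1)] by fastforce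
qed

text \<open>A value at an exceptional point is, by continuity, within 1 of a value at a nearby
  generic point. If the generic values are finite, so is this one.\<close>

lemma finitary_at_iff_generic:
  fixes b :: "('a::{linordered_field,linorder_topology}, 'n::{finite,linorder}) vec"
  shows "finitary_at f b \<longleftrightarrow>
    (\<exists>q. q \<noteq> 0 \<and> near b (\<lambda>x. eval_mpoly q x \<noteq> 0 \<longrightarrow> (\<exists>y. ratfun_has_value f x y \<and> y \<in> finite_part)))"
proof
  assume "finitary_at f b"
  then obtain U where U: "open U" "b \<in> U" "\<And>x y. x \<in> U \<Longrightarrow> ratfun_has_value f x y \<Longrightarrow> y \<in> finite_part"
    unfolding finitary_at_def by blast
  obtain q where q: "q \<noteq> 0" "\<forall>x. eval_mpoly q x \<noteq> 0 \<longrightarrow> (\<exists>y. ratfun_has_value f x y)"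
    using generically_has_value[of f] unfolding generically_def by blast
  have "near b (\<lambda>x. eval_mpoly q x \<noteq> 0 \<longrightarrow> (\<exists>y. ratfun_has_value f x y \<and> y \<in> finite_part))"
    by (rule near_mono[OF open_imp_near[OF U(1,2)]]) (use q(2) U(3) in blast)
  then show "\<exists>q. q \<noteq> 0 \<and> near b (\<lambda>x. eval_mpoly q x \<noteq> 0 \<longrightarrow> (\<exists>y. ratfun_has_value f x y \<and> y \<in> finite_part))"
    using q(1) by blast
next
  assume "\<exists>q. q \<noteq> 0 \<and> near b (\<lambda>x. eval_mpoly q x \<noteq> 0 \<longrightarrow> (\<exists>y. ratfun_has_value f x y \<and> y \<in> finite_part))"
  then obtain q \<epsilon> where q: "q \<noteq> 0" "0 < \<epsilon>" and fin: "\<And>x. (\<forall>i. \<bar>x $ i - b $ i\<bar> < \<epsilon>) \<Longrightarrow> eval_mpoly q x \<noteq> 0 \<Longrightarrow>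
      \<exists>y. ratfun_has_value f x y \<and> y \<in> finite_part"
    unfolding near_def by blast
  define U where "U = {x. \<forall>i. \<bar>x $ i - b $ i\<bar> < \<epsilon>}"
  have U: "open U" "b \<in> U" using open_box q(2) by (auto simp: U_def)
  have "y \<in> finite_part" if x: "x \<in> U" and y: "ratfun_has_value f x y" for x y
  proof -
    have "near x (\<lambda>x'. x' \<in> U \<and> (\<exists>z. ratfun_has_value f x' z \<and> \<bar>z - y\<bar> < 1))"
      by (intro near_conj open_imp_near U(1) x ratfun_has_value_near y zero_less_one)
    then obtain x' where x': "x' \<in> U \<and> (\<exists>z. ratfun_has_value f x' z \<and> \<bar>z - y\<bar> < 1)" "eval_mpoly q x' \<noteq> 0"
      by (rule near_generically[OF _ generically_nonzero[OF q(1)]])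
    then obtain z z' where z: "ratfun_has_value f x' z" "\<bar>z - y\<bar> < 1" "ratfun_has_value f x' z'" "z' \<in> finite_part"
      using fin[of x'] by (auto simp: U_def)
    then have "z \<in> finite_part" using ratfun_has_value_unique by blast
    then show ?thesis using finite_part_near[of z y] z(2) by (simp add: abs_minus_commute)
  qed
  then show "finitary_at f b" unfolding finitary_at_def using U by blast
qed

text \<open>The common pattern behind the closure properties: near \<open>b\<close> and off one
  hypersurface, the values of the functions in \<open>A\<close> are all finite and the conditions
  \<open>Q\<close> and \<open>R\<close> hold, so the argument becomes one about numbers.\<close>

lemma finitary_at_combine:
  fixes b :: "('a::{linordered_field,linorder_topology}, 'n::{finite,linorder}) vec"
  assumes "finite A" "\<And>f. f \<in> A \<Longrightarrow> finitary_at f b"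
    and "near b Q" "generically R"
    and "\<And>x. Q x \<Longrightarrow> R x \<Longrightarrow> (\<And>f. f \<in> A \<Longrightarrow> \<exists>y. ratfun_has_value f x y \<and> y \<in> finite_part) \<Longrightarrow>
      \<exists>y. ratfun_has_value g x y \<and> y \<in> finite_part"
  shows "finitary_at g b"
proof -
  have "\<forall>f\<in>A. \<exists>q. q \<noteq> 0 \<and> near b (\<lambda>x. eval_mpoly q x \<noteq> 0 \<longrightarrow> (\<exists>y. ratfun_has_value f x y \<and> y \<in> finite_part))"
    using assms(2) unfolding finitary_at_iff_generic by blast
  from bchoice[OF this] obtain q where "\<forall>f\<in>A. q f \<noteq> 0 \<and>
      near b (\<lambda>x. eval_mpoly (q f) x \<noteq> 0 \<longrightarrow> (\<exists>y. ratfun_has_value f x y \<and> y \<in> finite_part))" ..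
  then have q: "\<And>f. f \<in> A \<Longrightarrow> q f \<noteq> 0"
    "\<And>f. f \<in> A \<Longrightarrow> near b (\<lambda>x. eval_mpoly (q f) x \<noteq> 0 \<longrightarrow> (\<exists>y. ratfun_has_value f x y \<and> y \<in> finite_part))"
    by blast+
  obtain r where r: "r \<noteq> 0" "\<And>x. eval_mpoly r x \<noteq> 0 \<Longrightarrow> R x"
    using assms(4) unfolding generically_def by blast
  define p where "p = r * prod q A"
  have "p \<noteq> 0" using q(1) r(1) assms(1) by (simp add: p_def)
  have "near b (\<lambda>x. (\<forall>f\<in>A. eval_mpoly (q f) x \<noteq> 0 \<longrightarrow> (\<exists>y. ratfun_has_value f x y \<and> y \<in> finite_part)) \<and> Q x)"
    by (intro near_conj near_ball assms(1,3) q(2))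
  then have "near b (\<lambda>x. eval_mpoly p x \<noteq> 0 \<longrightarrow> (\<exists>y. ratfun_has_value g x y \<and> y \<in> finite_part))"
  proof (rule near_mono, intro impI)
    fix x
    assume x: "(\<forall>f\<in>A. eval_mpoly (q f) x \<noteq> 0 \<longrightarrow> (\<exists>y. ratfun_has_value f x y \<and> y \<in> finite_part)) \<and> Q x"
      and p: "eval_mpoly p x \<noteq> 0"
    have "eval_mpoly r x \<noteq> 0" "(\<Prod>f\<in>A. eval_mpoly (q f) x) \<noteq> 0"
      using p by (simp_all add: p_def eval_mpoly_simps is_ring_hom_prod[OF is_ring_hom_eval_mpoly])
    then have "\<And>f. f \<in> A \<Longrightarrow> eval_mpoly (q f) x \<noteq> 0" "R x" using assms(1) r(2) by auto
    then show "\<exists>y. ratfun_has_value g x y \<and> y \<in> finite_part" using assms(5) x by blast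
  qed
  then show ?thesis unfolding finitary_at_iff_generic using \<open>p \<noteq> 0\<close> by blast
qed

section \<open>Closure properties of finitary functions\<close>

lemma finitary_at_const:
  fixes b :: "('a::{linordered_field,linorder_topology}, 'n::{finite,linorder}) vec"
  assumes "c \<in> finite_part"
  shows "finitary_at (ratfun_const c) b"
  by (rule finitary_at_combine[of "{}" b "\<lambda>x. True" "\<lambda>x. True"])
    (use assms ratfun_has_value_const in \<open>auto intro: near_True generically_True\<close>)

lemma finitary_at_add:
  fixes b :: "('a::{linordered_field,linorder_topology}, 'n::{finite,linorder}) vec"
  assumes "finitary_at f b" "finitary_at g b"
  shows "finitary_at (f + g) b"
proof (rule finitary_at_combine[of "{f, g}" b "\<lambda>x. True" "\<lambda>x. True"])
  fix x assume "\<And>h. h \<in> {f, g} \<Longrightarrow> \<exists>y. ratfun_has_value h x y \<and> y \<in> finite_part"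
  from this[of f] this[of g] show "\<exists>y. ratfun_has_value (f + g) x y \<and> y \<in> finite_part"
    using ratfun_has_value_add finite_part_closed(1) by blast
qed (use assms in \<open>auto intro: near_True generically_True\<close>)

lemma finitary_at_mult:
  fixes b :: "('a::{linordered_field,linorder_topology}, 'n::{finite,linorder}) vec"
  assumes "finitary_at f b" "finitary_at g b"
  shows "finitary_at (f * g) b"
proof (rule finitary_at_combine[of "{f, g}" b "\<lambda>x. True" "\<lambda>x. True"])
  fix x assume "\<And>h. h \<in> {f, g} \<Longrightarrow> \<exists>y. ratfun_has_value h x y \<and> y \<in> finite_part"
  from this[of f] this[of g] show "\<exists>y. ratfun_has_value (f * g) x y \<and> y \<in> finite_part"
    using ratfun_has_value_mult finite_part_closed(2) by blast
qed (use assms in \<open>auto intro: near_True generically_True\<close>)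

text \<open>By continuity nearby values stay within 1 of \<open>y\<close>. Thus finite values of the
  \<open>g\<close>'s at a single point are enough to place that point in
  \<open>T_set\<close>.\<close>

lemma finitary_at_of_value:
  fixes b :: "('a::{linordered_field,linorder_topology}, 'n::{finite,linorder}) vec"
  assumes "ratfun_has_value f b y" "y \<in> finite_part"
  shows "finitary_at f b"
  by (rule finitary_at_combine[OF _ _ ratfun_has_value_near[OF assms(1) zero_less_one], of "{}" "\<lambda>x. True"])
    (use finite_part_near[OF assms(2)] in \<open>auto intro: generically_True\<close>)

lemma finitary_at_I_set:
  fixes b :: "('a::{linordered_field,linorder_topology}, 'n::{finite,linorder}) vec"
  assumes "\<forall>p\<in>set ps. 0 < eval_mpoly p b" "g \<in> I_set ps"
  shows "finitary_at g b"
proof -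
  obtain f where f: "f \<in> Cone ps" "g = 1 / (1 + f)" using assms(2) unfolding I_set_def by blast
  have "near b (\<lambda>x. \<forall>p\<in>set ps. 0 < eval_mpoly p x)"
    using assms(1) by (intro near_ball near_pos cont_at_eval_mpoly) auto
  then show ?thesis
  proof (rule finitary_at_combine[OF finite.emptyI _ _ Cone_generically_nonneg[OF f(1)], rotated])
    fix x :: "('a, 'n) vec"
    assume "\<forall>p\<in>set ps. 0 < eval_mpoly p x" "(\<forall>p\<in>set ps. 0 < eval_mpoly p x) \<longrightarrow> (\<exists>y\<ge>0. ratfun_has_value f x y)"
    then obtain y where y: "0 \<le> y" "ratfun_has_value f x y" by blast
    have "ratfun_has_value g x (1 / (1 + y))"
      unfolding f(2) using y by (intro ratfun_has_value_divide ratfun_has_value_add ratfun_has_value_1) auto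
    moreover have "\<bar>1 / (1 + y)\<bar> \<le> \<bar>1\<bar>" using y(1) by simp
    ultimately show "\<exists>y. ratfun_has_value g x y \<and> y \<in> finite_part"
      using finite_part_abs_le[OF finite_part_1] by blast
  qed auto
qed

lemma finitary_at_A_alg:
  fixes b :: "('a::{linordered_field,linorder_topology}, 'n::{finite,linorder}) vec"
  assumes "b \<in> T_set ps gs" "f \<in> A_alg ps gs"
  shows "finitary_at f b"
proof -
  have "is_finite_part_subalgebra {f. finitary_at f b}"
    unfolding is_finite_part_subalgebra_def mem_Collect_eq
    using finitary_at_const[OF finite_part_1, of b]
    by (simp add: ratfun_const_simps finitary_at_add finitary_at_mult finitary_at_const)
  moreover have "I_set ps \<union> set gs \<subseteq> {f. finitary_at f b}"
    using assms(1) finitary_at_I_set[of ps b] by (auto simp: T_set_def)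
  ultimately have "A_alg ps gs \<subseteq> {f. finitary_at f b}"
    unfolding A_alg_def by (intro hull_minimal)
  then show ?thesis using assms(2) by blast
qed

text \<open>A denominator takes values \<open>1 + c * z\<close> with \<open>c\<close> infinitesimal
  and \<open>z\<close> finite. These have absolute value above one half, so dividing by them at most
  doubles a value.\<close>

lemma finitary_at_localization:
  fixes b :: "('a::{linordered_field,linorder_topology}, 'n::{finite,linorder}) vec"
  assumes A: "\<And>f. f \<in> A \<Longrightarrow> finitary_at f b" and f: "f \<in> localization_in A (T_mult A)"
  shows "finitary_at f b"
proof -
  obtain u c a where f: "f = u / (1 + ratfun_const c * a)" "u \<in> A" "c \<in> finite_part_max_ideal" "a \<in> A"
    using f unfolding localization_in_def T_mult_def by blast
  show ?thesis
  proof (rule finitary_at_combine[of "{u, a}" b "\<lambda>x. True" "\<lambda>x. True"])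
    fix x assume "\<And>h. h \<in> {u, a} \<Longrightarrow> \<exists>y. ratfun_has_value h x y \<and> y \<in> finite_part"
    from this[of u] this[of a] obtain y z where
      y: "ratfun_has_value u x y" "y \<in> finite_part" and z: "ratfun_has_value a x z" "z \<in> finite_part" by auto
    have small: "\<bar>c * z\<bar> * 2 < 1" using max_ideal_mult_small[OF f(3) z(2)] .
    define v where "v = 1 + c * z"
    have v: "1 < 2 * \<bar>v\<bar>" using small unfolding v_def by (auto simp: abs_if split: if_splits)
    then have "v \<noteq> 0" by auto
    then have "ratfun_has_value f x (y / v)"
      unfolding f(1) v_def using y z
      by (intro ratfun_has_value_divide ratfun_has_value_add ratfun_has_value_1 ratfun_has_value_mult
          ratfun_has_value_const)
    moreover have "\<bar>y / v\<bar> \<le> \<bar>y * of_nat 2\<bar>"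
    proof -
      have "\<bar>y\<bar> * 1 \<le> \<bar>y\<bar> * (2 * \<bar>v\<bar>)" using v by (intro mult_left_mono) auto
      then show ?thesis using \<open>v \<noteq> 0\<close> by (simp add: abs_mult pos_divide_le_eq mult_ac)
    qed
    then have "y / v \<in> finite_part"
      using finite_part_abs_le[OF finite_part_closed(2)[OF y(2) finite_part_of_nat]] by blast
    ultimately show "\<exists>y. ratfun_has_value f x y \<and> y \<in> finite_part" by blast
  qed (use A f in \<open>auto intro: near_True generically_True\<close>)
qed

lemma ratfun_has_value_sum:
  "(\<And>i. i \<in> A \<Longrightarrow> ratfun_has_value (f i) x (y i)) \<Longrightarrow> ratfun_has_value (sum f A) x (sum y A)"
  using ratfun_has_value_const[of 0 x]
  by (induction A rule: infinite_finite_induct) (auto simp: ratfun_const_simps intro: ratfun_has_value_add)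

text \<open>A form of Cauchy's bound for roots: finite coefficients of a monic equation force a
  finite root.\<close>

lemma monic_root_bound:
  fixes y :: "'a::linordered_field"
  assumes "0 < n" "y ^ n + (\<Sum>i<n. c i * y ^ i) = 0"
  shows "\<bar>y\<bar> \<le> 1 + (\<Sum>i<n. \<bar>c i\<bar>)"
proof (cases "\<bar>y\<bar> \<le> 1")
  case True
  moreover have "0 \<le> (\<Sum>i<n. \<bar>c i\<bar>)" by (simp add: sum_nonneg)
  ultimately show ?thesis by linarith
next
  case False
  obtain k where k: "n = Suc k" using assms(1) gr0_conv_Suc by blast
  have "y ^ n = - (\<Sum>i<n. c i * y ^ i)" using assms(2) by (simp add: add_eq_0_iff2)
  then have "\<bar>y\<bar> ^ n = \<bar>\<Sum>i<n. c i * y ^ i\<bar>" by (metis abs_minus_cancel power_abs)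
  also have "\<dots> \<le> (\<Sum>i<n. \<bar>c i * y ^ i\<bar>)" by (rule sum_abs)
  also have "\<dots> \<le> (\<Sum>i<n. \<bar>c i\<bar> * \<bar>y\<bar> ^ k)"
    using False k by (intro sum_mono) (auto simp: abs_mult power_abs intro!: mult_left_mono power_increasing)
  also have "\<dots> = (\<Sum>i<n. \<bar>c i\<bar>) * \<bar>y\<bar> ^ k" by (simp add: sum_distrib_right)
  finally have "\<bar>y\<bar> * \<bar>y\<bar> ^ k \<le> (\<Sum>i<n. \<bar>c i\<bar>) * \<bar>y\<bar> ^ k" by (simp add: k)
  moreover have "0 < \<bar>y\<bar> ^ k" using False by (intro zero_less_power) auto
  ultimately have "\<bar>y\<bar> \<le> (\<Sum>i<n. \<bar>c i\<bar>)" by (simp only: mult_le_cancel_right_pos)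
  then show ?thesis by simp
qed

lemma finitary_at_integral:
  fixes b :: "('a::{linordered_field,linorder_topology}, 'n::{finite,linorder}) vec"
  assumes B: "\<And>f. f \<in> B \<Longrightarrow> finitary_at f b" and h: "h \<in> integral_closure_in B"
  shows "finitary_at h b"
proof -
  obtain P where P: "lead_coeff P = 1" "\<And>i. coeff P i \<in> B" "poly P h = 0"
    using h unfolding integral_closure_in_def by blast
  define n where "n = degree P"
  have n: "0 < n"
  proof (rule ccontr)
    assume "\<not> 0 < n"
    then obtain c where "P = [:c:]" unfolding n_def using degree_eq_zeroE by blast
    then show False using P by simp
  qed
  show ?thesis
  proof (rule finitary_at_combine[of "coeff P ` {..<n}" b "\<lambda>x. True" "\<lambda>x. \<exists>y. ratfun_has_value h x y"])
    fix x assume "\<exists>y. ratfun_has_value h x y"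
      and "\<And>f. f \<in> coeff P ` {..<n} \<Longrightarrow> \<exists>y. ratfun_has_value f x y \<and> y \<in> finite_part"
    then obtain y where y: "ratfun_has_value h x y" and "\<forall>i\<in>{..<n}. \<exists>z. ratfun_has_value (coeff P i) x z \<and> z \<in> finite_part"
      by blast
    then obtain c where c: "\<And>i. i < n \<Longrightarrow> ratfun_has_value (coeff P i) x (c i) \<and> c i \<in> finite_part"
      by (metis lessThan_iff)
    have "poly P h = (\<Sum>i\<le>n. coeff P i * h ^ i)" by (simp add: poly_altdef n_def)
    also have "\<dots> = h ^ n + (\<Sum>i<n. coeff P i * h ^ i)"
      using P(1) by (simp add: n_def lessThan_Suc_atMost[symmetric])
    finally have "h ^ n + (\<Sum>i<n. coeff P i * h ^ i) = 0" using P(3) by simp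
    moreover have "ratfun_has_value (h ^ n + (\<Sum>i<n. coeff P i * h ^ i)) x (y ^ n + (\<Sum>i<n. c i * y ^ i))"
      using c y by (intro ratfun_has_value_add ratfun_has_value_sum ratfun_has_value_mult ratfun_has_value_power) auto
    moreover have "ratfun_has_value 0 x 0" using ratfun_has_value_const[of 0 x] by (simp add: ratfun_const_simps)
    ultimately have "y ^ n + (\<Sum>i<n. c i * y ^ i) = 0" using ratfun_has_value_unique by metis
    then have "\<bar>y\<bar> \<le> 1 + (\<Sum>i<n. \<bar>c i\<bar>)" by (rule monic_root_bound[OF n])
    then have "\<bar>y\<bar> \<le> \<bar>1 + (\<Sum>i<n. \<bar>c i\<bar>)\<bar>" by simp
    moreover have "1 + (\<Sum>i<n. \<bar>c i\<bar>) \<in> finite_part"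
    proof (intro finite_part_closed finite_part_1 finite_part_sum)
      fix i assume "i \<in> {..<n}"
      then have "c i \<in> finite_part" using c by simp
      then show "\<bar>c i\<bar> \<in> finite_part" by (rule finite_part_abs_le) simp
    qed
    ultimately show "\<exists>y. ratfun_has_value h x y \<and> y \<in> finite_part" using y finite_part_abs_le by blast
  qed (use B P(2) in \<open>auto intro: near_True generically_has_value\<close>)
qed

theorem finitary_on_integral_radical:
  fixes ps :: "('a::{linordered_field,linorder_topology}, 'n::{finite,linorder}) mpoly list"
  assumes "h \<in> integral_radical (A_alg ps gs)"
  shows "finitary_on h (T_set ps gs)"
  unfolding finitary_on_def
proof
  fix b assume b: "b \<in> T_set ps gs"
  show "finitary_at h b"
    by (rule finitary_at_integral[OF finitary_at_localization[OF finitary_at_A_alg[OF b]]])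
      (use assms in \<open>simp_all add: integral_radical_def\<close>)
qed

section \<open>The integral radical\<close>

lemma is_finite_part_subalgebra_A_alg: "is_finite_part_subalgebra (A_alg ps gs)"
  unfolding A_alg_def hull_def is_finite_part_subalgebra_def by blast

lemma A_alg_superset: "I_set ps \<subseteq> A_alg ps gs" "set gs \<subseteq> A_alg ps gs"
  using hull_subset[of "I_set ps \<union> set gs" is_finite_part_subalgebra] unfolding A_alg_def by blast+

lemma is_finite_part_subalgebraD:
  fixes A :: "('a::linordered_field, 'n::linorder) ratfun set"
  assumes A: "is_finite_part_subalgebra A"
  shows "1 \<in> A" "x \<in> A \<Longrightarrow> y \<in> A \<Longrightarrow> x + y \<in> A" "x \<in> A \<Longrightarrow> y \<in> A \<Longrightarrow> x * y \<in> A"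
    "c \<in> finite_part \<Longrightarrow> ratfun_const c \<in> A" "x \<in> A \<Longrightarrow> - x \<in> A" "x \<in> A \<Longrightarrow> y \<in> A \<Longrightarrow> x - y \<in> A"
    "x \<in> A \<Longrightarrow> x ^ n \<in> A" "0 \<in> A"
proof -
  show one: "1 \<in> A" and add: "x \<in> A \<Longrightarrow> y \<in> A \<Longrightarrow> x + y \<in> A" and mult: "x \<in> A \<Longrightarrow> y \<in> A \<Longrightarrow> x * y \<in> A" for x y
    using A unfolding is_finite_part_subalgebra_def by blast+
  have sm: "c \<in> finite_part \<Longrightarrow> x \<in> A \<Longrightarrow> ratfun_const c * x \<in> A" for c x
    using A unfolding is_finite_part_subalgebra_def by blast
  show "ratfun_const c \<in> A" if "c \<in> finite_part" using sm[OF that one] by simp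
  have "- 1 \<in> (finite_part :: 'a set)" using finite_part_closed(3)[OF finite_part_1 finite_part_1] .
  then show minus: "- x \<in> A" if "x \<in> A" for x using sm[OF _ that, of "- 1"] by (simp add: ratfun_const_simps)
  show "x - y \<in> A" if "x \<in> A" "y \<in> A" using add[OF that(1) minus[OF that(2)]] by simp
  show "x ^ n \<in> A" if "x \<in> A" by (induction n) (auto simp: one mult that)
  show "0 \<in> A" using sm[OF finite_part_0 one] by (simp add: ratfun_const_simps)
qed

lemma max_ideal_0: "0 \<in> finite_part_max_ideal"
  by (simp add: finite_part_max_ideal_iff)

lemma max_ideal_uminus: "m \<in> finite_part_max_ideal \<Longrightarrow> - m \<in> finite_part_max_ideal"
  by (simp add: finite_part_max_ideal_iff)

lemma localization_superset:
  assumes A: "is_finite_part_subalgebra A" and "x \<in> A"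
  shows "x \<in> localization_in A (T_mult A)"
proof -
  have "1 + ratfun_const 0 * 1 \<in> T_mult A"
    unfolding T_mult_def using max_ideal_0 is_finite_part_subalgebraD(1)[OF A] by blast
  then have "1 \<in> T_mult A" by (simp add: ratfun_const_simps)
  moreover have "x = x / 1" by simp
  ultimately show ?thesis unfolding localization_in_def using assms(2) one_neq_zero by blast
qed

text \<open>\<open>- h\<close> is the constant coefficient of the monic polynomial
  \<open>X - h\<close>.\<close>

lemma integral_radicalI:
  assumes A: "is_finite_part_subalgebra A" and h: "- h \<in> localization_in A (T_mult A)"
  shows "h \<in> integral_radical A"
proof -
  have 01: "0 \<in> localization_in A (T_mult A)" "1 \<in> localization_in A (T_mult A)"
    using is_finite_part_subalgebraD(1,8)[OF A] by (auto intro: localization_superset[OF A])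
  have "coeff [:- h, 1:] i \<in> localization_in A (T_mult A)" for i
    using h 01 by (auto simp: coeff_pCons split: nat.splits)
  then show ?thesis
    unfolding integral_radical_def integral_closure_in_def by (intro CollectI exI[of _ "[:- h, 1:]"]) simp
qed

text \<open>Here integral closure does real work: the localization is shown to contain
  \<open>h * h\<close>, and \<open>h\<close> is reached only as a root of
  \<open>X * X - h * h\<close>.\<close>

lemma integral_radical_square_rootI:
  assumes A: "is_finite_part_subalgebra A" and h: "- (h * h) \<in> localization_in A (T_mult A)"
  shows "h \<in> integral_radical A"
proof -
  have 01: "0 \<in> localization_in A (T_mult A)" "1 \<in> localization_in A (T_mult A)"
    using is_finite_part_subalgebraD(1,8)[OF A] by (auto intro: localization_superset[OF A])
  have "coeff [:- (h * h), 0, 1:] i \<in> localization_in A (T_mult A)" for i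
    using h 01 by (auto simp: coeff_pCons split: nat.splits)
  then show ?thesis
    unfolding integral_radical_def integral_closure_in_def
    by (intro CollectI exI[of _ "[:- (h * h), 0, 1:]"]) simp
qed

text \<open>The factor \<open>q\<close> in the denominator makes its nonvanishing imply that of
  \<open>q\<close>.\<close>

lemma common_denominator:
  fixes f g :: "'d::idom fract"
  assumes "q \<noteq> 0"
  obtains a b d where "d \<noteq> 0" "f = Fract a (d * q)" "g = Fract b (d * q)"
proof -
  obtain a1 d1 where 1: "f = Fract a1 d1" "d1 \<noteq> 0" by (cases f) auto
  obtain a2 d2 where 2: "g = Fract a2 d2" "d2 \<noteq> 0" by (cases g) auto
  have "f = Fract (a1 * (d2 * q)) (d1 * d2 * q)" "g = Fract (a2 * (d1 * q)) (d1 * d2 * q)"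
    using 1 2 assms by (simp_all add: eq_fract mult_ac)
  then show thesis using that[of "d1 * d2"] 1 2 by simp
qed

text \<open>\<open>2 h / (1 + h\<^sup>2) = 1 - 2 / (1 + v\<^sup>2)\<close> with \<open>v = (1 + h) / (1 - h)\<close>.\<close>

lemma divide_one_plus_square_in_A_alg:
  fixes h :: "('a::linordered_field, 'n::{finite,linorder}) ratfun"
  assumes "- 1 \<notin> Cone ps"
  shows "1 / (1 + h * h) \<in> A_alg ps gs" "h / (1 + h * h) \<in> A_alg ps gs"
proof -
  note A = is_finite_part_subalgebraD[OF is_finite_part_subalgebra_A_alg[of ps gs]]
  have nz: "1 + x * x \<noteq> 0" for x :: "('a, 'n) ratfun"
  proof
    assume "1 + x * x = 0"
    then have "x * x = - 1" by (simp add: add_eq_0_iff)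
    then show False using assms is_positive_coneD(1)[OF is_positive_cone_Cone] by metis
  qed
  have I: "1 / (1 + x * x) \<in> A_alg ps gs" for x :: "('a, 'n) ratfun"
    using A_alg_superset(1)[of ps gs] is_positive_coneD(1)[OF is_positive_cone_Cone] nz
    unfolding I_set_def by blast
  show "1 / (1 + h * h) \<in> A_alg ps gs" by (rule I)
  note two = ratfun_two_neq_0[where 'a = 'a and 'n = 'n]
  have half: "(1/2 :: 'a) \<in> finite_part"
    by (rule finite_part_abs_le[OF finite_part_1]) simp
  have half2: "ratfun_const (1/2) * 2 = (1 :: ('a, 'n) ratfun)"
  proof -
    have "ratfun_const (1/2) * 2 = ratfun_const (1/2) * (ratfun_const (of_nat 2) :: ('a, 'n) ratfun)"
      unfolding ratfun_const_simps by simp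
    also have "\<dots> = ratfun_const (1/2 * of_nat 2)" by (simp only: ratfun_const_simps)
    finally show ?thesis by (simp add: ratfun_const_simps)
  qed
  show "h / (1 + h * h) \<in> A_alg ps gs"
  proof (cases "h = 1")
    \<comment> \<open>Here \<open>v\<close> would have denominator 0, but
      \<open>h / (1 + h * h)\<close> is itself of the form \<open>1 / (1 + x * x)\<close>.\<close>
    case True
    then show ?thesis using I[of 1] by simp
  next
    case False
    define v where "v = (1 + h) / (1 - h)"
    have d: "1 - h \<noteq> 0" using False by simp
    have "1 + v * v = ((1 - h) * (1 - h)) / ((1 - h) * (1 - h)) + ((1 + h) * (1 + h)) / ((1 - h) * (1 - h))"
      using d by (simp add: v_def)
    also have "\<dots> = ((1 - h) * (1 - h) + (1 + h) * (1 + h)) / ((1 - h) * (1 - h))"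
      by (rule add_divide_distrib[symmetric])
    also have "(1 - h) * (1 - h) + (1 + h) * (1 + h) = 2 * (1 + h * h)" by (simp add: algebra_simps)
    finally have "1 / (1 + v * v) = ((1 - h) * (1 - h)) / (2 * (1 + h * h))" by simp
    then have "2 * (1 / (1 + v * v)) = (2 * ((1 - h) * (1 - h))) / (2 * (1 + h * h))"
      by (simp only: times_divide_eq_right)
    also have "\<dots> = ((1 - h) * (1 - h)) / (1 + h * h)"
      by (rule nonzero_mult_divide_mult_cancel_left[OF two])
    finally have "1 - 2 * (1 / (1 + v * v)) = ((1 + h * h) - (1 - h) * (1 - h)) / (1 + h * h)"
      using nz[of h] by (simp add: diff_divide_distrib)
    also have "(1 + h * h) - (1 - h) * (1 - h) = 2 * h" by (simp add: algebra_simps)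
    finally have "h / (1 + h * h) = ratfun_const (1/2) * (1 - 2 * (1 / (1 + v * v)))"
      using half2 by (simp flip: mult.assoc)
    also have "2 * (1 / (1 + v * v)) = 1 / (1 + v * v) + 1 / (1 + v * v)" by (simp only: mult_2)
    also have "ratfun_const (1/2) * (1 - (1 / (1 + v * v) + 1 / (1 + v * v))) \<in> A_alg ps gs"
      by (intro A I half)
    finally show ?thesis .
  qed
qed

text \<open>A cone containing \<open>- 1\<close> contains every \<open>f\<close>, in particular
  \<open>1 / h - 1\<close>, for which \<open>1 / (1 + f)\<close> is \<open>h\<close>.\<close>

lemma improper_cone_A_alg:
  fixes h :: "('a::linordered_field, 'n::{finite,linorder}) ratfun"
  assumes "- 1 \<in> Cone ps"
  shows "h \<in> A_alg ps gs"
proof (cases "h = 0")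
  case True
  then show ?thesis using is_finite_part_subalgebraD(8)[OF is_finite_part_subalgebra_A_alg] by simp
next
  case False
  note D = is_positive_coneD[OF is_positive_cone_Cone[of ps]]
  define f where "f = 1 / h - 1"
  have "f = ((f + 1) / 2) * ((f + 1) / 2) + (- 1) * (((f - 1) / 2) * ((f - 1) / 2))"
    using eq_diff_squares[OF ratfun_two_neq_0, of f] by simp
  also have "\<dots> \<in> Cone ps" using assms D(1-3) by blast
  finally have "f \<in> Cone ps" .
  moreover have "1 + f = 1 / h" by (simp add: f_def)
  ultimately have "1 / (1 + f) \<in> I_set ps" using False unfolding I_set_def by force
  then have "h \<in> I_set ps" using \<open>1 + f = 1 / h\<close> by simp
  then show ?thesis using A_alg_superset(1) by blast
qed

lemma ratfun_has_value_sum_list_squares: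
  assumes "\<And>f. f \<in> set gs \<Longrightarrow> ratfun_has_value f x (y f)"
  shows "ratfun_has_value (\<Sum>f\<leftarrow>gs. f * f) x (\<Sum>f\<leftarrow>gs. y f * y f)"
  using assms ratfun_has_value_const[of 0 x]
  by (induction gs) (auto simp: ratfun_const_simps intro!: ratfun_has_value_add ratfun_has_value_mult)

lemma sum_list_squares_ge:
  fixes y :: "'b \<Rightarrow> 'a::linordered_field"
  shows "0 \<le> (\<Sum>f\<leftarrow>gs. y f * y f)" "f \<in> set gs \<Longrightarrow> y f * y f \<le> (\<Sum>f\<leftarrow>gs. y f * y f)"
  by (induction gs) (auto simp: add_increasing add_increasing2)

text \<open>The common denominator is a multiple of \<open>r\<close>, so that off its zeros all of
  \<open>gs\<close> and \<open>h\<close> have values. A finite value of \<open>g\<close> bounds each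
  square in the sum; every member of \<open>gs\<close> then has a finite value, the point lies in
  \<open>T_set\<close>, and \<open>h\<close> is finite there.\<close>

lemma finitary_bound:
  fixes ps :: "('a::{linordered_field,linorder_topology}, 'n::{finite,linorder}) mpoly list"
  assumes rc: "real_closed TYPE('a)" and na: "non_archimedean TYPE('a)"
    and fin: "finitary_on h (T_set ps gs)"
  defines "g \<equiv> 1 + (\<Sum>f\<leftarrow>gs. f * f)"
  obtains N k :: nat and c q where "0 < k" "infinite_elt c" "q \<noteq> 0"
    "\<And>b. (\<And>p. p \<in> set ps \<Longrightarrow> 0 < eval_mpoly p b) \<Longrightarrow> eval_mpoly q b \<noteq> 0 \<Longrightarrow>
      \<exists>G H. ratfun_has_value g b G \<and> ratfun_has_value (h * h) b H \<and> 1 \<le> G \<and> 0 \<le> H \<and>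
        (G \<le> c \<longrightarrow> H \<le> of_nat N * G ^ k)"
proof -
  have "generically (\<lambda>x. (\<forall>f\<in>set gs. \<exists>y. ratfun_has_value f x y) \<and> (\<exists>y. ratfun_has_value h x y))"
    by (intro generically_conj generically_ball generically_has_value) simp
  then obtain r where r: "r \<noteq> 0" "\<And>x. eval_mpoly r x \<noteq> 0 \<Longrightarrow>
      (\<forall>f\<in>set gs. \<exists>y. ratfun_has_value f x y) \<and> (\<exists>y. ratfun_has_value h x y)"
    unfolding generically_def by blast
  obtain ga ha d0 where d0: "d0 \<noteq> 0" "g = Fract ga (d0 * r)" "h * h = Fract ha (d0 * r)"
    by (rule common_denominator[OF r(1)])
  define d where "d = d0 * r"
  have "d \<noteq> 0" using d0 r by (simp add: d_def)
  have rd: "eval_mpoly r b \<noteq> 0" if "eval_mpoly d b \<noteq> 0" for b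
    using that by (auto simp: d_def eval_mpoly_simps)
  have valg: "ratfun_has_value g b (eval_mpoly ga b / eval_mpoly d b)"
    and valH: "ratfun_has_value (h * h) b (eval_mpoly ha b / eval_mpoly d b)" if "eval_mpoly d b \<noteq> 0" for b
    using that ratfun_has_valueI[of d b] by (simp_all add: d0(2,3) d_def)
  have vals: "\<exists>y z. (\<forall>f\<in>set gs. ratfun_has_value f b (y f)) \<and> ratfun_has_value h b z \<and>
      eval_mpoly ga b / eval_mpoly d b = 1 + (\<Sum>f\<leftarrow>gs. y f * y f) \<and> eval_mpoly ha b / eval_mpoly d b = z * z"
    if d: "eval_mpoly d b \<noteq> 0" for b
  proof -
    have "\<forall>f\<in>set gs. \<exists>y. ratfun_has_value f b y" using r(2)[OF rd[OF d]] by blast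
    from bchoice[OF this] obtain y where y: "\<forall>f\<in>set gs. ratfun_has_value f b (y f)" ..
    obtain z where z: "ratfun_has_value h b z" using r(2)[OF rd[OF d]] by blast
    have "ratfun_has_value g b (1 + (\<Sum>f\<leftarrow>gs. y f * y f))"
      unfolding g_def using y by (intro ratfun_has_value_add ratfun_has_value_1 ratfun_has_value_sum_list_squares) blast
    then have "eval_mpoly ga b / eval_mpoly d b = 1 + (\<Sum>f\<leftarrow>gs. y f * y f)"
      using valg[OF d] ratfun_has_value_unique by blast
    moreover have "eval_mpoly ha b / eval_mpoly d b = z * z"
      using valH[OF d] ratfun_has_value_mult[OF z z] ratfun_has_value_unique by blast
    ultimately show ?thesis using y z by blast
  qed
  have g1: "1 \<le> eval_mpoly ga b / eval_mpoly d b" and H0: "0 \<le> eval_mpoly ha b / eval_mpoly d b"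
    if d: "eval_mpoly d b \<noteq> 0" for b
  proof -
    obtain y z where *: "eval_mpoly ga b / eval_mpoly d b = 1 + (\<Sum>f\<leftarrow>gs. y f * y f)"
        "eval_mpoly ha b / eval_mpoly d b = z * z"
      using vals[OF d] by blast
    show "1 \<le> eval_mpoly ga b / eval_mpoly d b" "0 \<le> eval_mpoly ha b / eval_mpoly d b"
      unfolding * using sum_list_squares_ge(1)[of y gs] by simp_all
  qed
  have fin': "eval_mpoly ha b / eval_mpoly d b \<in> finite_part"
    if ps: "\<And>p. p \<in> set ps \<Longrightarrow> 0 < eval_mpoly p b" and d: "eval_mpoly d b \<noteq> 0"
      and f: "eval_mpoly ga b / eval_mpoly d b \<in> finite_part" for b
  proof -
    obtain y z where y: "\<forall>f\<in>set gs. ratfun_has_value f b (y f)" and z: "ratfun_has_value h b z"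
      and G: "eval_mpoly ga b / eval_mpoly d b = 1 + (\<Sum>f\<leftarrow>gs. y f * y f)"
      and H: "eval_mpoly ha b / eval_mpoly d b = z * z"
      using vals[OF d] by blast
    have "finitary_at u b" if u: "u \<in> set gs" for u
    proof -
      have "y u * y u \<le> 1 + (\<Sum>f\<leftarrow>gs. y f * y f)" using sum_list_squares_ge(2)[OF u, of y] by simp
      then have "y u \<in> finite_part" using finite_part_square_le[OF f] unfolding G by blast
      then show ?thesis using finitary_at_of_value y u by blast
    qed
    then have "b \<in> T_set ps gs" using ps by (simp add: T_set_def)
    then have "finitary_at h b" using fin unfolding finitary_on_def by blast
    then have "z \<in> finite_part" using z unfolding finitary_at_def by blast
    then show ?thesis unfolding H using finite_part_closed(2) by blast
  qed
  obtain N k :: nat and c where k: "0 < k" and c: "infinite_elt c" and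
    bound: "\<And>b. (\<And>p. p \<in> set ps \<Longrightarrow> 0 < eval_mpoly p b) \<Longrightarrow> eval_mpoly d b \<noteq> 0 \<Longrightarrow>
      eval_mpoly ga b / eval_mpoly d b \<le> c \<Longrightarrow>
      eval_mpoly ha b / eval_mpoly d b \<le> of_nat N * (eval_mpoly ga b / eval_mpoly d b) ^ k"
    by (rule polynomial_bound_up_to_infinite[OF rc na, of ps d ga ha]) (use g1 fin' in blast)+
  show thesis
  proof (rule that[OF k c \<open>d \<noteq> 0\<close>])
    fix b assume "\<And>p. p \<in> set ps \<Longrightarrow> 0 < eval_mpoly p b" "eval_mpoly d b \<noteq> 0"
    then show "\<exists>G H. ratfun_has_value g b G \<and> ratfun_has_value (h * h) b H \<and> 1 \<le> G \<and> 0 \<le> H \<and>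
        (G \<le> c \<longrightarrow> H \<le> of_nat N * G ^ k)"
      using valg valH g1 H0 bound by blast
  qed
qed

theorem finitary_imp_integral_radical:
  fixes ps :: "('a::{linordered_field,linorder_topology}, 'n::{finite,linorder}) mpoly list"
  assumes rc: "real_closed TYPE('a)" and na: "non_archimedean TYPE('a)"
    and ps: "\<forall>p\<in>set ps. p \<noteq> 0" and fin: "finitary_on h (T_set ps gs)"
  shows "h \<in> integral_radical (A_alg ps gs)"
proof (cases "- 1 \<in> Cone ps")
  case True
  then show ?thesis
    by (intro integral_radicalI localization_superset is_finite_part_subalgebra_A_alg improper_cone_A_alg)
next
  case proper: False
  define A where "A = A_alg ps gs"
  have subalg: "is_finite_part_subalgebra A" unfolding A_def by (rule is_finite_part_subalgebra_A_alg)
  note AD = is_finite_part_subalgebraD[OF subalg]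
  note CD = is_positive_coneD[OF is_positive_cone_Cone[of ps]]
  define g where "g = 1 + (\<Sum>f\<leftarrow>gs. f * f)"
  define H where "H = h * h"
  have "(\<Sum>f\<leftarrow>xs. f * f) \<in> A" if "set xs \<subseteq> A" for xs
    using that by (induction xs) (auto simp: AD)
  then have gA: "g \<in> A" using A_alg_superset(2)[where ps = ps and gs = gs] by (auto simp: g_def A_def intro!: AD[unfolded A_def])
  obtain N k c q where k: "0 < k" and c: "infinite_elt c" and q: "q \<noteq> 0" and
    bound: "\<And>b. (\<And>p. p \<in> set ps \<Longrightarrow> 0 < eval_mpoly p b) \<Longrightarrow> eval_mpoly q b \<noteq> 0 \<Longrightarrow>
      \<exists>G H. ratfun_has_value g b G \<and> ratfun_has_value (h * h) b H \<and> 1 \<le> G \<and> 0 \<le> H \<and>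
        (G \<le> c \<longrightarrow> H \<le> of_nat N * G ^ k)"
    unfolding g_def by (rule finitary_bound[OF rc na fin]) blast
  \<comment> \<open>Chosen so that \<open>m * c ^ k = 1\<close>: the value of
    \<open>m * g ^ k\<close> is at most 1 only where \<open>g \<le> c\<close>. Since
    \<open>k\<close> is positive, \<open>c ^ k\<close> is infinite and \<open>m\<close>
    infinitesimal.\<close>
  define m where "m = inverse (c ^ k)"
  have c1: "1 \<le> c" using infinite_elt_ge_1[OF c] .
  have mpos: "0 < m" using c1 by (simp add: m_def)
  have m: "m \<in> finite_part_max_ideal"
    unfolding finite_part_max_ideal_iff
  proof
    fix n :: nat
    have "c ^ 1 \<le> c ^ k" using c1 k by (intro power_increasing) auto
    then have "of_nat n < c ^ k" using c unfolding infinite_elt_def by (metis order.strict_trans2 power_one_right)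
    moreover have "0 < c ^ k" using c1 by simp
    ultimately show "of_nat n * \<bar>m\<bar> < 1"
      using mpos by (simp add: m_def abs_of_pos flip: divide_inverse)
  qed
  define w where "w = ratfun_const m * g ^ k"
  define U where "U = ratfun_const (of_nat N) * g ^ k * (1 + w * w)"
  define f where "f = U - H * (1 - w)"
  have fC: "f \<in> Cone ps"
  proof (rule nonneg_imp_in_Cone[OF rc _ q])
    show "p \<noteq> 0" if "p \<in> set ps" for p using ps that by blast
    fix b y
    assume pos: "\<And>p. p \<in> set ps \<Longrightarrow> 0 < eval_mpoly p b" and qb: "eval_mpoly q b \<noteq> 0"
      and y: "ratfun_has_value f b y"
    obtain G Hb where G: "ratfun_has_value g b G" and Hb: "ratfun_has_value (h * h) b Hb"
      and ge: "1 \<le> G" "0 \<le> Hb" and le: "G \<le> c \<Longrightarrow> Hb \<le> of_nat N * G ^ k"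
      using bound[OF pos qb] by blast
    define W where "W = m * G ^ k"
    have vw: "ratfun_has_value w b W"
      unfolding w_def W_def by (intro ratfun_has_value_mult ratfun_has_value_const ratfun_has_value_power G)
    have "ratfun_has_value f b (of_nat N * G ^ k * (1 + W * W) - Hb * (1 - W))"
      unfolding f_def U_def H_def
      by (intro ratfun_has_value_diff ratfun_has_value_mult ratfun_has_value_add ratfun_has_value_const
          ratfun_has_value_power ratfun_has_value_1 G Hb vw)
    then have yeq: "y = of_nat N * G ^ k * (1 + W * W) - Hb * (1 - W)"
      using y ratfun_has_value_unique by blast
    have NG: "0 \<le> of_nat N * G ^ k" using ge by simp
    \<comment> \<open>For \<open>W \<le> 1\<close> one has \<open>G \<le> c\<close>, and the bound
      on \<open>Hb\<close> applies. For \<open>W > 1\<close> the subtracted term is nonpositive,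
      whatever the size of \<open>Hb\<close>.\<close>
    show "0 \<le> y"
    proof (cases "W \<le> 1")
      case True
      have "G \<le> c"
      proof (rule ccontr)
        assume "\<not> G \<le> c"
        then have "c ^ k < G ^ k" using c1 k by (intro power_strict_mono) auto
        then have "m * c ^ k < W" unfolding W_def using mpos by (intro mult_strict_left_mono)
        then show False using True c1 by (simp add: m_def)
      qed
      then have "Hb * (1 - W) \<le> of_nat N * G ^ k * (1 - W)" using le True by (intro mult_right_mono) auto
      also have "0 \<le> W" unfolding W_def using mpos ge by simp
      then have "1 - W \<le> 1 + W * W" using mult_nonneg_nonneg[of W W] by linarith
      then have "of_nat N * G ^ k * (1 - W) \<le> of_nat N * G ^ k * (1 + W * W)" using NG by (intro mult_left_mono)
      finally show ?thesis by (simp add: yeq)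
    next
      case False
      then have "Hb * (1 - W) \<le> 0" using ge(2) by (intro mult_nonneg_nonpos) auto
      moreover have "0 \<le> of_nat N * G ^ k * (1 + W * W)" by (rule mult_nonneg_nonneg[OF NG]) simp
      ultimately show ?thesis by (simp add: yeq)
    qed
  qed
  have nz: "1 + u \<noteq> 0" if "u \<in> Cone ps" for u using proper that by (metis add_eq_0_iff minus_minus)
  have inv: "1 / (1 + u) \<in> A" if "u \<in> Cone ps" for u
    using A_alg_superset(1)[of ps gs] nz[OF that] that unfolding I_set_def A_def by blast
  define z where "z = 1 / (1 + H)"
  have HC: "H \<in> Cone ps" unfolding H_def by (rule CD)
  have zA: "z \<in> A" unfolding z_def by (rule inv[OF HC])
  have zC: "z \<in> Cone ps" unfolding z_def using CD(7)[OF CD(2)[OF CD(5) HC]] by (simp add: inverse_eq_divide)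
  have z1: "z * (1 + H) = 1" "z \<noteq> 0" using nz[OF HC] by (simp_all add: z_def)
  define e where "e = 1 / (1 + f * z)"
  have fz: "f * z \<in> Cone ps" using fC zC by (rule CD)
  have eA: "e \<in> A" unfolding e_def by (rule inv[OF fz])
  have e1: "e * (1 + f * z) = 1" using nz[OF fz] by (simp add: e_def)
  define a where "a = g ^ k * e"
  define a' where "a' = (U + 1 - w) * e"
  define s where "s = 1 + ratfun_const (- m) * a"
  have mfin: "m \<in> finite_part" using m by (simp add: finite_part_max_ideal_def)
  have wA: "w \<in> A" unfolding w_def by (intro AD mfin gA)
  have aA: "a \<in> A" unfolding a_def by (intro AD gA eA)
  have a'A: "a' \<in> A" unfolding a'_def U_def by (intro AD gA eA wA finite_part_of_nat)
  have sT: "s \<in> T_mult A" unfolding s_def T_mult_def using max_ideal_uminus[OF m] aA by blast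
  have sA: "s \<in> A" unfolding s_def by (intro AD aA finite_part_closed(3)[OF mfin mfin])
  have "z * (U + 1 - w) = (1 - w) * (z * (1 + H)) + f * z"
    by (simp add: f_def algebra_simps)
  then have "z * a' = ((1 - w) + f * z) * e" by (simp add: a'_def z1(1) flip: mult.assoc)
  also have "\<dots> = e * (1 + f * z) - w * e" by (simp add: algebra_simps)
  also have "\<dots> = s" by (simp add: e1 s_def a_def w_def ratfun_const_simps mult.assoc)
  finally have za: "z * a' = s" .
  show ?thesis
  proof (cases "s = 0")
    case False
    have "(1 + H) * s = (z * (1 + H)) * a'" unfolding za[symmetric] by (simp only: mult_ac)
    then have "a' = (1 + H) * s" by (simp add: z1(1))
    \<comment> \<open>Since \<open>1 + H = a' / s\<close>, this writes \<open>- H\<close> as one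
      fraction over the denominator \<open>s\<close>.\<close>
    then have "- H = (s - a') / s" using False by (simp add: diff_divide_distrib)
    then have "- H \<in> localization_in A (T_mult A)"
      unfolding localization_in_def using AD(6)[OF sA a'A] sT False by blast
    then show ?thesis
      unfolding H_def A_def[symmetric] by (rule integral_radical_square_rootI[OF subalg])
  next
    \<comment> \<open>If \<open>s = 0\<close> it cannot serve as a denominator. But then the
      infinitesimal \<open>m\<close> has an inverse in \<open>A\<close>, so every element of
      \<open>A\<close> has the form \<open>1 + m * a * (x - 1)\<close> and belongs to
      \<open>T_mult A\<close>. In particular \<open>z\<close> can be inverted, and \<open>h\<close>
      is the quotient of \<open>h / (1 + h * h)\<close> by \<open>z\<close>.\<close>
    case True
    then have ma: "ratfun_const m * a = 1" by (simp add: s_def ratfun_const_simps)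
    have "x \<in> T_mult A" if "x \<in> A" for x
    proof -
      have "x = 1 + (ratfun_const m * a) * (x - 1)" unfolding ma by simp
      then have "x = 1 + ratfun_const m * (a * (x - 1))" by (simp only: mult.assoc)
      moreover have "a * (x - 1) \<in> A" using that aA by (intro AD)
      ultimately show ?thesis unfolding T_mult_def using m by blast
    qed
    then have "z \<in> T_mult A" using zA by blast
    moreover have "h / (1 + h * h) \<in> A"
      unfolding A_def by (rule divide_one_plus_square_in_A_alg(2)[OF proper])
    then have "- (h / (1 + h * h)) \<in> A" by (rule AD)
    moreover have "- h = - (h / (1 + h * h)) / z" using nz[OF HC] by (simp add: z_def H_def)
    ultimately have "- h \<in> localization_in A (T_mult A)"
      unfolding localization_in_def using z1(2) by blast
    then show ?thesis unfolding A_def[symmetric] by (rule integral_radicalI[OF subalg])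
  qed
qed

theorem theorem4p1:
  fixes ps :: "('a::{linordered_field,linorder_topology}, 'n::{finite,linorder}) mpoly list"
    and gs :: "('a, 'n) ratfun list"
    and h :: "('a, 'n) ratfun"
  assumes "real_closed TYPE('a)"
    and "non_archimedean TYPE('a)"
    and "\<forall>p\<in>set ps. p \<noteq> 0"
  shows "finitary_on h (T_set ps gs) \<longleftrightarrow> h \<in> integral_radical (A_alg ps gs)"
  using finitary_imp_integral_radical[OF assms] finitary_on_integral_radical by blast

end
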